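(* Let $r\ge2$ and let $L$ be an abstract algebraic lamination on $F_r$. Let $T_1,T_2\in\mathrm{cv}_r$ and let $\Gamma_1=T_1/F_r$, $\Gamma_2=T_2/F_r$ be the quotient marked metric graphs with the induced metric structures $\mathfrak J_1$ and $\mathfrak J_2$ respectively. Then: (1) $\beta_{L_{\Gamma_1}}(n)\sim\beta_{L_{\Gamma_2}}(n)$; (2) $\beta_{L_{\Gamma_1},\mathfrak J_1}(n)\sim\beta_{L_{\Gamma_2},\mathfrak J_2}(n)$.
   Context: **Laminations.** $F_r$ is the free group of rank $r\ge2$, $\partial F_r$ its hyperbolic boundary, $\partial^2F_r=\{(p,q)\in\partial F_r\times\partial F_r:p\ne q\}$. An abstract algebraic lamination on $F_r$ is a subset $L\subseteq\partial^2F_r$ closed in $\partial^2F_r$, invariant under the diagonal $F_r$-action and under $(p,q)\mapsto(q,p)$. **Outer space.** $\mathrm{cv}_r$ is the set of $\mathbb R$-trees $T$ with a minimal nontrivial free discrete isometric $F_r$-action (up to $F_r$-equivariant isometry). For $T\in\mathrm{cv}_r$, $\Gamma=T/F_r$ is a finite connected graph, all vertices of degree $\ge3$, with an identification (marking) $\pi_1(\Gamma)=F_r$ and an induced metric structure $\mathfrak J$ giving every edge $e$ a length $\mathfrak J(e)>0$; $\partial T$ is identified with $\partial F_r$. $E\Gamma$ is the set of oriented edges. For an edge-path $\gamma$, $|\gamma|$ is the number of edges and $\mathfrak J(\gamma)$ the sum of the lengths of its edges. **Laminary language.** $L_\Gamma\subseteq(E\Gamma)^*$ is the set of all finite edge-paths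 $\gamma$ in $\Gamma$ with $|\gamma|>0$ having a lift to $T$ that is a subpath of the bi-infinite geodesic in $T$ from $p$ to $q$ for some $(p,q)\in L$. For $n\ge1$, $\beta_{L_\Gamma}(n)=\#\{\gamma\in L_\Gamma:|\gamma|\le n\}$ and $\beta_{L_\Gamma,\mathfrak J}(n)=\#\{\gamma\in L_\Gamma:\mathfrak J(\gamma)\le n\}$ (both set to $0$ at $n=0$). **Equivalence.** For monotone non-decreasing $f,g:\mathbb N\to\mathbb N$, $f\sim g$ means there is an integer $C\ge1$ such that $f(n)\le Cg(Cn)$ and $g(n)\le Cf(Cn)$ for all $n\ge1$. *)

theory Defs
  imports "HOL-Analysis.Analysis" "HOL-Algebra.Group_Action" "Graph_Theory.Arc_Walk"
begin

section \<open>The free group of rank \<open>r\<close>\<close>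

text \<open>The letter \<open>(i, True)\<close> is the basis element with index \<open>i\<close>, and \<open>(i, False)\<close> is its inverse.\<close>

type_synonym letter = "nat \<times> bool"
type_synonym word = "letter list"

definition inv_letter :: "letter \<Rightarrow> letter" where
  "inv_letter a = (fst a, \<not> snd a)"

definition reduced_word :: "word \<Rightarrow> bool" where
  "reduced_word w \<longleftrightarrow> successively (\<lambda>a b. b \<noteq> inv_letter a) w"

text \<open>Left multiplication of a reduced word by a letter, with cancellation.\<close>

definition cons_red :: "letter \<Rightarrow> word \<Rightarrow> word" where
  "cons_red a w = (case w of [] \<Rightarrow> [a] | b # v \<Rightarrow> if b = inv_letter a then v else a # w)"

definition free_group :: "nat \<Rightarrow> word monoid" where
  "free_group r =
     \<lparr>carrier = {w. reduced_word w \<and> fst ` set w \<subseteq> {..<r}},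
      mult = foldr cons_red,
      one = []\<rparr>"

lemma inv_letter_inv_letter [simp]: "inv_letter (inv_letter a) = a"
  by (simp add: inv_letter_def)

lemma fst_inv_letter [simp]: "fst (inv_letter a) = fst a"
  by (simp add: inv_letter_def)

lemma inv_letter_neq [simp]: "inv_letter a \<noteq> a" "a \<noteq> inv_letter a"
  by (simp_all add: inv_letter_def prod_eq_iff)

lemma reduced_Nil [simp]: "reduced_word []"
  by (simp add: reduced_word_def)

lemma reduced_Cons: "reduced_word (a # w) \<longleftrightarrow> reduced_word w \<and> (w = [] \<or> hd w \<noteq> inv_letter a)"
  by (cases w) (auto simp: reduced_word_def)

lemma reduced_cons_red: "reduced_word w \<Longrightarrow> reduced_word (cons_red a w)"
  by (cases w) (auto simp: cons_red_def reduced_Cons)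

lemma reduced_foldr_cons_red: "reduced_word w \<Longrightarrow> reduced_word (foldr cons_red v w)"
  by (induction v) (auto simp: reduced_cons_red)

lemma cons_red_cancel: "reduced_word w \<Longrightarrow> cons_red (inv_letter a) (cons_red a w) = w"
  by (cases w; cases "tl w") (auto simp: cons_red_def reduced_Cons)

lemma cons_red_cancel': "reduced_word w \<Longrightarrow> cons_red a (cons_red (inv_letter a) w) = w"
  using cons_red_cancel[of w "inv_letter a"] by simp

lemma foldr_cons_red_cons_red:
  assumes "reduced_word w"
  shows "foldr cons_red (cons_red a v) w = cons_red a (foldr cons_red v w)"
proof (cases "v \<noteq> [] \<and> hd v = inv_letter a")
  case True
  then obtain v' where "v = inv_letter a # v'" by (cases v) auto
  then show ?thesis
    using assms by (simp add: cons_red_def[of a "_ # _"] cons_red_cancel' reduced_foldr_cons_red)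
next
  case False
  then have "cons_red a v = a # v" by (cases v) (auto simp: cons_red_def)
  then show ?thesis by simp
qed

lemma foldr_cons_red_assoc:
  assumes "reduced_word w"
  shows "foldr cons_red (foldr cons_red u v) w = foldr cons_red u (foldr cons_red v w)"
  using assms by (induction u) (simp_all add: foldr_cons_red_cons_red)

lemma foldr_cons_red_Nil: "reduced_word w \<Longrightarrow> foldr cons_red w [] = w"
proof (induction w)
  case (Cons a w)
  then show ?case by (cases w) (auto simp: reduced_Cons cons_red_def)
qed simp

lemma foldr_cons_red_inverse: "foldr cons_red (rev (map inv_letter w)) w = []"
  by (induction w) (simp_all add: cons_red_def)

lemma reduced_rev_map_inv_letter: "reduced_word w \<Longrightarrow> reduced_word (rev (map inv_letter w))"
  unfolding reduced_word_def successively_rev successively_map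
  by (rule successively_mono[of "\<lambda>a b. b \<noteq> inv_letter a"]) auto

lemma set_foldr_cons_red: "set (foldr cons_red v w) \<subseteq> set v \<union> set w"
proof (induction v)
  case (Cons a v)
  have "set (cons_red a u) \<subseteq> insert a (set u)" for u
    by (cases u) (auto simp: cons_red_def)
  with Cons show ?case by fastforce
qed simp

lemma group_free_group: "group (free_group r)"
proof (rule groupI)
  fix u v assume uv: "u \<in> carrier (free_group r)" "v \<in> carrier (free_group r)"
  have "fst ` set (foldr cons_red u v) \<subseteq> fst ` (set u \<union> set v)"
    by (rule image_mono[OF set_foldr_cons_red])
  also have "\<dots> \<subseteq> {..<r}"
    unfolding image_Un using uv by (simp add: free_group_def)
  finally show "u \<otimes>\<^bsub>free_group r\<^esub> v \<in> carrier (free_group r)"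
    using uv by (simp add: free_group_def reduced_foldr_cons_red)
next
  fix w assume "w \<in> carrier (free_group r)"
  then show "\<exists>v\<in>carrier (free_group r). v \<otimes>\<^bsub>free_group r\<^esub> w = \<one>\<^bsub>free_group r\<^esub>"
    by (intro bexI[of _ "rev (map inv_letter w)"])
       (auto simp: free_group_def foldr_cons_red_inverse reduced_rev_map_inv_letter image_image)
qed (auto simp: free_group_def foldr_cons_red_assoc)

definition word_dist :: "nat \<Rightarrow> word \<Rightarrow> word \<Rightarrow> real" where
  "word_dist r u v = real (length (inv\<^bsub>free_group r\<^esub> u \<otimes>\<^bsub>free_group r\<^esub> v))"


section \<open>Gromov boundary\<close>

definition gromov_product :: "('a \<Rightarrow> 'a \<Rightarrow> real) \<Rightarrow> 'a \<Rightarrow> 'a \<Rightarrow> 'a \<Rightarrow> real" where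
  "gromov_product d b x y = (d b x + d b y - d x y) / 2"

text \<open>The Gromov products of two sequences tend to infinity. Whether this holds does not depend on
  the base point \<open>b\<close>, so we quantify over all of them.\<close>

definition gromov_asymptotic ::
    "'a set \<Rightarrow> ('a \<Rightarrow> 'a \<Rightarrow> real) \<Rightarrow> (nat \<Rightarrow> 'a) \<Rightarrow> (nat \<Rightarrow> 'a) \<Rightarrow> bool" where
  "gromov_asymptotic M d s t \<longleftrightarrow>
     (\<forall>b\<in>M. filterlim (\<lambda>(i, j). gromov_product d b (s i) (t j)) at_top
        (sequentially \<times>\<^sub>F sequentially))"

definition converging_at_infinity :: "'a set \<Rightarrow> ('a \<Rightarrow> 'a \<Rightarrow> real) \<Rightarrow> (nat \<Rightarrow> 'a) set" where
  "converging_at_infinity M d = {s. range s \<subseteq> M \<and> gromov_asymptotic M d s s}"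

definition asymptotic_rel ::
    "'a set \<Rightarrow> ('a \<Rightarrow> 'a \<Rightarrow> real) \<Rightarrow> ((nat \<Rightarrow> 'a) \<times> (nat \<Rightarrow> 'a)) set" where
  "asymptotic_rel M d =
     {(s, t). s \<in> converging_at_infinity M d \<and> t \<in> converging_at_infinity M d
        \<and> gromov_asymptotic M d s t}"

definition gromov_boundary :: "'a set \<Rightarrow> ('a \<Rightarrow> 'a \<Rightarrow> real) \<Rightarrow> (nat \<Rightarrow> 'a) set set" where
  "gromov_boundary M d = converging_at_infinity M d // asymptotic_rel M d"

text \<open>The usual basic neighbourhoods of a boundary point \<open>p\<close>: all \<open>q\<close> such that
  \<open>liminf (s\<^sub>i | t\<^sub>j)\<^sub>b \<ge> R\<close> for some sequences \<open>s\<close> and \<open>t\<close> representing \<open>p\<close> and \<open>q\<close>.\<close>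

definition boundary_nbhd ::
    "'a set \<Rightarrow> ('a \<Rightarrow> 'a \<Rightarrow> real) \<Rightarrow> 'a \<Rightarrow> (nat \<Rightarrow> 'a) set \<Rightarrow> real \<Rightarrow> (nat \<Rightarrow> 'a) set set" where
  "boundary_nbhd M d b p R =
     {q \<in> gromov_boundary M d. \<exists>s\<in>p. \<exists>t\<in>q.
        ereal R \<le> Liminf (sequentially \<times>\<^sub>F sequentially)
                    (\<lambda>(i, j). ereal (gromov_product d b (s i) (t j)))}"

definition boundary_open ::
    "'a set \<Rightarrow> ('a \<Rightarrow> 'a \<Rightarrow> real) \<Rightarrow> 'a \<Rightarrow> (nat \<Rightarrow> 'a) set set \<Rightarrow> bool" where
  "boundary_open M d b U \<longleftrightarrow>
     U \<subseteq> gromov_boundary M d \<and> (\<forall>p\<in>U. \<exists>R\<ge>0. boundary_nbhd M d b p R \<subseteq> U)"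

definition boundary_topology ::
    "'a set \<Rightarrow> ('a \<Rightarrow> 'a \<Rightarrow> real) \<Rightarrow> 'a \<Rightarrow> (nat \<Rightarrow> 'a) set topology" where
  "boundary_topology M d b = topology (boundary_open M d b)"

lemma boundary_nbhd_antimono:
  assumes "R \<le> R'"
  shows "boundary_nbhd M d b p R' \<subseteq> boundary_nbhd M d b p R"
proof -
  have "ereal R \<le> ereal R'" using assms by simp
  then show ?thesis unfolding boundary_nbhd_def by (blast intro: order_trans)
qed

lemma istopology_boundary_open: "istopology (boundary_open M d b)"
  unfolding istopology_def
proof (intro conjI allI impI)
  fix U V assume UV: "boundary_open M d b U" "boundary_open M d b V"
  show "boundary_open M d b (U \<inter> V)"
    unfolding boundary_open_def
  proof (intro conjI ballI)
    show "U \<inter> V \<subseteq> gromov_boundary M d" using UV by (auto simp: boundary_open_def)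
    fix p assume "p \<in> U \<inter> V"
    with UV obtain R R' where "R \<ge> 0" "boundary_nbhd M d b p R \<subseteq> U"
      "R' \<ge> 0" "boundary_nbhd M d b p R' \<subseteq> V"
      unfolding boundary_open_def by blast
    then show "\<exists>R\<ge>0. boundary_nbhd M d b p R \<subseteq> U \<inter> V"
      using boundary_nbhd_antimono[of R "max R R'" M d b p]
        boundary_nbhd_antimono[of R' "max R R'" M d b p]
      by (intro exI[of _ "max R R'"]) auto
  qed
next
  fix K assume "\<forall>U\<in>K. boundary_open M d b U"
  then show "boundary_open M d b (\<Union>K)"
    unfolding boundary_open_def by (meson Sup_least Union_upper order_trans UnionE)
qed

lemma openin_boundary_topology: "openin (boundary_topology M d b) = boundary_open M d b"
  unfolding boundary_topology_def by (rule topology_inverse'[OF istopology_boundary_open])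


section \<open>Algebraic laminations\<close>

type_synonym bdry_point = "(nat \<Rightarrow> word) set"

definition free_group_boundary :: "nat \<Rightarrow> bdry_point set" where
  "free_group_boundary r = gromov_boundary (carrier (free_group r)) (word_dist r)"

definition free_group_boundary_topology :: "nat \<Rightarrow> bdry_point topology" where
  "free_group_boundary_topology r =
     boundary_topology (carrier (free_group r)) (word_dist r) \<one>\<^bsub>free_group r\<^esub>"

definition double_boundary :: "nat \<Rightarrow> (bdry_point \<times> bdry_point) set" where
  "double_boundary r =
     {(p, q). p \<in> free_group_boundary r \<and> q \<in> free_group_boundary r \<and> p \<noteq> q}"

definition double_boundary_topology :: "nat \<Rightarrow> (bdry_point \<times> bdry_point) topology" where
  "double_boundary_topology r =
     subtopology
       (prod_topology (free_group_boundary_topology r) (free_group_boundary_topology r))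
       (double_boundary r)"

text \<open>The action of \<open>g\<close> on the boundary point represented by \<open>s\<close> gives the one represented by
  \<open>\<lambda>n. g \<otimes> s n\<close>.\<close>

definition boundary_act :: "nat \<Rightarrow> word \<Rightarrow> bdry_point \<Rightarrow> bdry_point" where
  "boundary_act r g p = (\<lambda>s n. g \<otimes>\<^bsub>free_group r\<^esub> s n) ` p"

definition algebraic_lamination :: "nat \<Rightarrow> (bdry_point \<times> bdry_point) set \<Rightarrow> bool" where
  "algebraic_lamination r L \<longleftrightarrow>
     L \<subseteq> double_boundary r \<and>
     closedin (double_boundary_topology r) L \<and>
     (\<forall>g\<in>carrier (free_group r). \<forall>(p, q)\<in>L. (boundary_act r g p, boundary_act r g q) \<in> L) \<and>
     (\<forall>(p, q)\<in>L. (q, p) \<in> L)"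


section \<open>Real trees and Outer space\<close>

text \<open>A real tree is a nonempty geodesic metric space that is 0-hyperbolic in Gromov's sense.\<close>

definition real_tree :: "'a set \<Rightarrow> ('a \<Rightarrow> 'a \<Rightarrow> real) \<Rightarrow> bool" where
  "real_tree M d \<longleftrightarrow>
     Metric_space M d \<and> M \<noteq> {} \<and>
     (\<forall>x\<in>M. \<forall>y\<in>M. \<exists>c :: real \<Rightarrow> 'a. c 0 = x \<and> c (d x y) = y \<and>
        (\<forall>s\<in>{0..d x y}. c s \<in> M \<and> (\<forall>t\<in>{0..d x y}. d (c s) (c t) = \<bar>s - t\<bar>))) \<and>
     (\<forall>b\<in>M. \<forall>x\<in>M. \<forall>y\<in>M. \<forall>z\<in>M.
        min (gromov_product d b x y) (gromov_product d b y z) \<le> gromov_product d b x z)"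

text \<open>A tree in \<open>cv\<^sub>r\<close> is given by its points \<open>M\<close>, its metric \<open>d\<close> and the action \<open>\<phi>\<close>.
  The conjuncts after \<open>group_action\<close> say that the action is isometric, free, discrete (every
  orbit is a discrete subset), nontrivial (no global fixed point) and minimal.\<close>

definition outer_space_tree ::
    "nat \<Rightarrow> 'a set \<Rightarrow> ('a \<Rightarrow> 'a \<Rightarrow> real) \<Rightarrow> (word \<Rightarrow> 'a \<Rightarrow> 'a) \<Rightarrow> bool" where
  "outer_space_tree r M d \<phi> \<longleftrightarrow>
     real_tree M d \<and>
     group_action (free_group r) M \<phi> \<and>
     (\<forall>g\<in>carrier (free_group r). \<forall>x\<in>M. \<forall>y\<in>M. d (\<phi> g x) (\<phi> g y) = d x y) \<and>
     (\<forall>g\<in>carrier (free_group r). \<forall>x\<in>M. \<phi> g x = x \<longrightarrow> g = \<one>\<^bsub>free_group r\<^esub>) \<and>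
     (\<forall>x\<in>M. subtopology (Metric_space.mtopology M d) (orbit (free_group r) \<phi> x)
              = discrete_topology (orbit (free_group r) \<phi> x)) \<and>
     \<not> (\<exists>x\<in>M. \<forall>g\<in>carrier (free_group r). \<phi> g x = x) \<and>
     (\<forall>S\<subseteq>M. real_tree S d \<and> (\<forall>g\<in>carrier (free_group r). \<phi> g ` S \<subseteq> S) \<longrightarrow> S = M)"


section \<open>The quotient graph\<close>

definition tree_segment :: "'a set \<Rightarrow> ('a \<Rightarrow> 'a \<Rightarrow> real) \<Rightarrow> 'a \<Rightarrow> 'a \<Rightarrow> 'a set" where
  "tree_segment M d x y = {z \<in> M. d x z + d z y = d x y}"

text \<open>Points of degree at least 3: there are three directions at \<open>x\<close>, i.e. three nondegenerate
  segments issuing from \<open>x\<close> that pairwise meet only in \<open>x\<close>.\<close>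

definition branch_points :: "'a set \<Rightarrow> ('a \<Rightarrow> 'a \<Rightarrow> real) \<Rightarrow> 'a set" where
  "branch_points M d =
     {x \<in> M. \<exists>y1\<in>M - {x}. \<exists>y2\<in>M - {x}. \<exists>y3\<in>M - {x}.
        tree_segment M d x y1 \<inter> tree_segment M d x y2 = {x} \<and>
        tree_segment M d x y1 \<inter> tree_segment M d x y3 = {x} \<and>
        tree_segment M d x y2 \<inter> tree_segment M d x y3 = {x}}"

text \<open>The simplicial structure of a tree: an oriented edge is the ordered pair of its endpoints,
  which are two distinct branch points with no branch point strictly between them.\<close>

definition tree_graph :: "'a set \<Rightarrow> ('a \<Rightarrow> 'a \<Rightarrow> real) \<Rightarrow> ('a, 'a \<times> 'a) pre_digraph" where
  "tree_graph M d =
     \<lparr>verts = branch_points M d,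
      arcs = {(u, v). u \<in> branch_points M d \<and> v \<in> branch_points M d \<and> u \<noteq> v \<and>
                tree_segment M d u v \<inter> branch_points M d = {u, v}},
      tail = fst,
      head = snd\<rparr>"

definition edge_orbit :: "nat \<Rightarrow> (word \<Rightarrow> 'a \<Rightarrow> 'a) \<Rightarrow> 'a \<times> 'a \<Rightarrow> ('a \<times> 'a) set" where
  "edge_orbit r \<phi> e = orbit (free_group r) (\<lambda>g. map_prod (\<phi> g) (\<phi> g)) e"

text \<open>Vertices and oriented edges of the quotient graph are orbits. For an orbit \<open>e\<close> of oriented
  edges, \<open>fst ` e\<close> and \<open>snd ` e\<close> are the orbits of the initial and of the terminal vertices.\<close>

definition quotient_graph ::
    "nat \<Rightarrow> 'a set \<Rightarrow> ('a \<Rightarrow> 'a \<Rightarrow> real) \<Rightarrow> (word \<Rightarrow> 'a \<Rightarrow> 'a) \<Rightarrow> ('a set, ('a \<times> 'a) set) pre_digraph"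
  where
  "quotient_graph r M d \<phi> =
     \<lparr>verts = orbit (free_group r) \<phi> ` verts (tree_graph M d),
      arcs = edge_orbit r \<phi> ` arcs (tree_graph M d),
      tail = (\<lambda>e. fst ` e),
      head = (\<lambda>e. snd ` e)\<rparr>"

definition edge_path :: "('v, 'e) pre_digraph \<Rightarrow> 'e list \<Rightarrow> bool" where
  "edge_path G \<gamma> \<longleftrightarrow> (\<exists>u v. pre_digraph.awalk G u \<gamma> v)"

text \<open>All lifts of an edge of the quotient have the same length, so the image below is a
  singleton.\<close>

definition edge_length :: "('a \<Rightarrow> 'a \<Rightarrow> real) \<Rightarrow> ('a \<times> 'a) set \<Rightarrow> real" where
  "edge_length d e = the_elem ((\<lambda>(u, v). d u v) ` e)"

definition path_length :: "('a \<Rightarrow> 'a \<Rightarrow> real) \<Rightarrow> ('a \<times> 'a) set list \<Rightarrow> real" where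
  "path_length d \<gamma> = (\<Sum>e\<leftarrow>\<gamma>. edge_length d e)"


section \<open>Laminary language and complexity\<close>

text \<open>The identification of the boundary of the free group with the boundary of the tree, induced
  by the orbit maps \<open>g \<mapsto> \<phi> g x\<close>.\<close>

definition boundary_ident ::
    "'a set \<Rightarrow> ('a \<Rightarrow> 'a \<Rightarrow> real) \<Rightarrow> (word \<Rightarrow> 'a \<Rightarrow> 'a) \<Rightarrow> bdry_point \<Rightarrow> (nat \<Rightarrow> 'a) set" where
  "boundary_ident M d \<phi> p =
     {t. \<exists>s\<in>p. \<exists>x\<in>M. ((\<lambda>n. \<phi> (s n) x), t) \<in> asymptotic_rel M d}"

definition geodesic_from_to ::
    "'a set \<Rightarrow> ('a \<Rightarrow> 'a \<Rightarrow> real) \<Rightarrow> (word \<Rightarrow> 'a \<Rightarrow> 'a) \<Rightarrow> bdry_point \<Rightarrow> bdry_point \<Rightarrow> (real \<Rightarrow> 'a) \<Rightarrow> bool"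
  where
  "geodesic_from_to M d \<phi> p q c \<longleftrightarrow>
     range c \<subseteq> M \<and> (\<forall>s t. d (c s) (c t) = \<bar>s - t\<bar>) \<and>
     (\<lambda>n. c (- real n)) \<in> boundary_ident M d \<phi> p \<and>
     (\<lambda>n. c (real n)) \<in> boundary_ident M d \<phi> q"

text \<open>The edges of the path are traversed consecutively by \<open>c\<close>, in the direction of \<open>c\<close>.\<close>

definition subpath_of_geodesic :: "(real \<Rightarrow> 'a) \<Rightarrow> ('a \<times> 'a) list \<Rightarrow> bool" where
  "subpath_of_geodesic c \<delta> \<longleftrightarrow>
     (\<exists>\<tau> :: nat \<Rightarrow> real. \<forall>i<length \<delta>. \<tau> i < \<tau> (Suc i) \<and> \<delta> ! i = (c (\<tau> i), c (\<tau> (Suc i))))"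

definition laminary_language ::
    "nat \<Rightarrow> 'a set \<Rightarrow> ('a \<Rightarrow> 'a \<Rightarrow> real) \<Rightarrow> (word \<Rightarrow> 'a \<Rightarrow> 'a) \<Rightarrow> (bdry_point \<times> bdry_point) set
      \<Rightarrow> ('a \<times> 'a) set list set"
  where
  "laminary_language r M d \<phi> L =
     {\<gamma>. edge_path (quotient_graph r M d \<phi>) \<gamma> \<and> length \<gamma> > 0 \<and>
        (\<exists>\<delta>. edge_path (tree_graph M d) \<delta> \<and> map (edge_orbit r \<phi>) \<delta> = \<gamma> \<and>
          (\<exists>(p, q)\<in>L. \<exists>c. geodesic_from_to M d \<phi> p q c \<and> subpath_of_geodesic c \<delta>))}"

definition complexity ::
    "nat \<Rightarrow> 'a set \<Rightarrow> ('a \<Rightarrow> 'a \<Rightarrow> real) \<Rightarrow> (word \<Rightarrow> 'a \<Rightarrow> 'a) \<Rightarrow> (bdry_point \<times> bdry_point) set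
      \<Rightarrow> nat \<Rightarrow> nat"
  where
  "complexity r M d \<phi> L n =
     (if n = 0 then 0 else card {\<gamma> \<in> laminary_language r M d \<phi> L. length \<gamma> \<le> n})"

definition metric_complexity ::
    "nat \<Rightarrow> 'a set \<Rightarrow> ('a \<Rightarrow> 'a \<Rightarrow> real) \<Rightarrow> (word \<Rightarrow> 'a \<Rightarrow> 'a) \<Rightarrow> (bdry_point \<times> bdry_point) set
      \<Rightarrow> nat \<Rightarrow> nat"
  where
  "metric_complexity r M d \<phi> L n =
     (if n = 0 then 0 else card {\<gamma> \<in> laminary_language r M d \<phi> L. path_length d \<gamma> \<le> real n})"

text \<open>Meant for monotone functions; both complexity functions are monotone.\<close>

definition growth_equiv :: "(nat \<Rightarrow> nat) \<Rightarrow> (nat \<Rightarrow> nat) \<Rightarrow> bool" where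
  "growth_equiv f g \<longleftrightarrow>
     (\<exists>C\<ge>1. \<forall>n\<ge>1. f n \<le> C * g (C * n) \<and> g n \<le> C * f (C * n))"

end

theory Submission
  imports Defs
begin

text \<open>The language of a tree is counted through the orbits of pairs of branch points \<open>(u, v)\<close> lying,
  in this order, on a geodesic that joins the two ends of a leaf of the lamination; number of edges
  and length of a path are comparable because the edge lengths lie between two positive constants.

  Each tree is quasi-isometric to the free group along its orbit maps, by cocompactness and
  properness of the action. In a 0-hyperbolic space a coarse path cannot bypass a point of the
  segment between its ends, so bounded Gromov products of orbit points in one tree are bounded in
  the other. Therefore the geodesics of the two trees with the same ends fellow-travel, with the
  same orientation, and moving \<open>u\<close> and \<open>v\<close> to nearby branch points of the other geodesic gives
  a map between the languages. It increases lengths at most linearly, and its fibres are bounded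
      because a
  ball contains boundedly many branch points.\<close>

section \<open>Real trees\<close>

lemma real_tree_four_point:
  assumes "real_tree M d" "x \<in> M" "y \<in> M" "z \<in> M" "w \<in> M"
  shows "d x y + d z w \<le> max (d x z + d y w) (d x w + d y z)"
proof -
  interpret Metric_space M d using assms by (simp add: real_tree_def)
  have "min (gromov_product d w x z) (gromov_product d w z y) \<le> gromov_product d w x y"
    using assms by (simp add: real_tree_def)
  then show ?thesis
    unfolding gromov_product_def using commute[of w] commute[of z y] by (auto simp: min_def max_def
        split: if_splits)
qed

locale rtree =
  fixes M :: "'a set" and d :: "'a \<Rightarrow> 'a \<Rightarrow> real"
  assumes real_tree: "real_tree M d"

sublocale rtree \<subseteq> Metric_space M d
  using real_tree by (simp add: real_tree_def)

context rtree
begin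

abbreviation gp :: "'a \<Rightarrow> 'a \<Rightarrow> 'a \<Rightarrow> real" where "gp \<equiv> gromov_product d"
abbreviation seg :: "'a \<Rightarrow> 'a \<Rightarrow> 'a set" where "seg \<equiv> tree_segment M d"

lemmas gp_def = gromov_product_def

lemma hyperbolic:
  "\<lbrakk>b \<in> M; x \<in> M; y \<in> M; z \<in> M\<rbrakk> \<Longrightarrow> min (gp b x y) (gp b y z) \<le> gp b x z"
  using real_tree by (simp add: real_tree_def)

lemmas four_point = real_tree_four_point[OF real_tree]

lemma gp_commute: "gp b x y = gp b y x"
  by (simp add: gp_def commute)

lemma gp_nonneg: "\<lbrakk>b \<in> M; x \<in> M; y \<in> M\<rbrakk> \<Longrightarrow> 0 \<le> gp b x y"
  using triangle[of x b y] by (simp add: gp_def commute)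

lemma gp_base_change: "\<lbrakk>b \<in> M; b' \<in> M; x \<in> M; y \<in> M\<rbrakk> \<Longrightarrow> gp b x y \<le> gp b' x y + d b b'"
  using triangle[of b b' x] triangle[of b b' y] by (simp add: gp_def field_simps)

lemma gp_point_change: "\<lbrakk>b \<in> M; x \<in> M; x' \<in> M; y \<in> M\<rbrakk> \<Longrightarrow> gp b x y \<le> gp b x' y + d x x'"
  using triangle[of b x' x] triangle[of x' x y] commute[of x x'] by (simp add: gp_def field_simps)

lemma seg_iff: "z \<in> seg x y \<longleftrightarrow> z \<in> M \<and> gp z x y = 0"
  by (auto simp: tree_segment_def gp_def commute)

lemma seg_iff_le: "\<lbrakk>x \<in> M; y \<in> M\<rbrakk> \<Longrightarrow> z \<in> seg x y \<longleftrightarrow> z \<in> M \<and> gp z x y \<le> 0"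
  using gp_nonneg[of z x y] by (auto simp: seg_iff)

lemma seg_commute: "seg x y = seg y x"
  by (auto simp: seg_iff gp_commute)

lemma seg_subset: "seg x y \<subseteq> M"
  by (auto simp: tree_segment_def)

lemma seg_dist: "z \<in> seg x y \<Longrightarrow> d x z + d z y = d x y"
  by (auto simp: tree_segment_def)

lemma ends_in_seg: "\<lbrakk>x \<in> M; y \<in> M\<rbrakk> \<Longrightarrow> x \<in> seg x y" "\<lbrakk>x \<in> M; y \<in> M\<rbrakk> \<Longrightarrow> y \<in> seg x y"
  by (auto simp: tree_segment_def)

lemma geodesic:
  assumes "x \<in> M" "y \<in> M"
  obtains c where "c 0 = x" "c (d x y) = y"
    "\<And>s. \<lbrakk>0 \<le> s; s \<le> d x y\<rbrakk> \<Longrightarrow> c s \<in> M"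
    "\<And>s t. \<lbrakk>0 \<le> s; s \<le> d x y; 0 \<le> t; t \<le> d x y\<rbrakk> \<Longrightarrow> d (c s) (c t) = \<bar>s - t\<bar>"
proof -
  obtain c :: "real \<Rightarrow> 'a" where "c 0 = x" "c (d x y) = y"
    "\<forall>s\<in>{0..d x y}. c s \<in> M \<and> (\<forall>t\<in>{0..d x y}. d (c s) (c t) = \<bar>s - t\<bar>)"
    using real_tree assms unfolding real_tree_def by blast
  then show thesis using that[of c] by simp
qed

lemma seg_point:
  assumes "x \<in> M" "y \<in> M" "0 \<le> t" "t \<le> d x y"
  obtains z where "z \<in> seg x y" "d x z = t" "d z y = d x y - t"
proof -
  obtain c where c: "c 0 = x" "c (d x y) = y"
    "\<And>s. \<lbrakk>0 \<le> s; s \<le> d x y\<rbrakk> \<Longrightarrow> c s \<in> M"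
    "\<And>s t. \<lbrakk>0 \<le> s; s \<le> d x y; 0 \<le> t; t \<le> d x y\<rbrakk> \<Longrightarrow> d (c s) (c t) = \<bar>s - t\<bar>"
    using geodesic[OF assms(1,2)] by metis
  have "d x (c t) = t" "d (c t) y = d x y - t"
    using c(4)[of 0 t] c(4)[of t "d x y"] c(1,2) assms by auto
  with c(3)[of t] assms show thesis by (intro that[of "c t"]) (auto simp: tree_segment_def)
qed

lemma seg_unique:
  assumes "x \<in> M" "y \<in> M" "z \<in> seg x y" "w \<in> seg x y" "d x z = d x w"
  shows "z = w"
proof -
  have "d x y + d z w \<le> max (d x z + d y w) (d x w + d y z)"
    using assms seg_subset by (intro four_point) auto
  with seg_dist[OF assms(3)] seg_dist[OF assms(4)] assms(5) have "d z w \<le> 0"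
    by (simp add: commute[of y])
  with assms seg_subset show ?thesis by (metis nonneg zero order_antisym subsetD)
qed

lemma seg_dist_eq:
  assumes "x \<in> M" "y \<in> M" "z \<in> seg x y" "w \<in> seg x y"
  shows "d z w = \<bar>d x z - d x w\<bar>"
proof -
  have "d x y + d z w \<le> max (d x z + d y w) (d x w + d y z)"
    using assms seg_subset by (intro four_point) auto
  moreover have "\<bar>d x z - d x w\<bar> \<le> d z w"
    using triangle[of x z w] triangle[of x w z] assms seg_subset[of x y] commute[of w z]
    by (smt (verit) subsetD)
  ultimately show ?thesis
    using seg_dist[OF assms(3)] seg_dist[OF assms(4)] by (auto simp: commute[of y])
qed

lemma seg_union:
  assumes "x \<in> M" "y \<in> M" "z \<in> M"
  shows "seg x z \<subseteq> seg x y \<union> seg y z"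
proof
  fix w assume w: "w \<in> seg x z"
  then have "w \<in> M" using seg_subset by auto
  with hyperbolic[of w x y z] w assms show "w \<in> seg x y \<union> seg y z"
    by (auto simp: seg_iff_le seg_iff[of w x z] min_def split: if_splits)
qed

lemma seg_sub:
  assumes "x \<in> M" "y \<in> M" "z \<in> seg x y"
  shows "seg x z \<subseteq> seg x y"
proof
  fix w assume w: "w \<in> seg x z"
  have M: "w \<in> M" "z \<in> M" using seg_subset w assms by auto
  show "w \<in> seg x y"
    using seg_dist[OF w] seg_dist[OF assms(3)] triangle[of w z y] triangle[of x w y] M assms
    by (auto simp: tree_segment_def)
qed

lemma projection:
  assumes "b \<in> M" "x \<in> M" "y \<in> M"
  obtains z where "z \<in> seg x y" "d b z = gp b x y" "d x z = gp x b y" "d y z = gp y b x"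
    "z \<in> seg b x" "z \<in> seg b y"
proof -
  have t: "0 \<le> gp x b y" "gp x b y \<le> d x y"
    using gp_nonneg[of x b y] triangle[of b x y] triangle[of x y b] assms
    by (auto simp: gp_def commute)
  obtain z where z: "z \<in> seg x y" "d x z = gp x b y" "d z y = d x y - gp x b y"
    using seg_point[OF assms(2,3) t] by metis
  have zM: "z \<in> M" using z seg_subset by auto
  have "d b z + d x y \<le> max (d b x + d z y) (d b y + d z x)"
    using four_point[of b z x y] assms zM by simp
  then have le: "d b z \<le> gp b x y"
    using z by (simp add: gp_def commute max_def field_simps split: if_splits)
  have "d b x \<le> d b z + d z x" "d b y \<le> d b z + d z y" using triangle assms zM by auto
  with z have "gp b x y \<le> d b z" by (simp add: gp_def commute)
  with le have eq: "d b z = gp b x y" by simp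
  show thesis
  proof (rule that[OF z(1) eq z(2)])
    show "d y z = gp y b x" using z(3) by (simp add: commute gp_def field_simps)
    show "z \<in> seg b x" using eq z zM by (simp add: tree_segment_def gp_def commute)
    show "z \<in> seg b y" using eq z zM by (simp add: tree_segment_def gp_def commute field_simps)
  qed
qed

lemma gp_chain:
  assumes "z \<in> M" "\<And>i. i \<le> Suc n \<Longrightarrow> f i \<in> M" "gp z (f 0) (f (Suc n)) \<le> \<rho>"
  shows "\<exists>i\<le>n. gp z (f i) (f (Suc i)) \<le> \<rho>"
  using assms(2,3)
proof (induction n)
  case (Suc n)
  have "min (gp z (f 0) (f (Suc n))) (gp z (f (Suc n)) (f (Suc (Suc n)))) \<le> gp z (f 0) (f (Suc (Suc
      n)))"
    using Suc.prems by (intro hyperbolic assms(1)) auto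
  with Suc.prems consider "gp z (f 0) (f (Suc n)) \<le> \<rho>" | "gp z (f (Suc n)) (f (Suc (Suc n))) \<le> \<rho>"
    by (auto simp: min_def split: if_splits)
  then show ?case
  proof cases
    case 1
    then show ?thesis using Suc.IH Suc.prems by (meson le_SucI)
  qed auto
qed auto

lemma seg_chain:
  assumes "x \<in> M" "y \<in> M" "\<delta> > 0"
  obtains f n where "f 0 = x" "f (Suc n) = y" "real n \<le> d x y / \<delta>"
    "\<And>i. i \<le> Suc n \<Longrightarrow> f i \<in> seg x y" "\<And>i. i \<le> n \<Longrightarrow> d (f i) (f (Suc i)) \<le> \<delta>"
proof -
  obtain c where c: "c 0 = x" "c (d x y) = y"
    "\<And>s. \<lbrakk>0 \<le> s; s \<le> d x y\<rbrakk> \<Longrightarrow> c s \<in> M"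
    "\<And>s t. \<lbrakk>0 \<le> s; s \<le> d x y; 0 \<le> t; t \<le> d x y\<rbrakk> \<Longrightarrow> d (c s) (c t) = \<bar>s - t\<bar>"
    using geodesic[OF assms(1,2)] by metis
  define n where "n = nat \<lfloor>d x y / \<delta>\<rfloor>"
  have n: "real n \<le> d x y / \<delta>" "d x y / \<delta> < real n + 1"
    unfolding n_def using assms by (auto intro: divide_nonneg_pos)
  have n1: "real n * \<delta> \<le> d x y" and n2: "d x y < real n * \<delta> + \<delta>"
    using n assms by (simp_all add: field_simps)
  define f where "f i = c (min (real i * \<delta>) (d x y))" for i
  have cseg: "c t \<in> seg x y" if "0 \<le> t" "t \<le> d x y" for t
    using c(3)[OF that] c(4)[of 0 t] c(4)[of t "d x y"] that c(1,2) by (auto simp: tree_segment_def)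
  show thesis
  proof (rule that[of f n])
    show "f 0 = x" "f (Suc n) = y" using c n2 by (auto simp: f_def min_def algebra_simps)
    fix i
    show "f i \<in> seg x y" unfolding f_def using assms by (intro cseg) auto
    show "d (f i) (f (Suc i)) \<le> \<delta>"
      unfolding f_def using assms
      by (subst c(4)) (auto simp: min_def algebra_simps)
  qed (use n in auto)
qed

end

section \<open>Points of Outer space: cocompactness and properness\<close>

locale cv_tree =
  fixes r :: nat and M :: "'a set" and d :: "'a \<Rightarrow> 'a \<Rightarrow> real" and \<phi> :: "word \<Rightarrow> 'a \<Rightarrow> 'a"
  assumes rank: "2 \<le> r"
    and outer_space_tree: "outer_space_tree r M d \<phi>"

sublocale cv_tree \<subseteq> rtree M d
  using outer_space_tree by unfold_locales (simp add: outer_space_tree_def)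

sublocale cv_tree \<subseteq> group_action "free_group r" M \<phi>
  using outer_space_tree by (simp add: outer_space_tree_def)

sublocale cv_tree \<subseteq> FG: group "free_group r"
  by (rule group_free_group)

lemma free_group_generator: "i < r \<Longrightarrow> [(i, b)] \<in> carrier (free_group r)"
  by (simp add: free_group_def reduced_Cons)

lemma free_group_ConsD:
  assumes "a # w \<in> carrier (free_group r)"
  shows "[a] \<in> carrier (free_group r)" "w \<in> carrier (free_group r)"
    "[a] \<otimes>\<^bsub>free_group r\<^esub> w = a # w"
proof -
  show "[a] \<in> carrier (free_group r)" "w \<in> carrier (free_group r)"
    using assms by (auto simp: free_group_def reduced_Cons)
  show "[a] \<otimes>\<^bsub>free_group r\<^esub> w = a # w"
    using assms by (cases w) (auto simp: free_group_def reduced_Cons cons_red_def)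
qed

context cv_tree
begin

abbreviation F :: "word set" where "F \<equiv> carrier (free_group r)"
abbreviation mult_F (infixl "\<odot>" 70) where "g \<odot> h \<equiv> g \<otimes>\<^bsub>free_group r\<^esub> h"
abbreviation inv_F where "inv_F g \<equiv> inv\<^bsub>free_group r\<^esub> g"
abbreviation one_F where "one_F \<equiv> \<one>\<^bsub>free_group r\<^esub>"

lemma act_closed: "\<lbrakk>g \<in> F; y \<in> M\<rbrakk> \<Longrightarrow> \<phi> g y \<in> M"
  using element_image by blast

lemma act_mult: "\<lbrakk>g \<in> F; h \<in> F; y \<in> M\<rbrakk> \<Longrightarrow> \<phi> (g \<odot> h) y = \<phi> g (\<phi> h y)"
  by (rule composition_rule)

lemma act_one: "y \<in> M \<Longrightarrow> \<phi> one_F y = y"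
  using id_eq_one by (metis restrict_apply')

lemma act_inv: "\<lbrakk>g \<in> F; y \<in> M\<rbrakk> \<Longrightarrow> \<phi> (inv_F g) (\<phi> g y) = y"
  using orbit_sym_aux by blast

lemma act_inv': "\<lbrakk>g \<in> F; y \<in> M\<rbrakk> \<Longrightarrow> \<phi> g (\<phi> (inv_F g) y) = y"
  using act_inv[of "inv_F g" y] by simp

lemma act_isometry: "\<lbrakk>g \<in> F; y \<in> M; z \<in> M\<rbrakk> \<Longrightarrow> d (\<phi> g y) (\<phi> g z) = d y z"
  using outer_space_tree by (simp add: outer_space_tree_def)

lemma act_free: "\<lbrakk>g \<in> F; y \<in> M; \<phi> g y = y\<rbrakk> \<Longrightarrow> g = one_F"
  using outer_space_tree unfolding outer_space_tree_def by blast

lemma act_free_eq: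
  assumes "g \<in> F" "h \<in> F" "y \<in> M" "\<phi> g y = \<phi> h y"
  shows "g = h"
proof -
  have "\<phi> (inv_F h \<odot> g) y = y" using assms by (simp add: act_mult act_inv)
  then have "inv_F h \<odot> g = one_F" using assms by (intro act_free) auto
  then show ?thesis using assms by (metis FG.inv_equality FG.inv_closed FG.inv_inv)
qed

lemma act_dist_shift:
  assumes "g \<in> F" "h \<in> F" "y \<in> M" "z \<in> M"
  shows "d (\<phi> g y) (\<phi> h z) = d y (\<phi> (inv_F g \<odot> h) z)"
proof -
  have "d (\<phi> g y) (\<phi> h z) = d (\<phi> (inv_F g) (\<phi> g y)) (\<phi> (inv_F g) (\<phi> h z))"
    using assms by (simp add: act_isometry act_closed)
  then show ?thesis using assms by (simp add: act_inv act_mult)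
qed

lemma gp_act: "\<lbrakk>g \<in> F; b \<in> M; y \<in> M; z \<in> M\<rbrakk> \<Longrightarrow> gp (\<phi> g b) (\<phi> g y) (\<phi> g z) = gp b y z"
  by (simp add: gp_def act_isometry)

lemma seg_act:
  assumes "g \<in> F" "y \<in> M" "z \<in> M"
  shows "seg (\<phi> g y) (\<phi> g z) = \<phi> g ` seg y z"
proof (intro equalityI subsetI)
  fix w assume w: "w \<in> seg (\<phi> g y) (\<phi> g z)"
  then have wM: "w \<in> M" using seg_subset by auto
  let ?v = "\<phi> (inv_F g) w"
  have "?v \<in> M" "\<phi> g ?v = w" using wM assms by (auto simp: act_closed act_inv')
  with w assms have "?v \<in> seg y z"
    by (metis gp_act seg_iff)
  then show "w \<in> \<phi> g ` seg y z" using \<open>\<phi> g ?v = w\<close> by force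
qed (use assms in \<open>auto simp: seg_iff gp_act act_closed\<close>)

definition basepoint :: 'a ("\<xi>") where "\<xi> = (SOME x. x \<in> M)"

lemma basepoint [simp]: "\<xi> \<in> M"
  unfolding basepoint_def using real_tree by (auto simp: real_tree_def some_in_eq)

abbreviation orb :: "word \<Rightarrow> 'a" where "orb g \<equiv> \<phi> g \<xi>"

lemma orb_closed [simp]: "g \<in> F \<Longrightarrow> orb g \<in> M"
  by (simp add: act_closed)

lemma gen_closed [simp]: "i < r \<Longrightarrow> [(i, b)] \<in> F"
  by (rule free_group_generator)

definition cayley_subtree :: "'a set" where
  "cayley_subtree = (\<Union>g\<in>F. \<Union>i<r. seg (orb g) (orb (g \<odot> [(i, True)])))"

lemma cayley_subtree_edge: "\<lbrakk>g \<in> F; i < r\<rbrakk> \<Longrightarrow> seg (orb g) (orb (g \<odot> [(i, True)])) \<subseteq> cayley_subtree"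
  unfolding cayley_subtree_def by blast

lemma orb_seg_cayley_subtree: "\<lbrakk>g \<in> F; w \<in> F\<rbrakk> \<Longrightarrow> seg (orb g) (orb (g \<odot> w)) \<subseteq> cayley_subtree"
proof (induction w arbitrary: g)
  case Nil
  have "[] = one_F" by (simp add: free_group_def)
  then have "g \<odot> [] = g" using Nil by simp
  moreover have "seg (orb g) (orb g) = {orb g}"
    using Nil triangle[of "orb g"] by (auto simp: tree_segment_def commute)
  moreover have "orb g \<in> cayley_subtree"
  proof -
    have "0 < r" using rank by simp
    moreover have "orb g \<in> seg (orb g) (orb (g \<odot> [(0, True)]))"
      using Nil \<open>0 < r\<close> by (simp add: ends_in_seg)
    ultimately show ?thesis using Nil unfolding cayley_subtree_def by blast
  qed
  ultimately show ?case by simp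
next
  case (Cons a w)
  note aw = free_group_ConsD[OF Cons.prems(2)]
  have ga: "g \<odot> [a] \<in> F" using Cons.prems aw by simp
  have eq: "g \<odot> (a # w) = g \<odot> [a] \<odot> w"
    using aw Cons.prems by (metis FG.m_assoc)
  obtain i b where ib: "a = (i, b)" by (cases a)
  then have i: "i < r" using aw by (auto simp: free_group_def)
  have "seg (orb g) (orb (g \<odot> [a])) \<subseteq> cayley_subtree"
  proof (cases b)
    case True
    then show ?thesis using Cons.prems i ib cayley_subtree_edge by simp
  next
    case False
    have "[(i, False)] \<odot> [(i, True)] = one_F"
      by (simp add: free_group_def cons_red_def inv_letter_def)
    then have "g \<odot> [a] \<odot> [(i, True)] = g"
      using ib False i Cons.prems FG.m_assoc[of g "[(i, False)]" "[(i, True)]"] by simp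
    then have "seg (orb (g \<odot> [a])) (orb g) \<subseteq> cayley_subtree"
      using cayley_subtree_edge[OF ga i] by simp
    then show ?thesis by (simp add: seg_commute)
  qed
  moreover have "seg (orb (g \<odot> [a])) (orb (g \<odot> [a] \<odot> w)) \<subseteq> cayley_subtree"
    using Cons.IH[OF ga] aw by simp
  moreover have "seg (orb g) (orb (g \<odot> (a # w))) \<subseteq>
      seg (orb g) (orb (g \<odot> [a])) \<union> seg (orb (g \<odot> [a])) (orb (g \<odot> [a] \<odot> w))"
    unfolding eq using ga aw Cons.prems by (intro seg_union orb_closed) auto
  ultimately show ?case by blast
qed

lemma cayley_subtree_seg:
  assumes "y \<in> cayley_subtree" "z \<in> cayley_subtree"
  shows "seg y z \<subseteq> cayley_subtree"
proof -
  have star: "\<exists>g\<in>F. y \<in> M \<and> seg y (orb g) \<subseteq> cayley_subtree" if y: "y \<in> cayley_subtree" for y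
  proof -
    obtain g i where gi: "g \<in> F" "i < r" "y \<in> seg (orb g) (orb (g \<odot> [(i, True)]))"
      using y unfolding cayley_subtree_def by blast
    then have "seg (orb g) y \<subseteq> seg (orb g) (orb (g \<odot> [(i, True)]))"
      by (intro seg_sub orb_closed) auto
    then show ?thesis using gi seg_subset unfolding cayley_subtree_def seg_commute[of y]
      by blast
  qed
  obtain g where g: "g \<in> F" "y \<in> M" "seg y (orb g) \<subseteq> cayley_subtree" using star[OF assms(1)] by blast
  obtain h where h: "h \<in> F" "z \<in> M" "seg z (orb h) \<subseteq> cayley_subtree" using star[OF assms(2)] by blast
  have "h = g \<odot> (inv_F g \<odot> h)" using g h by (simp add: FG.m_assoc[symmetric])
  then have gh: "seg (orb g) (orb h) \<subseteq> cayley_subtree"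
    using orb_seg_cayley_subtree[of g "inv_F g \<odot> h"] g h by simp
  have "seg y z \<subseteq> seg y (orb g) \<union> seg (orb g) z" using g h by (intro seg_union) auto
  moreover have "seg (orb g) z \<subseteq> seg (orb g) (orb h) \<union> seg (orb h) z"
    using g h by (intro seg_union) auto
  ultimately show ?thesis using g h gh seg_commute[of z] by blast
qed

lemma cayley_subtree_eq: "cayley_subtree = M"
proof -
  have sub: "cayley_subtree \<subseteq> M" unfolding cayley_subtree_def using seg_subset by blast
  have "orb one_F \<in> cayley_subtree"
    using orb_seg_cayley_subtree[of one_F one_F] ends_in_seg(1)[of "orb one_F" "orb one_F"]
    by (metis FG.one_closed FG.r_one orb_closed subsetD)
  then have ne: "cayley_subtree \<noteq> {}" by auto
  have geo: "\<exists>c :: real \<Rightarrow> 'a. c 0 = x \<and> c (d x y) = y \<and> (\<forall>s\<in>{0..d x y}. c s \<in> cayley_subtree \<and>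
        (\<forall>t\<in>{0..d x y}. d (c s) (c t) = \<bar>s - t\<bar>))"
    if xy: "x \<in> cayley_subtree" "y \<in> cayley_subtree" for x y
  proof -
    have "x \<in> M" "y \<in> M" using xy sub by auto
    then obtain c where c: "c 0 = x" "c (d x y) = y"
      "\<And>s. \<lbrakk>0 \<le> s; s \<le> d x y\<rbrakk> \<Longrightarrow> c s \<in> M"
      "\<And>s t. \<lbrakk>0 \<le> s; s \<le> d x y; 0 \<le> t; t \<le> d x y\<rbrakk> \<Longrightarrow> d (c s) (c t) = \<bar>s - t\<bar>"
      by (rule geodesic) metis
    have "c s \<in> seg x y" if "0 \<le> s" "s \<le> d x y" for s
      using c(3)[OF that] c(4)[of 0 s] c(4)[of s "d x y"] that c(1,2) by (auto simp: tree_segment_def)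
    then have "c s \<in> cayley_subtree" if "0 \<le> s" "s \<le> d x y" for s
      using cayley_subtree_seg[OF xy] that by blast
    with c show ?thesis by (intro exI[of _ c]) auto
  qed
  have met: "Metric_space cayley_subtree d" by (rule subspace[OF sub])
  have hyp: "min (gp b x y) (gp b y z) \<le> gp b x z"
    if "b \<in> cayley_subtree" "x \<in> cayley_subtree" "y \<in> cayley_subtree" "z \<in> cayley_subtree" for b x y z
    using that sub by (intro hyperbolic) auto
  have "real_tree cayley_subtree d"
    unfolding real_tree_def by (intro conjI ballI met ne geo hyp) assumption+
  moreover have "\<phi> h ` cayley_subtree \<subseteq> cayley_subtree" if h: "h \<in> F" for h
  proof -
    have "\<phi> h ` seg (orb g) (orb (g \<odot> [(i, True)])) = seg (orb (h \<odot> g)) (orb (h \<odot> g \<odot> [(i, True)]))"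
      if "g \<in> F" "i < r" for g i
      using that h by (simp add: seg_act[symmetric] act_mult act_closed)
    then have "\<phi> h ` seg (orb g) (orb (g \<odot> [(i, True)])) \<subseteq> cayley_subtree" if "g \<in> F" "i < r" for g i
      using that h cayley_subtree_edge[of "h \<odot> g" i] by simp
    then show ?thesis unfolding cayley_subtree_def[THEN arg_cong[where f = "(`) (\<phi> h)"]] image_UN by
        blast
  qed
  moreover have "\<forall>S\<subseteq>M. real_tree S d \<and> (\<forall>g\<in>F. \<phi> g ` S \<subseteq> S) \<longrightarrow> S = M"
    using outer_space_tree unfolding outer_space_tree_def by (elim conjE)
  ultimately show ?thesis using sub by simp
qed

lemma cocompact_generators:
  assumes "y \<in> M"
  obtains g i z where "g \<in> F" "i < r" "z \<in> seg \<xi> (orb [(i, True)])" "y = \<phi> g z"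
proof -
  obtain g i where gi: "g \<in> F" "i < r" "y \<in> seg (orb g) (orb (g \<odot> [(i, True)]))"
    using assms cayley_subtree_eq unfolding cayley_subtree_def by blast
  then have "y \<in> \<phi> g ` seg \<xi> (orb [(i, True)])"
    by (simp add: seg_act[symmetric] act_mult)
  with gi show thesis using that by blast
qed

lemma cocompact:
  obtains R where "\<And>y. y \<in> M \<Longrightarrow> \<exists>g\<in>F. d y (orb g) \<le> R"
proof
  fix y assume "y \<in> M"
  then obtain g i z where gi: "g \<in> F" "i < r" and z: "z \<in> seg \<xi> (orb [(i, True)])" "y = \<phi> g z"
    by (rule cocompact_generators)
  have "d y (orb g) = d z \<xi>" using z gi seg_subset by (subst z(2), subst act_isometry) auto
  also have "\<dots> \<le> d \<xi> (orb [(i, True)])"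
    using seg_dist[OF z(1)] nonneg[of z "orb [(i, True)]"] commute[of z \<xi>] by linarith
  also have "\<dots> \<le> (\<Sum>i<r. d \<xi> (orb [(i, True)]))"
    using gi by (intro member_le_sum) auto
  finally show "\<exists>g\<in>F. d y (orb g) \<le> (\<Sum>i<r. d \<xi> (orb [(i, True)]))" using gi by blast
qed

lemma orbit_discrete:
  assumes "y \<in> M"
  obtains \<epsilon> where "\<epsilon> > 0" "\<And>g. \<lbrakk>g \<in> F; g \<noteq> one_F\<rbrakk> \<Longrightarrow> d y (\<phi> g y) \<ge> \<epsilon>"
proof -
  have "subtopology mtopology (orbit (free_group r) \<phi> y) = discrete_topology (orbit (free_group r) \<phi> y)"
    using outer_space_tree assms by (simp add: outer_space_tree_def)
  moreover have yo: "y \<in> orbit (free_group r) \<phi> y"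
    unfolding orbit_def using act_one[OF assms] by (force intro: exI[of _ one_F])
  ultimately have "openin (subtopology mtopology (orbit (free_group r) \<phi> y)) {y}" by simp
  then obtain U where U: "openin mtopology U" "{y} = U \<inter> orbit (free_group r) \<phi> y"
    unfolding openin_subtopology by blast
  then obtain \<epsilon> where e: "\<epsilon> > 0" "mball y \<epsilon> \<subseteq> U" using openin_mtopology by blast
  show thesis
  proof (rule that[OF e(1)])
    fix g assume g: "g \<in> F" "g \<noteq> one_F"
    show "d y (\<phi> g y) \<ge> \<epsilon>"
    proof (rule ccontr)
      assume "\<not> ?thesis"
      then have "\<phi> g y \<in> mball y \<epsilon>" using g assms by (simp add: act_closed)
      then have "\<phi> g y = y" using U e g unfolding orbit_def by blast
      then show False using act_free g assms by blast
    qed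
  qed
qed

lemma segment_displacement:
  assumes "x \<in> M" "y \<in> M"
  shows "\<exists>\<epsilon>>0. \<forall>z\<in>seg x y. \<forall>g\<in>F. g \<noteq> one_F \<longrightarrow> d z (\<phi> g z) \<ge> \<epsilon>"
proof (rule ccontr)
  assume neg: "\<not> ?thesis"
  have "\<exists>z\<in>seg x y. \<exists>g\<in>F. g \<noteq> one_F \<and> d z (\<phi> g z) < inverse (real (Suc n))" for n
    using neg[simplified, rule_format, of "inverse (real (Suc n))"] by (force simp: not_le)
  then obtain z g where zg: "\<And>n. z n \<in> seg x y" "\<And>n. g n \<in> F" "\<And>n. g n \<noteq> one_F"
    "\<And>n. d (z n) (\<phi> (g n) (z n)) < inverse (real (Suc n))" by metis
  have "d x (z n) \<in> {0..d x y}" for n using seg_dist[OF zg(1)[of n]] nonneg[of "z n" y] nonneg[of x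
      "z n"]
    by (intro atLeastAtMost_iff[THEN iffD2] conjI) linarith+
  then obtain t k where tk: "t \<in> {0..d x y}" "strict_mono k" "(\<lambda>n. d x (z (k n))) \<longlonglongrightarrow> t"
    using seq_compactE[of "{0..d x y}" "\<lambda>n. d x (z n)"] compact_Icc[of 0 "d x y"]
    unfolding compact_eq_seq_compact_metric comp_def by metis
  obtain w where w: "w \<in> seg x y" "d x w = t" using seg_point[OF assms, of t] tk by auto
  have wM: "w \<in> M" and zM: "\<And>n. z n \<in> M" using w(1) zg(1) seg_subset by blast+
  obtain \<epsilon> where e: "\<epsilon> > 0" "\<And>g. \<lbrakk>g \<in> F; g \<noteq> one_F\<rbrakk> \<Longrightarrow> d w (\<phi> g w) \<ge> \<epsilon>"
    using orbit_discrete[OF wM] by blast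
  have "\<epsilon> \<le> 2 * \<bar>d x (z (k n)) - t\<bar> + inverse (real (Suc (k n)))" for n
  proof -
    let ?z = "z (k n)" and ?g = "g (k n)"
    have M: "\<phi> ?g w \<in> M" "\<phi> ?g ?z \<in> M" using zg zM wM by (auto simp: act_closed)
    have "\<epsilon> \<le> d w (\<phi> ?g w)" using e zg by blast
    also have "\<dots> \<le> d w ?z + d ?z (\<phi> ?g w)" using triangle M zM wM by blast
    also have "d ?z (\<phi> ?g w) \<le> d ?z (\<phi> ?g ?z) + d (\<phi> ?g ?z) (\<phi> ?g w)"
      using triangle M zM wM by blast
    also have "d (\<phi> ?g ?z) (\<phi> ?g w) = d ?z w" using act_isometry zg zM wM by blast
    finally show ?thesis
      using seg_dist_eq[OF assms zg(1) w(1), of "k n"] zg(4)[of "k n"] w(2) commute[of w ?z] by simp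
  qed
  moreover have "(\<lambda>n. 2 * \<bar>d x (z (k n)) - t\<bar> + inverse (real (Suc (k n)))) \<longlonglongrightarrow> 2 * \<bar>t - t\<bar> + 0"
    using LIMSEQ_subseq_LIMSEQ[OF LIMSEQ_inverse_real_of_nat tk(2)]
    by (intro tendsto_intros tk) (simp add: comp_def)
  ultimately have "\<epsilon> \<le> 2 * \<bar>t - t\<bar> + 0"
    by (intro LIMSEQ_le_const) auto
  then show False using e by simp
qed

lemma uniform_displacement:
  obtains \<epsilon> where "\<epsilon> > 0" "\<And>y g. \<lbrakk>y \<in> M; g \<in> F; g \<noteq> one_F\<rbrakk> \<Longrightarrow> d y (\<phi> g y) \<ge> \<epsilon>"
proof -
  let ?s = "\<lambda>i. seg \<xi> (orb [(i, True)])"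
  have "\<forall>i\<in>{..<r}. \<exists>\<epsilon>>0. \<forall>z\<in>?s i. \<forall>g\<in>F. g \<noteq> one_F \<longrightarrow> d z (\<phi> g z) \<ge> \<epsilon>"
    using segment_displacement by simp
  then obtain e where e: "\<And>i. i < r \<Longrightarrow> e i > 0"
    "\<And>i z g. \<lbrakk>i < r; z \<in> ?s i; g \<in> F; g \<noteq> one_F\<rbrakk> \<Longrightarrow> d z (\<phi> g z) \<ge> e i"
    by (auto simp: bchoice_iff)
  define \<epsilon> where "\<epsilon> = Min (e ` {..<r})"
  have "0 \<in> {..<r}" using rank by simp
  then have ne: "e ` {..<r} \<noteq> {}" by blast
  show thesis
  proof (rule that[of \<epsilon>])
    show "\<epsilon> > 0" unfolding \<epsilon>_def using ne e by (subst Min_gr_iff) auto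
    fix y g assume y: "y \<in> M" and g: "g \<in> F" "g \<noteq> one_F"
    obtain h i z where h: "h \<in> F" "i < r" "z \<in> ?s i" "y = \<phi> h z"
      using y by (rule cocompact_generators)
    then have zM: "z \<in> M" using seg_subset by auto
    let ?k = "inv_F h \<odot> (g \<odot> h)"
    have k: "?k \<noteq> one_F" using g h
      by (metis FG.inv_closed FG.inv_solve_left' FG.m_closed FG.r_cancel_one FG.r_one)
    have "\<epsilon> \<le> e i" unfolding \<epsilon>_def using h by (intro Min_le) auto
    also have "\<dots> \<le> d z (\<phi> ?k z)" using e h g k by simp
    also have "\<dots> = d y (\<phi> g y)"
      using act_dist_shift[of h "g \<odot> h" z z] h g zM by (simp add: act_mult act_closed)
    finally show "d y (\<phi> g y) \<ge> \<epsilon>" .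
  qed
qed

lemma proper_action: "finite {g \<in> F. d \<xi> (orb g) \<le> \<rho>}"
proof -
  obtain \<epsilon> where e: "\<epsilon> > 0" "\<And>y g. \<lbrakk>y \<in> M; g \<in> F; g \<noteq> one_F\<rbrakk> \<Longrightarrow> d y (\<phi> g y) \<ge> \<epsilon>"
    using uniform_displacement by blast
  define \<delta> where "\<delta> = \<epsilon> / 8"
  have \<delta>: "\<delta> > 0" "6 * \<delta> < \<epsilon>" using e(1) by (simp_all add: \<delta>_def)
  define K where "K = (\<Union>i<r. seg \<xi> (orb [(i, True)]))"
  have KM: "K \<subseteq> M" using seg_subset by (auto simp: K_def)
  have "0 < r" using rank by simp
  then have "\<xi> \<in> seg \<xi> (orb [(0, True)])" "0 \<in> {..<r}" by (simp_all add: ends_in_seg)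
  then have xK: "\<xi> \<in> K" unfolding K_def by blast
  have cover: "\<exists>g\<in>F. \<exists>z\<in>K. y = \<phi> g z" if "y \<in> M" for y
    using that by (rule cocompact_generators) (auto simp: K_def)
  have "\<exists>N. finite N \<and> N \<subseteq> M \<and> (\<forall>y\<in>K. \<exists>n\<in>N. d y n \<le> \<delta>)"
  proof -
    have "\<exists>N. finite N \<and> N \<subseteq> M \<and> (\<forall>z\<in>seg x y. \<exists>n\<in>N. d z n \<le> \<delta>)" if xy: "x \<in> M" "y \<in> M" for x y
    proof -
      obtain f n where f: "f 0 = x" "f (Suc n) = y" "real n \<le> d x y / \<delta>"
        "\<And>i. i \<le> Suc n \<Longrightarrow> f i \<in> seg x y" "\<And>i. i \<le> n \<Longrightarrow> d (f i) (f (Suc i)) \<le> \<delta>"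
        using seg_chain[OF xy \<delta>(1)] by metis
      have fM: "f i \<in> M" if "i \<le> Suc n" for i using f(4)[OF that] seg_subset by auto
      have "\<exists>m\<in>f ` {..n}. d z m \<le> \<delta>" if z: "z \<in> seg x y" for z
      proof -
        have zM: "z \<in> M" using z seg_subset by auto
        then obtain i where i: "i \<le> n" "gp z (f i) (f (Suc i)) \<le> 0"
          using gp_chain[of z n f 0] fM z f(1,2) seg_iff by auto
        then have "z \<in> seg (f i) (f (Suc i))" using fM zM by (simp add: seg_iff_le)
        then have "d z (f i) \<le> \<delta>" using seg_dist[of z "f i" "f (Suc i)"] f(5)[OF i(1)] nonneg[of z
            "f (Suc i)"]
          commute[of z "f i"] by linarith
        then show ?thesis using i by auto
      qed
      then show ?thesis using fM by (intro exI[of _ "f ` {..n}"]) auto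
    qed
    then have "\<forall>i\<in>{..<r}. \<exists>N. finite N \<and> N \<subseteq> M \<and> (\<forall>z\<in>seg \<xi> (orb [(i, True)]). \<exists>n\<in>N. d z n \<le> \<delta>)"
      by simp
    then obtain N where "\<forall>i\<in>{..<r}. finite (N i) \<and> N i \<subseteq> M \<and> (\<forall>z\<in>seg \<xi> (orb [(i, True)]). \<exists>n\<in>N i. d
        z n \<le> \<delta>)"
      unfolding bchoice_iff by blast
    then show ?thesis unfolding K_def by (intro exI[of _ "\<Union>i<r. N i"]) fastforce
  qed
  then obtain N where N: "finite N" "N \<subseteq> M" "\<And>y. y \<in> K \<Longrightarrow> \<exists>n\<in>N. d y n \<le> \<delta>" by blast
  define S where "S = {g \<in> F. \<exists>y\<in>K. \<exists>z\<in>K. d y (\<phi> g z) \<le> \<delta>}"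
  have "finite S"
  proof -
    have "\<exists>p\<in>N \<times> N. d (fst p) (\<phi> g (snd p)) \<le> 3 * \<delta>" if g: "g \<in> S" for g
    proof -
      obtain y z where yz: "g \<in> F" "y \<in> K" "z \<in> K" "d y (\<phi> g z) \<le> \<delta>" using g S_def by blast
      obtain m n where mn: "m \<in> N" "d y m \<le> \<delta>" "n \<in> N" "d z n \<le> \<delta>" using N(3) yz by meson
      have M: "y \<in> M" "z \<in> M" "m \<in> M" "n \<in> M" "\<phi> g z \<in> M" "\<phi> g n \<in> M"
        using yz mn KM N by (auto simp: act_closed)
      have "d m (\<phi> g n) \<le> d m y + (d y (\<phi> g z) + d (\<phi> g z) (\<phi> g n))"
        using triangle[of m y "\<phi> g n"] triangle[of y "\<phi> g z" "\<phi> g n"] M by simp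
      also have "d (\<phi> g z) (\<phi> g n) = d z n" using act_isometry yz M by blast
      finally show ?thesis using yz mn by (intro bexI[of _ "(m, n)"]) (auto simp: commute)
    qed
    then obtain p where p: "\<And>g. g \<in> S \<Longrightarrow> p g \<in> N \<times> N \<and> d (fst (p g)) (\<phi> g (snd (p g))) \<le> 3 * \<delta>"
      by metis
    have "inj_on p S"
    proof (rule inj_onI)
      fix g h assume gh: "g \<in> S" "h \<in> S" "p g = p h"
      let ?m = "fst (p g)" and ?n = "snd (p g)"
      have F: "g \<in> F" "h \<in> F" using gh S_def by auto
      have M: "?m \<in> M" "?n \<in> M" using p[OF gh(1)] N(2) by auto
      have "d (\<phi> h ?n) (\<phi> g ?n) \<le> d (\<phi> h ?n) ?m + d ?m (\<phi> g ?n)"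
        using M F by (intro triangle) (auto simp: act_closed)
      also have "\<dots> \<le> 6 * \<delta>" using p[OF gh(1)] p[OF gh(2)] gh(3) commute[of "\<phi> h ?n"] by auto
      finally have "d ?n (\<phi> (inv_F h \<odot> g) ?n) < \<epsilon>" using \<delta> F M by (simp add: act_dist_shift)
      then have "inv_F h \<odot> g = one_F" using e(2)[of ?n "inv_F h \<odot> g"] M F by force
      then show "g = h" using F by (metis FG.inv_equality FG.inv_closed FG.inv_inv)
    qed
    moreover have "p ` S \<subseteq> N \<times> N" using p by blast
    ultimately show ?thesis using N(1) by (metis finite_SigmaI inj_on_finite)
  qed
  have "finite {g \<in> F. \<exists>y\<in>K. d \<xi> (\<phi> g y) \<le> real n * \<delta>}" for n
  proof (induction n)
    case 0
    have "{g \<in> F. \<exists>y\<in>K. d \<xi> (\<phi> g y) \<le> real 0 * \<delta>} \<subseteq> S"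
      unfolding S_def using xK \<delta> by (force intro: order_trans[of _ 0 \<delta>])
    then show ?case using \<open>finite S\<close> finite_subset by blast
  next
    case (Suc n)
    let ?A = "{g \<in> F. \<exists>y\<in>K. d \<xi> (\<phi> g y) \<le> real n * \<delta>}"
    have "{g \<in> F. \<exists>y\<in>K. d \<xi> (\<phi> g y) \<le> real (Suc n) * \<delta>} \<subseteq> (\<lambda>(h, s). h \<odot> s) ` (?A \<times> S)"
    proof
      fix g assume "g \<in> {g \<in> F. \<exists>y\<in>K. d \<xi> (\<phi> g y) \<le> real (Suc n) * \<delta>}"
      then obtain y where y: "g \<in> F" "y \<in> K" "d \<xi> (\<phi> g y) \<le> real (Suc n) * \<delta>" by blast
      then have yM: "y \<in> M" "\<phi> g y \<in> M" using KM by (auto simp: act_closed)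
      define t where "t = min (d \<xi> (\<phi> g y)) (real n * \<delta>)"
      have t: "0 \<le> t" "t \<le> d \<xi> (\<phi> g y)" using \<delta> by (auto simp: t_def)
      obtain z where z: "z \<in> seg \<xi> (\<phi> g y)" "d \<xi> z = t" "d z (\<phi> g y) = d \<xi> (\<phi> g y) - t"
        using seg_point[OF basepoint yM(2) t] by blast
      have le: "d \<xi> z \<le> real n * \<delta>" using z(2) by (simp add: t_def)
      have le': "d z (\<phi> g y) \<le> \<delta>"
        unfolding z(3) t_def using y(3) \<delta>(1) by (auto simp: min_def algebra_simps)
      have zM: "z \<in> M" using z seg_subset by auto
      then obtain h w where h: "h \<in> F" "w \<in> K" "z = \<phi> h w" using cover by blast
      have "h \<in> ?A" using h le by blast
      moreover have "inv_F h \<odot> g \<in> S"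
      proof -
        have "d w (\<phi> (inv_F h \<odot> g) y) \<le> \<delta>"
          using act_dist_shift[of h g w y] h y le' yM KM by auto
        then show ?thesis unfolding S_def using h y by blast
      qed
      moreover have "g = h \<odot> (inv_F h \<odot> g)" using h y by (simp add: FG.m_assoc[symmetric])
      ultimately show "g \<in> (\<lambda>(h, s). h \<odot> s) ` (?A \<times> S)"
        by (intro image_eqI[of _ _ "(h, inv_F h \<odot> g)"]) auto
    qed
    moreover have "finite ((\<lambda>(h, s). h \<odot> s) ` (?A \<times> S))" using Suc \<open>finite S\<close> by blast
    ultimately show ?case using finite_subset by blast
  qed
  note fin = this
  obtain n where "\<rho> / \<delta> \<le> real n" using real_arch_simple by blast
  then have "\<rho> \<le> real n * \<delta>" using \<delta> by (simp add: field_simps)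
  then have "{g \<in> F. d \<xi> (orb g) \<le> \<rho>} \<subseteq> {g \<in> F. \<exists>y\<in>K. d \<xi> (\<phi> g y) \<le> real n * \<delta>}"
    using xK by force
  then show ?thesis using fin finite_subset by blast
qed

end

section \<open>Branch points\<close>

context cv_tree
begin

lemma finite_orb_ball: 
  assumes "y \<in> M"
  shows "finite {g \<in> F. d y (orb g) \<le> \<rho>}"
proof (rule finite_subset)
  show "{g \<in> F. d y (orb g) \<le> \<rho>} \<subseteq> {g \<in> F. d \<xi> (orb g) \<le> \<rho> + d \<xi> y}"
  proof clarify
    fix g assume "g \<in> F" "d y (orb g) \<le> \<rho>"
    then show "d \<xi> (orb g) \<le> \<rho> + d \<xi> y" using triangle[of \<xi> y "orb g"] assms by simp
  qed
qed (rule proper_action)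

lemma direction_endpoint:
  assumes "z \<in> M" "y \<in> seg a b" "y \<noteq> z" "a \<in> M" "b \<in> M"
  shows "0 < gp z y a \<or> 0 < gp z y b"
proof (rule ccontr)
  assume "\<not> ?thesis"
  moreover have "y \<in> M" using assms seg_subset by auto
  ultimately have 0: "gp z y a = 0" "gp z y b = 0" using gp_nonneg[of z y] assms by force+
  have "d a b \<le> d a z + d z b" using assms by (intro triangle)
  then have "d y z \<le> 0" using seg_dist[OF assms(2)] 0 by (simp add: gp_def commute)
  then show False using assms \<open>y \<in> M\<close> by (metis nonneg zero order_antisym)
qed

lemma branch_pointE:
  assumes "z \<in> branch_points M d"
  obtains y where "z \<in> M" "\<And>i. y i \<in> M" "\<And>i::nat. y i \<noteq> z"
     "\<And>i j. \<lbrakk>i < 3; j < 3; i \<noteq> j\<rbrakk> \<Longrightarrow> gp z (y i) (y j) = 0"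
proof -
  have dir: "gp z a b = 0" if zab: "z \<in> M" "a \<in> M" "b \<in> M" "seg z a \<inter> seg z b = {z}" for a b
  proof -
    obtain p where p: "p \<in> seg a b" "d z p = gp z a b" "p \<in> seg z a" "p \<in> seg z b"
      using projection[OF zab(1-3)] by metis
    then have "p = z" using zab by blast
    then show ?thesis using p zab by simp
  qed
  obtain a b c where abc: "z \<in> M" "a \<in> M - {z}" "b \<in> M - {z}" "c \<in> M - {z}"
    "seg z a \<inter> seg z b = {z}" "seg z a \<inter> seg z c = {z}" "seg z b \<inter> seg z c = {z}"
    using assms unfolding branch_points_def by blast
  then have "gp z a b = 0" "gp z a c = 0" "gp z b c = 0" using dir by auto
  then show thesis
    using abc by (intro that[of "\<lambda>i. if i = 0 then a else if i = 1 then b else c"])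
      (auto simp: gp_commute less_Suc_eq numeral_3_eq_3)
qed

lemma branch_pointI:
  assumes "z \<in> M" "a \<in> M" "b \<in> M" "c \<in> M" "z \<noteq> a" "z \<noteq> b" "z \<noteq> c"
    "gp z a b = 0" "gp z a c = 0" "gp z b c = 0"
  shows "z \<in> branch_points M d"
proof -
  have "seg z p \<inter> seg z q = {z}" if "p \<in> M" "q \<in> M" "gp z p q = 0" for p q
  proof -
    have "w = z" if w: "w \<in> seg z p" "w \<in> seg z q" for w
    proof -
      have wM: "w \<in> M" using w seg_subset by auto
      have "min (gp z p w) (gp z w q) \<le> gp z p q" using that assms wM \<open>p \<in> M\<close> \<open>q \<in> M\<close> by (intro
          hyperbolic)
      moreover have "gp z p w = d z w" "gp z w q = d z w"
        using seg_dist[OF w(1)] seg_dist[OF w(2)] by (auto simp: gp_def commute)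
      ultimately have "d z w \<le> 0" using \<open>gp z p q = 0\<close> by simp
      then show ?thesis using assms(1) wM by (metis nonneg zero order_antisym)
    qed
    then show ?thesis using assms(1) that ends_in_seg(1) by auto
  qed
  then have "seg z a \<inter> seg z b = {z}" "seg z a \<inter> seg z c = {z}" "seg z b \<inter> seg z c = {z}"
    using assms by auto
  then show ?thesis using assms unfolding branch_points_def by blast
qed

lemma branch_act:
  assumes "g \<in> F" "z \<in> branch_points M d"
  shows "\<phi> g z \<in> branch_points M d"
proof -
  obtain y where y: "z \<in> M" "\<And>i. y i \<in> M" "\<And>i::nat. y i \<noteq> z"
     "\<And>i j. \<lbrakk>i < 3; j < 3; i \<noteq> j\<rbrakk> \<Longrightarrow> gp z (y i) (y j) = 0"
    using branch_pointE[OF assms(2)] by metis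
  have "\<phi> g z \<noteq> \<phi> g (y i)" for i using y assms by (metis act_inv)
  then show ?thesis
    using y assms by (intro branch_pointI[of _ "\<phi> g (y 0)" "\<phi> g (y 1)" "\<phi> g (y 2)"]) 
      (auto simp: act_closed gp_act)
qed

lemma branch_subset: "branch_points M d \<subseteq> M"
  by (auto simp: branch_points_def)

lemma branch_act_iff:
  assumes "g \<in> F" "z \<in> M"
  shows "\<phi> g z \<in> branch_points M d \<longleftrightarrow> z \<in> branch_points M d"
  using branch_act[OF assms(1)] branch_act[of "inv_F g" "\<phi> g z"] assms act_inv by auto

lemma median_unique:
  assumes "a \<in> M" "b \<in> M" "z \<in> M" "w \<in> M"
    "gp z a b = 0" "gp z a c = 0" "gp z b c = 0" "gp w a b = 0" "gp w a c = 0" "gp w b c = 0"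
  shows "z = w"
proof (rule seg_unique[OF assms(1,2)])
  show "z \<in> seg a b" "w \<in> seg a b" using assms by (auto simp: seg_iff)
  show "d a z = d a w" using assms(5-) by (simp add: gp_def commute[of a])
qed

text \<open>A ball is covered by finitely many segments between orbit points, and by
  \<open>direction_endpoint\<close> every branch point in it is the median of three of their endpoints.\<close>

lemma finite_branch_ball:
  assumes "y \<in> M"
  shows "finite {z \<in> branch_points M d. d y z \<le> \<rho>}"
proof -
  obtain R where R: "\<And>y. y \<in> M \<Longrightarrow> \<exists>g\<in>F. d y (orb g) \<le> R" using cocompact by blast
  define A where "A = (\<Sum>i<r. d \<xi> (orb [(i, True)]))"
  have A: "d \<xi> (orb [(i, True)]) \<le> A" if "i < r" for i
    unfolding A_def using that by (intro member_le_sum) auto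
  define S where "S = {g \<in> F. d y (orb g) \<le> \<rho> + 1 + 2 * A}"
  have finS: "finite S" unfolding S_def by (rule finite_orb_ball[OF assms])
  define E where "E = orb ` S"
  have finE: "finite E" and EM: "E \<subseteq> M" using finS by (auto simp: E_def S_def)
  have cover: "\<exists>a\<in>E. \<exists>b\<in>E. w \<in> seg a b" if w: "w \<in> M" "d y w \<le> \<rho> + 1" for w
  proof -
    obtain g i z where g: "g \<in> F" "i < r" "z \<in> seg \<xi> (orb [(i, True)])" "w = \<phi> g z"
      using w(1) by (rule cocompact_generators)
    let ?h = "g \<odot> [(i, True)]"
    have seg: "w \<in> seg (orb g) (orb ?h)" using g by (simp add: act_mult seg_act)
    have "d (orb g) (orb ?h) \<le> A" using g A by (simp add: act_mult act_isometry)
    then have "d w (orb g) \<le> A" "d w (orb ?h) \<le> A"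
      using seg_dist[OF seg] nonneg[of w "orb g"] nonneg[of w "orb ?h"] commute[of w "orb g"] by
          linarith+
    moreover have "d y (orb g) \<le> d y w + d w (orb g)" "d y (orb ?h) \<le> d y w + d w (orb ?h)"
      using g w assms by (auto intro!: triangle)
    moreover have "0 \<le> A" unfolding A_def by (intro sum_nonneg) auto
    ultimately have "orb g \<in> E" "orb ?h \<in> E" unfolding E_def S_def using w g by auto
    with seg show ?thesis by blast
  qed
  let ?P = "\<lambda>z t. gp z (fst t) (fst (snd t)) = 0 \<and> gp z (fst t) (snd (snd t)) = 0
      \<and> gp z (fst (snd t)) (snd (snd t)) = 0"
  have "\<exists>t\<in>E \<times> E \<times> E. ?P z t" if z: "z \<in> branch_points M d" "d y z \<le> \<rho>" for z
  proof -
    obtain f where f: "z \<in> M" "\<And>i. f i \<in> M" "\<And>i::nat. f i \<noteq> z"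
       "\<And>i j. \<lbrakk>i < 3; j < 3; i \<noteq> j\<rbrakk> \<Longrightarrow> gp z (f i) (f j) = 0"
      using branch_pointE[OF z(1)] by metis
    have "\<exists>e\<in>E. 0 < gp z (f i) e" for i
    proof -
      have pos: "0 < d z (f i)" using f(1,2,3) by (metis nonneg zero order_le_less)
      define t where "t = min 1 (d z (f i))"
      have t: "0 \<le> t" "t \<le> d z (f i)" "0 < t" "t \<le> 1" using pos by (auto simp: t_def)
      obtain w where w: "w \<in> seg z (f i)" "d z w = t" using seg_point[OF f(1,2) t(1,2)] by blast
      have wM: "w \<in> M" using w seg_subset by auto
      have "d y w \<le> d y z + d z w" using triangle assms f wM by blast
      then obtain a b where ab: "a \<in> E" "b \<in> E" "w \<in> seg a b" using cover[OF wM] w z t by auto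
      have "w \<noteq> z" using w t f by auto
      then obtain e where e: "e \<in> E" "0 < gp z w e"
        using direction_endpoint[OF f(1) ab(3)] ab EM by blast
      have "gp z (f i) w = t" using seg_dist[OF w(1)] w(2) by (simp add: gp_def commute)
      moreover have "min (gp z (f i) w) (gp z w e) \<le> gp z (f i) e"
        using f wM e EM by (intro hyperbolic) auto
      ultimately show ?thesis using e t by (intro bexI[of _ e]) (auto simp: min_def split: if_splits)
    qed
    then obtain e where e: "\<And>i. e i \<in> E" "\<And>i. 0 < gp z (f i) (e i)" by metis
    have "gp z (e i) (e j) = 0" if ij: "i < 3" "j < 3" "i \<noteq> j" for i j
    proof -
      have M: "e i \<in> M" "e j \<in> M" using e EM by auto
      have "min (gp z (f i) (e i)) (gp z (e i) (f j)) \<le> gp z (f i) (f j)"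
        "min (gp z (e i) (e j)) (gp z (e j) (f j)) \<le> gp z (e i) (f j)"
        using f M by (auto intro!: hyperbolic)
      then have "gp z (e i) (e j) \<le> 0"
        using e(2)[of i] e(2)[of j] f(4)[OF ij] by (auto simp: gp_commute min_def split: if_splits)
      then show ?thesis using gp_nonneg[of z "e i" "e j"] f M by auto
    qed
    from this[of 0 1] this[of 0 2] this[of 1 2]
    show ?thesis using e(1) by (intro bexI[of _ "(e 0, e 1, e 2)"]) auto
  qed
  then obtain t where t: "\<And>z. \<lbrakk>z \<in> branch_points M d; d y z \<le> \<rho>\<rbrakk> \<Longrightarrow> t z \<in> E \<times> E \<times> E \<and> ?P z (t z)"
    by metis
  let ?B = "{z \<in> branch_points M d. d y z \<le> \<rho>}"
  have "inj_on t ?B"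
  proof (rule inj_onI)
    fix z w assume zw: "z \<in> ?B" "w \<in> ?B" "t z = t w"
    have P: "?P z (t z)" "?P w (t z)" "t z \<in> E \<times> E \<times> E"
      using t[of z] t[of w] zw by auto
    obtain a b c where abc: "t z = (a, b, c)" by (cases "t z")
    show "z = w" using P zw EM branch_subset unfolding abc by (intro median_unique[of a b z w c]) auto
  qed
  moreover have "t ` ?B \<subseteq> E \<times> E \<times> E" using t by blast
  ultimately show ?thesis using finE by (meson finite_SigmaI inj_on_finite)
qed

lemma branch_separation:
  obtains \<epsilon> where "\<epsilon> > 0"
    "\<And>u v. \<lbrakk>u \<in> branch_points M d; v \<in> branch_points M d; u \<noteq> v\<rbrakk> \<Longrightarrow> \<epsilon> \<le> d u v"
proof -
  obtain R where R: "\<And>y. y \<in> M \<Longrightarrow> \<exists>g\<in>F. d y (orb g) \<le> R" using cocompact by blast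
  define B where "B = {z \<in> branch_points M d. d \<xi> z \<le> R + 1}"
  have finB: "finite B" unfolding B_def by (rule finite_branch_ball) simp
  define D where "D = insert 1 ((\<lambda>(u, v). d u v) ` {(u, v) \<in> B \<times> B. u \<noteq> v})"
  have "finite {(u, v) \<in> B \<times> B. u \<noteq> v}" using finB by (auto intro: finite_subset[of _ "B \<times> B"])
  then have finD: "finite D" "D \<noteq> {}" by (auto simp: D_def)
  have pos: "0 < e" if "e \<in> D" for e
  proof -
    have "0 < d u v" if "u \<in> B" "v \<in> B" "u \<noteq> v" for u v
      using that branch_subset unfolding B_def
      by (metis (no_types, lifting) mem_Collect_eq nonneg order_le_less subsetD zero)
    then show ?thesis using that unfolding D_def by auto
  qed
  show thesis
  proof (rule that[of "Min D"])
    show "0 < Min D" using finD pos by simp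
    fix u v assume uv: "u \<in> branch_points M d" "v \<in> branch_points M d" "u \<noteq> v"
    then have uvM: "u \<in> M" "v \<in> M" using branch_subset by auto
    show "Min D \<le> d u v"
    proof (cases "d u v \<le> 1")
      case True
      obtain g where g: "g \<in> F" "d u (orb g) \<le> R" using R uvM by blast
      let ?u = "\<phi> (inv_F g) u" and ?v = "\<phi> (inv_F g) v"
      have b: "?u \<in> branch_points M d" "?v \<in> branch_points M d" using branch_act uv g by auto
      then have M: "?u \<in> M" "?v \<in> M" using branch_subset by auto
      have "d \<xi> ?u = d u (orb g)"
        using act_isometry[of "inv_F g" "orb g" u] g uvM by (simp add: act_inv commute)
      moreover have duv: "d ?u ?v = d u v" using g uvM by (simp add: act_isometry)
      moreover have "d \<xi> ?v \<le> d \<xi> ?u + d ?u ?v" using triangle M by simp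
      ultimately have "?u \<in> B" "?v \<in> B" using b g True by (auto simp: B_def)
      moreover have "?u \<noteq> ?v" using uv(3) act_inv' g uvM by metis
      ultimately have "d ?u ?v \<in> D" unfolding D_def by force
      then show ?thesis using finD duv by (metis Min_le)
    next
      case False
      moreover have "Min D \<le> 1" using finD by (intro Min_le) (auto simp: D_def)
      ultimately show ?thesis by linarith
    qed
  qed
qed

lemma ab_words:
  defines "w \<equiv> \<lambda>i j. replicate i (0, True) @ replicate j (Suc 0, True)"
  shows "w i j \<in> F" "d \<xi> (orb (w i j)) \<le> (real i + real j) * (d \<xi> (orb [(0, True)]) + d \<xi> (orb [(1,
      True)]))"
    "inj (\<lambda>(i, j). w i j)"
proof -
  let ?A = "d \<xi> (orb [(0, True)]) + d \<xi> (orb [(1, True)])"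
  have red: "reduced_word v" if "set v \<subseteq> {(0, True), (Suc 0, True)}" for v
    using that
  proof (induction v)
    case (Cons a v)
    then show ?case by (cases v) (auto simp: reduced_Cons inv_letter_def)
  qed simp
  have inF: "v \<in> F" if "set v \<subseteq> {(0, True), (Suc 0, True)}" for v
    using red[OF that] that rank by (auto simp: free_group_def)
  have sub: "set (w i j) \<subseteq> {(0, True), (Suc 0, True)}" by (auto simp: w_def)
  show "w i j \<in> F" using inF[OF sub] .
  have "d \<xi> (orb v) \<le> real (length v) * ?A" if "set v \<subseteq> {(0, True), (Suc 0, True)}" for v
    using that
  proof (induction v)
    case Nil
    have "[] = one_F" by (simp add: free_group_def)
    then show ?case using act_one[OF basepoint] by simp
  next
    case (Cons a v)
    note av = free_group_ConsD[OF inF[OF Cons.prems]]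
    have "d \<xi> (orb (a # v)) \<le> d \<xi> (orb [a]) + d (orb [a]) (orb ([a] \<odot> v))"
      unfolding av(3) using inF[OF Cons.prems] av by (intro triangle) auto
    also have "d (orb [a]) (orb ([a] \<odot> v)) = d \<xi> (orb v)"
 using act_mult[OF av(1,2) basepoint] av by (simp add: act_isometry)
    also have "d \<xi> (orb [a]) \<le> ?A" using Cons.prems by auto
    finally show ?case using Cons by (simp add: algebra_simps)
  qed
  from this[OF sub] show "d \<xi> (orb (w i j)) \<le> (real i + real j) * ?A" by (simp add: w_def)
  show "inj (\<lambda>(i, j). w i j)"
  proof (rule injI, clarify)
    fix i j i' j' assume eq: "w i j = w i' j'"
    have "length (filter (\<lambda>a. a = (0, True)) (w i j)) = i" for i j by (simp add: w_def)
    moreover have "length (filter (\<lambda>a. a = (Suc 0, True)) (w i j)) = j" for i j by (simp add: w_def)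
    ultimately show "i = i' \<and> j = j'" using eq by metis
  qed
qed

text \<open>A long segment without branch points would carry all the points \<open>g a\<^sup>i b\<^sup>j \<xi>\<close> near
  its midpoint: quadratically many uniformly separated points in linear space.\<close>

lemma branch_dense:
  obtains D where "D > 0"
    "\<And>y z. \<lbrakk>y \<in> M; z \<in> M; D \<le> d y z\<rbrakk> \<Longrightarrow> \<exists>w\<in>branch_points M d. w \<in> seg y z \<and> d y w \<le> D"
proof -
  obtain R0 where R0: "\<And>y. y \<in> M \<Longrightarrow> \<exists>g\<in>F. d y (orb g) \<le> R0" using cocompact by blast
  define R where "R = max R0 1"
  have R: "\<And>y. y \<in> M \<Longrightarrow> \<exists>g\<in>F. d y (orb g) \<le> R" and "R > 0" using R0 unfolding R_def by force+
  obtain \<epsilon> where \<epsilon>: "\<epsilon> > 0" "\<And>y g. \<lbrakk>y \<in> M; g \<in> F; g \<noteq> one_F\<rbrakk> \<Longrightarrow> d y (\<phi> g y) \<ge> \<epsilon>"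
    using uniform_displacement by blast
  define A where "A = d \<xi> (orb [(0, True)]) + d \<xi> (orb [(1, True)])"
  have "A \<ge> 0" by (simp add: A_def)
  define w where "w i j = replicate i (0::nat, True) @ replicate j (Suc 0, True)" for i j
  note w = ab_words[folded w_def A_def]
  have "\<exists>n. (2 * R + 4 * real n * A + 1) / \<epsilon> + 1 < real n * real n"
  proof -
    define c where "c = (2 * R + 4 * A + 1) / \<epsilon> + 1"
    obtain n where n: "max c 1 < real n" using reals_Archimedean2 by blast
    have "(2 * R + 4 * real n * A + 1) / \<epsilon> + 1 \<le> real n * c"
    proof -
      have "2 * R + 1 \<le> real n * (2 * R + 1)" using n \<open>R > 0\<close> by simp
      then have "2 * R + 4 * real n * A + 1 \<le> real n * (2 * R + 4 * A + 1)" by (simp add: algebra_simps)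
      then have "(2 * R + 4 * real n * A + 1) / \<epsilon> \<le> real n * (2 * R + 4 * A + 1) / \<epsilon>"
        using \<epsilon>(1) by (intro divide_right_mono) auto
      then show ?thesis unfolding c_def using n by (simp add: algebra_simps)
    qed
    also have "\<dots> < real n * real n" using n by simp
    finally show ?thesis by blast
  qed
  then obtain n where n: "(2 * R + 4 * real n * A + 1) / \<epsilon> + 1 < real n * real n" by blast
  define D where "D = 2 * R + 4 * real n * A + 1"
  have "D > 0" using \<open>R > 0\<close> \<open>A \<ge> 0\<close> by (simp add: D_def add_pos_nonneg)
  have main: "\<exists>p\<in>branch_points M d. p \<in> seg y z" if yz: "y \<in> M" "z \<in> M" "d y z = D" for y z
  proof (rule ccontr)
    assume neg: "\<not> ?thesis"
    obtain m where m: "m \<in> seg y z" "d y m = D / 2" "d m z = D / 2"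
      using seg_point[OF yz(1,2), of "D / 2"] yz \<open>D > 0\<close> by auto
    have mM: "m \<in> M" using m seg_subset by auto
    have near: "p \<in> seg y z" if p: "p \<in> M" "d m p < D / 2" for p
    proof -
      obtain q where q: "q \<in> seg y z" "d p q = gp p y z" "d y q = gp y p z" "d z q = gp z p y"
        using projection[OF p(1) yz(1,2)] by metis
      have qM: "q \<in> M" using q seg_subset by auto
      have "d p y > 0" "d p z > 0"
        using p triangle[of y p m] triangle[of m p z] m yz mM by (auto simp: commute)
      have four: "d p m + d y z \<le> max (d p y + d m z) (d p z + d m y)" using p mM yz four_point by blast
      show ?thesis
      proof (rule ccontr)
        assume np: "p \<notin> seg y z"
        then have "q \<noteq> p" using q by auto
        have le: "d y p \<le> d y m + d m p" "d p z \<le> d p m + d m z" using triangle p mM yz by auto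
        have "q \<noteq> y"
        proof
          assume "q = y"
          then have "gp y p z = 0" using q yz by simp
          then have "d y p + d y z = d p z" by (simp add: gp_def)
          then show False using le m yz p \<open>d p y > 0\<close> commute[of p m] commute[of p y] by simp
        qed
        have "q \<noteq> z"
        proof
          assume "q = z"
          then have "gp z p y = 0" using q yz by simp
          then have "d z p + d y z = d p y" by (simp add: gp_def commute)
          then show False using le m yz p \<open>d p z > 0\<close> commute[of p z] commute[of p y] by simp
        qed
        have "q \<in> branch_points M d"
        proof (rule branch_pointI[OF qM yz(1,2) p(1) \<open>q \<noteq> y\<close> \<open>q \<noteq> z\<close> \<open>q \<noteq> p\<close>])
          show "gp q y z = 0" using q seg_iff by auto
          show "gp q y p = 0" using q(2,3) commute[of q] commute[of p y] commute[of p z] by (simp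
              add: gp_def field_simps)
          show "gp q z p = 0" using q(2,4) commute[of q] commute[of p y] commute[of p z] commute[of z y]
            by (simp add: gp_def field_simps)
        qed
        then show False using neg q by blast
      qed
    qed
    obtain g where g: "g \<in> F" "d m (orb g) \<le> R" using R mM by blast
    have pt: "orb (g \<odot> w i j) \<in> seg y z" if ij: "i < n" "j < n" for i j
    proof (rule near)
      show "orb (g \<odot> w i j) \<in> M" using g w(1)[of i j] by simp
      have "d m (orb (g \<odot> w i j)) \<le> d m (orb g) + d (orb g) (orb (g \<odot> w i j))"
        using g w(1)[of i j] mM by (intro triangle) auto
      also have "d (orb g) (orb (g \<odot> w i j)) = d \<xi> (orb (w i j))"
        using g w(1)[of i j] by (simp add: act_mult act_isometry)
      also have "\<dots> \<le> (real i + real j) * A" using w(2) .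
      also have "\<dots> \<le> (2 * real n) * A" using ij \<open>A \<ge> 0\<close> by (intro mult_right_mono) auto
      finally show "d m (orb (g \<odot> w i j)) < D / 2" using g by (simp add: D_def)
    qed
    define f where "f = (\<lambda>(i, j). nat \<lfloor>d y (orb (g \<odot> w i j)) / \<epsilon>\<rfloor>)"
    have inj: "inj_on f ({..<n} \<times> {..<n})"
    proof (rule inj_onI, clarify)
      fix i j i' j' assume ij: "i < n" "j < n" "i' < n" "j' < n" "f (i, j) = f (i', j')"
      let ?h = "g \<odot> w i j" and ?h' = "g \<odot> w i' j'"
      have h: "?h \<in> F" "?h' \<in> F" using g w(1) by auto
      have "\<lfloor>d y (orb ?h) / \<epsilon>\<rfloor> = \<lfloor>d y (orb ?h') / \<epsilon>\<rfloor>"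
        using ij(5) \<epsilon>(1) unfolding f_def by (simp add: nat_eq_iff)
      then have "\<bar>d y (orb ?h) / \<epsilon> - d y (orb ?h') / \<epsilon>\<bar> < 1" by linarith
      then have "\<bar>d y (orb ?h) - d y (orb ?h')\<bar> < \<epsilon>"
        using \<epsilon>(1) by (simp add: diff_divide_distrib[symmetric] abs_divide field_simps)
      then have "d (orb ?h) (orb ?h') < \<epsilon>" using seg_dist_eq[OF yz(1,2) pt pt] ij by simp
      then have "d \<xi> (\<phi> (inv_F ?h \<odot> ?h') \<xi>) < \<epsilon>" using h by (simp add: act_dist_shift)
      then have "inv_F ?h \<odot> ?h' = one_F" using \<epsilon>(2)[of \<xi> "inv_F ?h \<odot> ?h'"] h by force
      then have "?h = ?h'" using h by (metis FG.inv_equality FG.inv_closed FG.inv_inv)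
      then have "w i j = w i' j'" using g w(1) by simp
      then show "i = i' \<and> j = j'" using w(3) by (auto dest: injD[of _ "(i, j)" "(i', j')"])
    qed
    have sub: "f ` ({..<n} \<times> {..<n}) \<subseteq> {..nat \<lfloor>D / \<epsilon>\<rfloor>}"
    proof clarify
      fix i j assume "i < n" "j < n"
      then have "d y (orb (g \<odot> w i j)) \<le> D"
        using seg_dist[OF pt[of i j]] nonneg[of "orb (g \<odot> w i j)" z] yz(3) by auto
      then show "f (i, j) \<le> nat \<lfloor>D / \<epsilon>\<rfloor>"
        unfolding f_def using \<epsilon>(1) by (auto intro!: nat_mono floor_mono divide_right_mono)
    qed
    have "card ({..<n} \<times> {..<n}) \<le> card {..nat \<lfloor>D / \<epsilon>\<rfloor>}"
      by (rule card_inj_on_le[OF inj sub]) simp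
    then have "n * n \<le> nat \<lfloor>D / \<epsilon>\<rfloor> + 1" by simp
    then have "real n * real n \<le> real (nat \<lfloor>D / \<epsilon>\<rfloor>) + 1"
      by (metis of_nat_mult of_nat_add of_nat_1 of_nat_le_iff)
    also have "real (nat \<lfloor>D / \<epsilon>\<rfloor>) \<le> D / \<epsilon>" using \<open>D > 0\<close> \<epsilon>(1) by simp
    finally show False using n by (simp add: D_def)
  qed
  show thesis
  proof (rule that[OF \<open>D > 0\<close>])
    fix y z assume yz: "y \<in> M" "z \<in> M" "D \<le> d y z"
    obtain x where x: "x \<in> seg y z" "d y x = D" using seg_point[OF yz(1,2), of D] yz \<open>D > 0\<close> by auto
    then obtain p where p: "p \<in> branch_points M d" "p \<in> seg y x"
      using main[of y x] yz seg_subset by blast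
    have "p \<in> seg y z" using seg_sub[OF yz(1,2) x(1)] p by blast
    moreover have "d y p \<le> D" using seg_dist[OF p(2)] nonneg[of p x] x by linarith
    ultimately show "\<exists>w\<in>branch_points M d. w \<in> seg y z \<and> d y w \<le> D" using p by blast
  qed
qed

end

section \<open>Geodesic lines and comparison of two trees\<close>

context rtree
begin

lemma asymptoticD:
  assumes "gromov_asymptotic M d s t" "b \<in> M"
  shows "\<exists>N. \<forall>i\<ge>N. \<forall>j\<ge>N. K \<le> gp b (s i) (t j)"
proof -
  have "\<forall>\<^sub>F x in sequentially \<times>\<^sub>F sequentially. K \<le> (case x of (i, j) \<Rightarrow> gp b (s i) (t j))"
    using assms unfolding gromov_asymptotic_def filterlim_at_top by blast
  then show ?thesis unfolding eventually_prod_sequentially by auto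
qed

lemma asymptoticI:
  assumes "b \<in> M" "range s \<subseteq> M" "range t \<subseteq> M"
    "\<And>K. \<exists>N. \<forall>i\<ge>N. \<forall>j\<ge>N. K \<le> gp b (s i) (t j)"
  shows "gromov_asymptotic M d s t"
  unfolding gromov_asymptotic_def filterlim_at_top
proof (intro ballI allI)
  fix b' K assume b': "b' \<in> M"
  obtain N where N: "\<forall>i\<ge>N. \<forall>j\<ge>N. K + d b b' \<le> gp b (s i) (t j)" using assms(4) by blast
  have "K \<le> gp b' (s i) (t j)" if "i \<ge> N" "j \<ge> N" for i j
  proof -
    have "gp b (s i) (t j) \<le> gp b' (s i) (t j) + d b b'"
      using assms b' by (intro gp_base_change) auto
    with N that show ?thesis by force
  qed
  then show "\<forall>\<^sub>F x in sequentially \<times>\<^sub>F sequentially. K \<le> (case x of (i, j) \<Rightarrow> gp b' (s i) (t j))"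
    unfolding eventually_prod_sequentially by auto
qed

lemma asymptotic_sym:
  assumes "range s \<subseteq> M" "range t \<subseteq> M" "gromov_asymptotic M d s t"
  shows "gromov_asymptotic M d t s"
proof (rule asymptoticI[OF _ assms(2,1)])
  show "s 0 \<in> M" using assms by auto
  then show "\<exists>N. \<forall>i\<ge>N. \<forall>j\<ge>N. K \<le> gp (s 0) (t i) (s j)" for K
    using asymptoticD[OF assms(3), of "s 0" K] by (auto simp: gp_commute)
qed

lemma asymptotic_trans:
  assumes "range s \<subseteq> M" "range t \<subseteq> M" "range u \<subseteq> M"
    "gromov_asymptotic M d s t" "gromov_asymptotic M d t u"
  shows "gromov_asymptotic M d s u"
proof (rule asymptoticI[OF _ assms(1,3)])
  show b: "s 0 \<in> M" using assms by auto
  fix K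
  obtain N N' where N: "\<forall>i\<ge>N. \<forall>j\<ge>N. K \<le> gp (s 0) (s i) (t j)"
    "\<forall>i\<ge>N'. \<forall>j\<ge>N'. K \<le> gp (s 0) (t i) (u j)"
    using asymptoticD[OF assms(4) b, of K] asymptoticD[OF assms(5) b, of K] by blast
  have "K \<le> gp (s 0) (s i) (u j)" if "i \<ge> max N N'" "j \<ge> max N N'" for i j
  proof -
    have "min (gp (s 0) (s i) (t i)) (gp (s 0) (t i) (u j)) \<le> gp (s 0) (s i) (u j)"
      using assms by (intro hyperbolic) auto
    moreover have "K \<le> gp (s 0) (s i) (t i)" "K \<le> gp (s 0) (t i) (u j)" using N that by auto
    ultimately show ?thesis by linarith
  qed
  then show "\<exists>N. \<forall>i\<ge>N. \<forall>j\<ge>N. K \<le> gp (s 0) (s i) (u j)" by blast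
qed

lemma asymptotic_rel_iff:
  "(s, t) \<in> asymptotic_rel M d \<longleftrightarrow> range s \<subseteq> M \<and> range t \<subseteq> M \<and> gromov_asymptotic M d s t"
proof
  assume st: "range s \<subseteq> M \<and> range t \<subseteq> M \<and> gromov_asymptotic M d s t"
  then have "gromov_asymptotic M d s s" "gromov_asymptotic M d t t"
    by (meson asymptotic_sym asymptotic_trans)+
  with st show "(s, t) \<in> asymptotic_rel M d"
    by (auto simp: asymptotic_rel_def converging_at_infinity_def)
qed (auto simp: asymptotic_rel_def converging_at_infinity_def)

definition geodesic_line :: "(real \<Rightarrow> 'a) \<Rightarrow> bool" where
  "geodesic_line c \<longleftrightarrow> range c \<subseteq> M \<and> (\<forall>s t. d (c s) (c t) = \<bar>s - t\<bar>)"

lemma geodesic_line_in: "geodesic_line c \<Longrightarrow> c s \<in> M"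
  and geodesic_line_dist: "geodesic_line c \<Longrightarrow> d (c s) (c t) = \<bar>s - t\<bar>"
  by (auto simp: geodesic_line_def)

lemma geodesic_line_seg:
  assumes "geodesic_line c" "s \<le> t" "z \<in> seg (c s) (c t)"
  shows "z = c (s + d (c s) z)" "s + d (c s) z \<le> t"
proof -
  let ?u = "s + d (c s) z"
  have "d (c s) z + d z (c t) = t - s" using seg_dist[OF assms(3)] assms by (simp add:
      geodesic_line_dist)
  then show le: "?u \<le> t" using nonneg[of z "c t"] by linarith
  have "c ?u \<in> seg (c s) (c t)"
    using assms le by (simp add: tree_segment_def geodesic_line_dist geodesic_line_in)
  then show "z = c ?u"
    using assms by (intro seg_unique[of "c s" "c t"]) (auto simp: geodesic_line_dist geodesic_line_in)
qed

lemma geodesic_line_between: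
  assumes "geodesic_line c" "s \<le> u" "u \<le> t"
  shows "c u \<in> seg (c s) (c t)"
  using assms by (simp add: tree_segment_def geodesic_line_dist geodesic_line_in)

lemma geodesic_line_gp_zero:
  assumes c: "geodesic_line c" and ab: "range a \<subseteq> M" "range b \<subseteq> M"
    "gromov_asymptotic M d a (\<lambda>n. c (- real n))" "gromov_asymptotic M d b (\<lambda>n. c (real n))"
  shows "\<exists>N. \<forall>i\<ge>N. \<forall>j\<ge>N. gp (c \<tau>) (a i) (b j) = 0"
proof -
  have M: "c s \<in> M" "a i \<in> M" "b i \<in> M" for s i using c ab by (auto simp: geodesic_line_in)
  obtain N N' where N: "\<forall>i\<ge>N. \<forall>j\<ge>N. 1 \<le> gp (c \<tau>) (a i) (c (- real j))"
    "\<forall>i\<ge>N'. \<forall>j\<ge>N'. 1 \<le> gp (c \<tau>) (b i) (c (real j))"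
    using asymptoticD[OF ab(3) M(1)] asymptoticD[OF ab(4) M(1)] by blast
  obtain m where m: "max (real N) (max (real N') \<bar>\<tau>\<bar>) \<le> real m" using real_arch_simple by blast
  have "\<bar>\<tau>\<bar> \<le> real m" using m by simp
  then have zero: "gp (c \<tau>) (c (- real m)) (c (real m)) = 0"
    using c by (simp add: gp_def geodesic_line_dist)
  have "gp (c \<tau>) (a i) (b j) = 0" if "i \<ge> max N N'" "j \<ge> max N N'" for i j
  proof -
    have "1 \<le> gp (c \<tau>) (a i) (c (- real m))" "1 \<le> gp (c \<tau>) (b j) (c (real m))" using N m that by auto
    moreover have "min (gp (c \<tau>) (c (- real m)) (a i)) (gp (c \<tau>) (a i) (c (real m))) \<le> gp (c \<tau>) (c
        (- real m)) (c (real m))"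
      "min (gp (c \<tau>) (a i) (b j)) (gp (c \<tau>) (b j) (c (real m))) \<le> gp (c \<tau>) (a i) (c (real m))"
      using M by (auto intro!: hyperbolic)
    ultimately have "gp (c \<tau>) (a i) (b j) \<le> 0"
      using zero gp_commute[of "c \<tau>" "a i" "c (- real m)"] by (auto simp: min_def split: if_splits)
    then show ?thesis using gp_nonneg[of "c \<tau>" "a i" "b j"] M by simp
  qed
  then show ?thesis by blast
qed

lemma geodesic_line_near:
  assumes c: "geodesic_line c" and ab: "range a \<subseteq> M" "range b \<subseteq> M"
    "gromov_asymptotic M d a (\<lambda>n. c (- real n))" "gromov_asymptotic M d b (\<lambda>n. c (real n))"
    and y: "y \<in> M" "\<And>i j. \<lbrakk>N0 \<le> i; N0 \<le> j\<rbrakk> \<Longrightarrow> gp y (a i) (b j) \<le> \<kappa>"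
  shows "\<exists>\<tau>. d y (c \<tau>) \<le> \<kappa>"
proof -
  have M: "c s \<in> M" "a i \<in> M" "b i \<in> M" for s i using c ab by (auto simp: geodesic_line_in)
  obtain N N' where N: "\<forall>i\<ge>N. \<forall>j\<ge>N. \<kappa> + 1 \<le> gp y (a i) (c (- real j))"
    "\<forall>i\<ge>N'. \<forall>j\<ge>N'. \<kappa> + 1 \<le> gp y (b i) (c (real j))"
    using asymptoticD[OF ab(3) y(1)] asymptoticD[OF ab(4) y(1)] by blast
  define m where "m = max N0 (max N N')"
  have "min (gp y (a m) (c (- real m))) (gp y (c (- real m)) (b m)) \<le> gp y (a m) (b m)"
    "min (gp y (c (- real m)) (c (real m))) (gp y (c (real m)) (b m)) \<le> gp y (c (- real m)) (b m)"
    using M y by (auto intro!: hyperbolic)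
  moreover have "gp y (a m) (b m) \<le> \<kappa>" using y by (simp add: m_def)
  moreover have "\<kappa> + 1 \<le> gp y (a m) (c (- real m))" "\<kappa> + 1 \<le> gp y (c (real m)) (b m)"
    using N gp_commute by (auto simp: m_def)
  ultimately have le: "gp y (c (- real m)) (c (real m)) \<le> \<kappa>" by (auto simp: min_def split: if_splits)
  obtain z where z: "z \<in> seg (c (- real m)) (c (real m))" "d y z = gp y (c (- real m)) (c (real m))"
    using projection[OF y(1) M(1) M(1)] by metis
  then show ?thesis using geodesic_line_seg(1)[OF c _ z(1)] le by (metis neg_le_0_iff_le
      of_nat_0_le_iff order_trans)
qed

lemma ray_exists:
  assumes "o' \<in> M" "range b \<subseteq> M" "gromov_asymptotic M d b b"
  obtains c :: "real \<Rightarrow> 'a" where "\<And>t. t \<ge> 0 \<Longrightarrow> c t \<in> M" "\<And>t. t \<ge> 0 \<Longrightarrow> d o' (c t) = t"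
    "\<And>t. t \<ge> 0 \<Longrightarrow> \<exists>N. \<forall>j\<ge>N. c t \<in> seg o' (b j)"
proof -
  have "\<exists>z. z \<in> M \<and> d o' z = t \<and> (\<exists>N. \<forall>j\<ge>N. z \<in> seg o' (b j))" if "t \<ge> 0" for t
  proof -
    obtain N where N: "\<forall>i\<ge>N. \<forall>j\<ge>N. t \<le> gp o' (b i) (b j)" using asymptoticD[OF assms(3,1)] by blast
    have bM: "b i \<in> M" for i using assms by auto
    have "t \<le> d o' (b N)" using N[rule_format, of N N] bM by (simp add: gp_def)
    then obtain z where z: "z \<in> seg o' (b N)" "d o' z = t"
      using seg_point[OF assms(1) bM \<open>t \<ge> 0\<close>] by metis
    have zM: "z \<in> M" using z seg_subset by auto
    have "z \<in> seg o' (b j)" if "j \<ge> N" for j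
    proof -
      have "min (gp o' z (b N)) (gp o' (b N) (b j)) \<le> gp o' z (b j)"
        using assms zM bM by (intro hyperbolic) auto
      moreover have "gp o' z (b N) = t" using seg_dist[OF z(1)] z(2) by (simp add: gp_def)
      ultimately have "t \<le> gp o' z (b j)" using N that by (auto simp: min_def split: if_splits)
      moreover have "d o' (b j) \<le> d o' z + d z (b j)" using triangle assms zM bM by blast
      ultimately show ?thesis using zM z(2) by (simp add: tree_segment_def gp_def field_simps)
    qed
    then show ?thesis using z zM by blast
  qed
  then show thesis using that by metis
qed

lemma geodesic_line_exists:
  assumes ab: "range a \<subseteq> M" "range b \<subseteq> M" "gromov_asymptotic M d a a" "gromov_asymptotic M d b b"
    and bd: "x \<in> M" "\<And>N. \<exists>i\<ge>N. \<exists>j\<ge>N. gp x (a i) (b j) \<le> \<kappa>"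
  obtains c where "geodesic_line c" "gromov_asymptotic M d a (\<lambda>n. c (- real n))"
    "gromov_asymptotic M d b (\<lambda>n. c (real n))"
proof -
  have M: "a i \<in> M" "b i \<in> M" for i using ab by auto
  obtain N1 where N1: "\<forall>i\<ge>N1. \<forall>j\<ge>N1. \<kappa> + 1 \<le> gp x (a i) (a j)" using asymptoticD[OF ab(3) bd(1)] by
      blast
  obtain N2 where N2: "\<forall>i\<ge>N2. \<forall>j\<ge>N2. \<kappa> + 1 \<le> gp x (b i) (b j)" using asymptoticD[OF ab(4) bd(1)] by
      blast
  define N where "N = max N1 N2"
  obtain i0 j0 where ij0: "i0 \<ge> N" "j0 \<ge> N" "gp x (a i0) (b j0) \<le> \<kappa>" using bd(2) by blast
  obtain p where p: "p \<in> seg (a i0) (b j0)" "d x p = gp x (a i0) (b j0)"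
    using projection[OF bd(1) M] by metis
  have pM: "p \<in> M" using p seg_subset by auto
  have zero: "gp p (a i) (b j) = 0" if "i \<ge> N" "j \<ge> N" for i j
  proof -
    have "gp x (a i0) (a i) \<le> gp p (a i0) (a i) + d x p" "gp x (b j0) (b j) \<le> gp p (b j0) (b j) + d x p"
      using bd pM M by (auto intro!: gp_base_change)
    moreover have "\<kappa> + 1 \<le> gp x (a i0) (a i)" "\<kappa> + 1 \<le> gp x (b j0) (b j)"
      using N1 N2 that ij0 by (auto simp: N_def)
    ultimately have "0 < gp p (a i0) (a i)" "0 < gp p (b j) (b j0)"
      using p ij0 gp_commute[of p "b j0" "b j"] by linarith+
    moreover have "min (gp p (a i0) (a i)) (gp p (a i) (b j0)) \<le> gp p (a i0) (b j0)"
      "min (gp p (a i) (b j)) (gp p (b j) (b j0)) \<le> gp p (a i) (b j0)"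
      using M pM by (auto intro!: hyperbolic)
    moreover have "gp p (a i0) (b j0) = 0" using p seg_iff by auto
    ultimately have "gp p (a i) (b j) \<le> 0" by (auto simp: min_def split: if_splits)
    then show ?thesis using gp_nonneg[OF pM M] by (simp add: order_antisym)
  qed
  obtain ca where ca: "\<And>t. t \<ge> 0 \<Longrightarrow> ca t \<in> M" "\<And>t. t \<ge> 0 \<Longrightarrow> d p (ca t) = t"
    "\<And>t. t \<ge> 0 \<Longrightarrow> \<exists>N. \<forall>j\<ge>N. ca t \<in> seg p (a j)" using ray_exists[OF pM ab(1,3)] by metis
  obtain cb where cb: "\<And>t. t \<ge> 0 \<Longrightarrow> cb t \<in> M" "\<And>t. t \<ge> 0 \<Longrightarrow> d p (cb t) = t"
    "\<And>t. t \<ge> 0 \<Longrightarrow> \<exists>N. \<forall>j\<ge>N. cb t \<in> seg p (b j)" using ray_exists[OF pM ab(2,4)] by metis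
  have ray: "d (f s) (f t) = \<bar>s - t\<bar>"
    if st: "s \<ge> 0" "t \<ge> 0" and e: "\<And>i. e i \<in> M" and f: "\<And>t. t \<ge> 0 \<Longrightarrow> d p (f t) = t"
      "\<And>t. t \<ge> 0 \<Longrightarrow> \<exists>N. \<forall>j\<ge>N. f t \<in> seg p (e j)" for f s t and e :: "nat \<Rightarrow> 'a"
  proof -
    obtain N where "\<forall>j\<ge>N. f s \<in> seg p (e j)" using f(2)[OF st(1)] ..
    moreover obtain N' where "\<forall>j\<ge>N'. f t \<in> seg p (e j)" using f(2)[OF st(2)] ..
    ultimately have "f s \<in> seg p (e (max N N'))" "f t \<in> seg p (e (max N N'))" by auto
    from seg_dist_eq[OF pM e this] show ?thesis using f(1)[OF st(1)] f(1)[OF st(2)] by simp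
  qed
  have opp: "d (ca s) (cb t) = s + t" if st: "s \<ge> 0" "t \<ge> 0" for s t
  proof -
    obtain Na where Na: "\<forall>j\<ge>Na. ca s \<in> seg p (a j)" using ca(3)[OF st(1)] ..
    obtain Nb where Nb: "\<forall>j\<ge>Nb. cb t \<in> seg p (b j)" using cb(3)[OF st(2)] ..
    define m where "m = max N (max Na Nb)"
    have m: "m \<ge> N" "ca s \<in> seg p (a m)" "cb t \<in> seg p (b m)"
      using Na Nb by (simp_all add: m_def)
    have "p \<in> seg (a m) (b m)" using zero m pM by (simp add: seg_iff)
    then have "d (a m) p + d p (b m) = d (a m) (b m)" by (rule seg_dist)
    moreover have "d p (ca s) + d (ca s) (a m) = d p (a m)" "d p (cb t) + d (cb t) (b m) = d p (b m)"
      using m by (auto intro: seg_dist)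
    moreover have "d (a m) (b m) \<le> d (a m) (ca s) + (d (ca s) (cb t) + d (cb t) (b m))"
      using triangle[of "a m" "ca s" "b m"] triangle[of "ca s" "cb t" "b m"] M ca(1) cb(1) st by auto
    moreover have "d (ca s) (cb t) \<le> d p (ca s) + d p (cb t)"
      using triangle[of "ca s" p "cb t"] ca(1) cb(1) st pM by (simp add: commute)
    ultimately show ?thesis using ca(2)[OF st(1)] cb(2)[OF st(2)] commute[of "a m" p] commute[of "a
        m" "ca s"]
      by linarith
  qed
  define c where "c t = (if t \<ge> 0 then cb t else ca (- t))" for t
  have "d (c s) (c t) = \<bar>s - t\<bar>" for s t
    using ray[of s t b cb, OF _ _ M(2) cb(2,3)] ray[of "-s" "-t" a ca, OF _ _ M(1) ca(2,3)]
      opp[of "-s" t] opp[of "-t" s] unfolding c_def by (auto simp: commute)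
  then have line: "geodesic_line c" unfolding geodesic_line_def c_def using ca(1) cb(1) by auto
  have lim: "gromov_asymptotic M d e f"
    if e: "range e \<subseteq> M" and f: "range f \<subseteq> M" "\<And>n. d p (f n) = real n"
      "\<And>m n. d (f m) (f n) = \<bar>real m - real n\<bar>" "\<And>n. \<exists>N. \<forall>j\<ge>N. f n \<in> seg p (e j)" for e f
  proof (rule asymptotic_sym[OF f(1) e asymptoticI[OF pM f(1) e]])
    fix K
    obtain k where k: "K \<le> real k" using real_arch_simple by blast
    obtain N where N: "\<forall>j\<ge>N. f k \<in> seg p (e j)" using f(4) by blast
    have "K \<le> gp p (f i) (e j)" if ij: "i \<ge> max N k" "j \<ge> max N k" for i j
    proof -
      have "min (gp p (f i) (f k)) (gp p (f k) (e j)) \<le> gp p (f i) (e j)"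
        using e f(1) pM by (intro hyperbolic) auto
      moreover have "gp p (f i) (f k) = real k" using ij by (simp add: gp_def f(2,3))
      moreover have "gp p (f k) (e j) = real k"
      proof -
        have "f k \<in> seg p (e j)" using N ij by auto
        from seg_dist[OF this] show ?thesis by (simp add: gp_def f(2))
      qed
      ultimately show ?thesis using k by linarith
    qed
    then show "\<exists>N. \<forall>i\<ge>N. \<forall>j\<ge>N. K \<le> gp p (f i) (e j)" by blast
  qed
  have c0: "ca 0 = p" "cb 0 = p" using ca(1,2)[of 0] cb(1,2)[of 0] pM by auto
  then have cneg: "c (- real n) = ca (real n)" for n by (cases "n = 0") (auto simp: c_def)
  have cpos: "c (real n) = cb (real n)" for n by (simp add: c_def)
  show thesis
  proof (rule that[OF line])
    show "gromov_asymptotic M d a (\<lambda>n. c (- real n))"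
      using ca ray[OF _ _ M(1) ca(2,3)] by (intro lim ab(1)) (auto simp: cneg)
    show "gromov_asymptotic M d b (\<lambda>n. c (real n))"
      using cb ray[OF _ _ M(2) cb(2,3)] by (intro lim ab(2)) (auto simp: cpos)
  qed
qed

end

lemma (in cv_tree) boundary_ident_iff:
  assumes "\<And>s. s \<in> p \<Longrightarrow> range s \<subseteq> F"
  shows "t \<in> boundary_ident M d \<phi> p \<longleftrightarrow>
    range t \<subseteq> M \<and> (\<exists>s\<in>p. gromov_asymptotic M d (\<lambda>n. orb (s n)) t)"
proof -
  have "gromov_asymptotic M d (\<lambda>n. \<phi> (s n) \<xi>) t"
    if s: "s \<in> p" "x \<in> M" "range t \<subseteq> M" "gromov_asymptotic M d (\<lambda>n. \<phi> (s n) x) t" for s x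
  proof (rule asymptoticI[OF basepoint])
    have sF: "s n \<in> F" for n using assms s by auto
    show "range (\<lambda>n. \<phi> (s n) \<xi>) \<subseteq> M" using sF by auto
    fix K
    obtain N where N: "\<forall>i\<ge>N. \<forall>j\<ge>N. K + d x \<xi> \<le> gp \<xi> (\<phi> (s i) x) (t j)"
      using asymptoticD[OF s(4) basepoint] by blast
    have "K \<le> gp \<xi> (orb (s i)) (t j)" if "i \<ge> N" "j \<ge> N" for i j
    proof -
      have "gp \<xi> (\<phi> (s i) x) (t j) \<le> gp \<xi> (orb (s i)) (t j) + d (\<phi> (s i) x) (orb (s i))"
        using sF s by (intro gp_point_change) (auto simp: act_closed)
      then show ?thesis using N that sF s by (force simp: act_isometry)
    qed
    then show "\<exists>N. \<forall>i\<ge>N. \<forall>j\<ge>N. K \<le> gp \<xi> (orb (s i)) (t j)" by blast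
  qed (use s in auto)
  moreover have "range (\<lambda>n. \<phi> (s n) x) \<subseteq> M" if "s \<in> p" "x \<in> M" for s x
    using assms[OF that(1)] that(2) by (auto simp: act_closed)
  ultimately show ?thesis
    unfolding boundary_ident_def mem_Collect_eq asymptotic_rel_iff by (meson basepoint)
qed

lemma lamination_sequences:
  assumes "algebraic_lamination r L" "(p, q) \<in> L"
  shows "s \<in> p \<Longrightarrow> range s \<subseteq> carrier (free_group r)" "s \<in> q \<Longrightarrow> range s \<subseteq> carrier (free_group r)"
proof -
  have "p \<in> free_group_boundary r" "q \<in> free_group_boundary r"
    using assms unfolding algebraic_lamination_def double_boundary_def by auto
  then show "s \<in> p \<Longrightarrow> range s \<subseteq> carrier (free_group r)" "s \<in> q \<Longrightarrow> range s \<subseteq> carrier (free_group r)"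
    unfolding free_group_boundary_def gromov_boundary_def quotient_def asymptotic_rel_def
      converging_at_infinity_def by auto
qed

lemma (in cv_tree) geodesic_from_to_iff:
  assumes "algebraic_lamination r L" "(p, q) \<in> L"
  shows "geodesic_from_to M d \<phi> p q c \<longleftrightarrow> geodesic_line c \<and>
    (\<exists>s\<in>p. gromov_asymptotic M d (\<lambda>n. orb (s n)) (\<lambda>n. c (- real n))) \<and>
    (\<exists>s\<in>q. gromov_asymptotic M d (\<lambda>n. orb (s n)) (\<lambda>n. c (real n)))"
proof -
  have p: "t \<in> boundary_ident M d \<phi> p \<longleftrightarrow> range t \<subseteq> M \<and> (\<exists>s\<in>p. gromov_asymptotic M d (\<lambda>n. orb (s n)) t)"
    and q: "t \<in> boundary_ident M d \<phi> q \<longleftrightarrow> range t \<subseteq> M \<and> (\<exists>s\<in>q. gromov_asymptotic M d (\<lambda>n. orb (s n))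
        t)" for t
    using lamination_sequences[OF assms] by (auto intro!: boundary_ident_iff)
  show ?thesis unfolding geodesic_from_to_def geodesic_line_def p q by auto
qed

locale cv_trees = A: cv_tree r M1 d1 \<phi>1 + B: cv_tree r M2 d2 \<phi>2
  for r M1 and d1 :: "'a \<Rightarrow> 'a \<Rightarrow> real" and \<phi>1 M2 and d2 :: "'b \<Rightarrow> 'b \<Rightarrow> real" and \<phi>2
begin

lemma orb_control:
  "\<exists>\<sigma>. \<forall>g\<in>A.F. \<forall>h\<in>A.F. d1 (A.orb g) (A.orb h) \<le> \<rho> \<longrightarrow> d2 (B.orb g) (B.orb h) \<le> \<sigma>"
proof -
  let ?S = "{g \<in> A.F. d1 A.basepoint (A.orb g) \<le> \<rho>}"
  have fin: "finite ?S" by (rule A.proper_action)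
  have "d2 (B.orb g) (B.orb h) \<le> (\<Sum>k\<in>?S. d2 B.basepoint (B.orb k))"
    if gh: "g \<in> A.F" "h \<in> A.F" "d1 (A.orb g) (A.orb h) \<le> \<rho>" for g h
  proof -
    let ?k = "inv\<^bsub>free_group r\<^esub> g \<otimes>\<^bsub>free_group r\<^esub> h"
    have "?k \<in> ?S" using gh by (simp add: A.act_dist_shift)
    then have "d2 B.basepoint (B.orb ?k) \<le> (\<Sum>k\<in>?S. d2 B.basepoint (B.orb k))"
      using fin by (intro member_le_sum) auto
    then show ?thesis using gh by (simp add: B.act_dist_shift)
  qed
  then show ?thesis by blast
qed

lemma orb_Lipschitz:
  "\<exists>\<Lambda>\<ge>0. \<forall>g\<in>A.F. \<forall>h\<in>A.F. d2 (B.orb g) (B.orb h) \<le> \<Lambda> * (d1 (A.orb g) (A.orb h) + 1)"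
proof -
  obtain R where R: "\<And>y. y \<in> M1 \<Longrightarrow> \<exists>g\<in>A.F. d1 y (A.orb g) \<le> R" using A.cocompact by blast
  have R0: "0 \<le> R" using R[OF A.basepoint] A.nonneg by (meson order_trans)
  obtain \<sigma> where \<sigma>: "\<forall>g\<in>A.F. \<forall>h\<in>A.F. d1 (A.orb g) (A.orb h) \<le> 2 * R + 1 \<longrightarrow> d2 (B.orb g) (B.orb h) \<le> \<sigma>"
    using orb_control by blast
  have \<sigma>0: "0 \<le> \<sigma>"
  proof -
    have one: "[] \<in> A.F" using A.FG.one_closed by (auto simp: free_group_def)
    then have "d1 (A.orb []) (A.orb []) = 0" by simp
    then have "d2 (B.orb []) (B.orb []) \<le> \<sigma>" using \<sigma> R0 one by force
    then show ?thesis by (meson B.nonneg order_trans)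
  qed
  have "d2 (B.orb g) (B.orb h) \<le> \<sigma> * (d1 (A.orb g) (A.orb h) + 1)" if gh: "g \<in> A.F" "h \<in> A.F" for g h
  proof -
    have M: "A.orb g \<in> M1" "A.orb h \<in> M1" using gh by auto
    obtain f n where f: "f 0 = A.orb g" "f (Suc n) = A.orb h" "real n \<le> d1 (A.orb g) (A.orb h) / 1"
      "\<And>i. i \<le> Suc n \<Longrightarrow> f i \<in> A.seg (A.orb g) (A.orb h)" "\<And>i. i \<le> n \<Longrightarrow> d1 (f i) (f (Suc i)) \<le> 1"
      using A.seg_chain[OF M, of 1] by (metis zero_less_one)
    have fM: "f i \<in> M1" if "i \<le> Suc n" for i using f(4)[OF that] A.seg_subset by auto
    have "\<exists>k. k \<in> A.F \<and> d1 (f i) (A.orb k) \<le> R \<and> (i = 0 \<longrightarrow> k = g) \<and> (i = Suc n \<longrightarrow> k = h)"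
      if "i \<le> Suc n" for i
      using R[OF fM[OF that]] gh f(1,2) R0 M by (cases "i = 0"; cases "i = Suc n") auto
    then obtain k where k: "\<And>i. i \<le> Suc n \<Longrightarrow> k i \<in> A.F \<and> d1 (f i) (A.orb (k i)) \<le> R \<and>
      (i = 0 \<longrightarrow> k i = g) \<and> (i = Suc n \<longrightarrow> k i = h)" by metis
    have step: "d2 (B.orb (k i)) (B.orb (k (Suc i))) \<le> \<sigma>" if i: "i \<le> n" for i
    proof -
      have ki: "k i \<in> A.F" "k (Suc i) \<in> A.F" "d1 (f i) (A.orb (k i)) \<le> R" "d1 (f (Suc i)) (A.orb (k
          (Suc i))) \<le> R"
        using k[of i] k[of "Suc i"] i by auto
      have "d1 (A.orb (k i)) (A.orb (k (Suc i))) \<le> d1 (A.orb (k i)) (f i) + (d1 (f i) (f (Suc i)) +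
          d1 (f (Suc i)) (A.orb (k (Suc i))))"
        using A.triangle[of "A.orb (k i)" "f i" "A.orb (k (Suc i))"] A.triangle[of "f i" "f (Suc i)"
            "A.orb (k (Suc i))"]
          ki fM[of i] fM[of "Suc i"] i by auto
      then show ?thesis using \<sigma> ki f(5)[OF i] A.commute[of "A.orb (k i)" "f i"] by force
    qed
    have "d2 (B.orb (k 0)) (B.orb (k (Suc i))) \<le> \<sigma> * real (Suc i)" if "i \<le> n" for i
      using that
    proof (induction i)
      case 0
      then show ?case using step[of 0] by simp
    next
      case (Suc i)
      have "d2 (B.orb (k 0)) (B.orb (k (Suc (Suc i)))) \<le>
          d2 (B.orb (k 0)) (B.orb (k (Suc i))) + d2 (B.orb (k (Suc i))) (B.orb (k (Suc (Suc i))))"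
        using k[of 0] k[of "Suc i"] k[of "Suc (Suc i)"] Suc.prems by (intro B.triangle) auto
      with Suc step[of "Suc i"] show ?case by (simp add: algebra_simps)
    qed
    from this[of n] have "d2 (B.orb g) (B.orb h) \<le> \<sigma> * (real n + 1)"
      using k[of 0] k[of "Suc n"] by (simp add: algebra_simps)
    also have "\<dots> \<le> \<sigma> * (d1 (A.orb g) (A.orb h) + 1)"
      using f(3) \<sigma>0 by (intro mult_left_mono) auto
    finally show ?thesis .
  qed
  with \<sigma>0 show ?thesis by blast
qed

text \<open>The segment of the second tree is followed by a coarse path of orbit points. Its image in the
  first tree is still a coarse path, so it cannot bypass a point of the first segment.\<close>

lemma segment_near:
  obtains D D' where "\<And>a b z \<kappa>. \<lbrakk>a \<in> A.F; b \<in> A.F; z \<in> M1; A.gp z (A.orb a) (A.orb b) \<le> \<kappa>\<rbrakk>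
    \<Longrightarrow> \<exists>h\<in>A.F. d1 z (A.orb h) \<le> \<kappa> + D \<and> B.gp (B.orb h) (B.orb a) (B.orb b) \<le> D'"
proof -
  obtain R where R: "\<And>y. y \<in> M2 \<Longrightarrow> \<exists>g\<in>A.F. d2 y (B.orb g) \<le> R" using B.cocompact by blast
  have R0: "0 \<le> R" using R[OF B.basepoint] B.nonneg by (meson order_trans)
  interpret S: cv_trees r M2 d2 \<phi>2 M1 d1 \<phi>1 ..
  obtain D where D: "\<forall>g\<in>A.F. \<forall>h\<in>A.F. d2 (B.orb g) (B.orb h) \<le> 2 * R + 1 \<longrightarrow> d1 (A.orb g) (A.orb h) \<le> D"
    using S.orb_control by blast
  have "\<exists>h\<in>A.F. d1 z (A.orb h) \<le> \<kappa> + D \<and> B.gp (B.orb h) (B.orb a) (B.orb b) \<le> R"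
    if ab: "a \<in> A.F" "b \<in> A.F" "z \<in> M1" "A.gp z (A.orb a) (A.orb b) \<le> \<kappa>" for a b z \<kappa>
  proof -
    have M: "B.orb a \<in> M2" "B.orb b \<in> M2" using ab by auto
    obtain f n where f: "f 0 = B.orb a" "f (Suc n) = B.orb b"
      "\<And>i. i \<le> Suc n \<Longrightarrow> f i \<in> B.seg (B.orb a) (B.orb b)" "\<And>i. i \<le> n \<Longrightarrow> d2 (f i) (f (Suc i)) \<le> 1"
      using B.seg_chain[OF M, of 1] by (metis zero_less_one)
    have fM: "f i \<in> M2" if "i \<le> Suc n" for i using f(3)[OF that] B.seg_subset by auto
    have "\<exists>k. k \<in> A.F \<and> d2 (f i) (B.orb k) \<le> R \<and> (i = 0 \<longrightarrow> k = a) \<and> (i = Suc n \<longrightarrow> k = b)"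
      if "i \<le> Suc n" for i
      using R[OF fM[OF that]] ab f(1,2) R0 M by (cases "i = 0"; cases "i = Suc n") auto
    then obtain k where k: "\<And>i. i \<le> Suc n \<Longrightarrow> k i \<in> A.F \<and> d2 (f i) (B.orb (k i)) \<le> R \<and>
      (i = 0 \<longrightarrow> k i = a) \<and> (i = Suc n \<longrightarrow> k i = b)" by metis
    have step: "d1 (A.orb (k i)) (A.orb (k (Suc i))) \<le> D" if i: "i \<le> n" for i
    proof -
      have ki: "k i \<in> A.F" "k (Suc i) \<in> A.F" "d2 (f i) (B.orb (k i)) \<le> R" "d2 (f (Suc i)) (B.orb (k
          (Suc i))) \<le> R"
        using k[of i] k[of "Suc i"] i by auto
      have "d2 (B.orb (k i)) (B.orb (k (Suc i))) \<le> d2 (B.orb (k i)) (f i) + (d2 (f i) (f (Suc i)) +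
          d2 (f (Suc i)) (B.orb (k (Suc i))))"
        using B.triangle[of "B.orb (k i)" "f i" "B.orb (k (Suc i))"] B.triangle[of "f i" "f (Suc i)"
            "B.orb (k (Suc i))"]
          ki fM[of i] fM[of "Suc i"] i by auto
      then show ?thesis using D ki f(4)[OF i] B.commute[of "B.orb (k i)" "f i"] by force
    qed
    have kF: "k i \<in> A.F" if "i \<le> Suc n" for i using k[OF that] by blast
    have "A.gp z (A.orb (k 0)) (A.orb (k (Suc n))) \<le> \<kappa>" using k[of 0] k[of "Suc n"] ab by simp
    then obtain i where i: "i \<le> n" "A.gp z (A.orb (k i)) (A.orb (k (Suc i))) \<le> \<kappa>"
      using A.gp_chain[of z n "\<lambda>i. A.orb (k i)" \<kappa>] kF ab(3) by auto
    have "d1 z (A.orb (k i)) \<le> d1 z (A.orb (k (Suc i))) + d1 (A.orb (k i)) (A.orb (k (Suc i)))"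
      using A.triangle[of z "A.orb (k (Suc i))" "A.orb (k i)"] kF[of i] kF[of "Suc i"] i ab by (simp
          add: A.commute)
    then have "d1 z (A.orb (k i)) \<le> \<kappa> + D" using i(2) step[OF i(1)] by (simp add: gromov_product_def)
    moreover have "B.gp (B.orb (k i)) (B.orb a) (B.orb b) \<le> B.gp (f i) (B.orb a) (B.orb b) + d2
        (B.orb (k i)) (f i)"
      using kF[of i] fM[of i] i ab by (intro B.gp_base_change) auto
    moreover have "B.gp (f i) (B.orb a) (B.orb b) = 0" using f(3)[of i] i B.seg_iff by auto
    moreover have "d2 (B.orb (k i)) (f i) \<le> R" using k[of i] i by (simp add: B.commute)
    ultimately show ?thesis using kF[of i] i by (intro bexI[of _ "k i"]) auto
  qed
  then show thesis using that by blast
qed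

lemma gp_control:
  obtains \<kappa>' where "\<And>a b g. \<lbrakk>a \<in> A.F; b \<in> A.F; g \<in> A.F; A.gp (A.orb g) (A.orb a) (A.orb b) \<le> \<kappa>\<rbrakk>
    \<Longrightarrow> B.gp (B.orb g) (B.orb a) (B.orb b) \<le> \<kappa>'"
proof -
  obtain D D' where D: "\<And>a b z \<kappa>. \<lbrakk>a \<in> A.F; b \<in> A.F; z \<in> M1; A.gp z (A.orb a) (A.orb b) \<le> \<kappa>\<rbrakk>
    \<Longrightarrow> \<exists>h\<in>A.F. d1 z (A.orb h) \<le> \<kappa> + D \<and> B.gp (B.orb h) (B.orb a) (B.orb b) \<le> D'"
    using segment_near by blast
  obtain \<sigma> where \<sigma>: "\<forall>g\<in>A.F. \<forall>h\<in>A.F. d1 (A.orb g) (A.orb h) \<le> \<kappa> + D \<longrightarrow> d2 (B.orb g) (B.orb h) \<le> \<sigma>"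
    using orb_control by blast
  show thesis
  proof (rule that[of "D' + \<sigma>"])
    fix a b g assume abg: "a \<in> A.F" "b \<in> A.F" "g \<in> A.F" "A.gp (A.orb g) (A.orb a) (A.orb b) \<le> \<kappa>"
    then obtain h where h: "h \<in> A.F" "d1 (A.orb g) (A.orb h) \<le> \<kappa> + D" "B.gp (B.orb h) (B.orb a)
        (B.orb b) \<le> D'"
      using D[of a b "A.orb g" \<kappa>] by auto
    have "B.gp (B.orb g) (B.orb a) (B.orb b) \<le> B.gp (B.orb h) (B.orb a) (B.orb b) + d2 (B.orb g)
        (B.orb h)"
      using abg h by (intro B.gp_base_change) auto
    then show "B.gp (B.orb g) (B.orb a) (B.orb b) \<le> D' + \<sigma>" using h \<sigma> abg by force
  qed
qed

lemma asymptotic_transfer: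
  assumes st: "range s \<subseteq> A.F" "range t \<subseteq> A.F"
    and lim: "gromov_asymptotic M1 d1 (\<lambda>n. A.orb (s n)) (\<lambda>n. A.orb (t n))"
  shows "gromov_asymptotic M2 d2 (\<lambda>n. B.orb (s n)) (\<lambda>n. B.orb (t n))"
proof -
  have F: "s n \<in> A.F" "t n \<in> A.F" for n using st by auto
  have one: "[] \<in> A.F" using A.FG.one_closed by (simp add: free_group_def)
  interpret S: cv_trees r M2 d2 \<phi>2 M1 d1 \<phi>1 ..
  show ?thesis
  proof (rule B.asymptoticI[of "B.orb []"])
    fix K
    obtain \<kappa>' where \<kappa>': "\<And>a b g. \<lbrakk>a \<in> A.F; b \<in> A.F; g \<in> A.F; B.gp (B.orb g) (B.orb a) (B.orb b) \<le> K\<rbrakk>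
      \<Longrightarrow> A.gp (A.orb g) (A.orb a) (A.orb b) \<le> \<kappa>'" using S.gp_control[of K] by blast
    obtain N where N: "\<forall>i\<ge>N. \<forall>j\<ge>N. \<kappa>' + 1 \<le> A.gp (A.orb []) (A.orb (s i)) (A.orb (t j))"
      using A.asymptoticD[OF lim A.orb_closed[OF one]] by blast
    have "K \<le> B.gp (B.orb []) (B.orb (s i)) (B.orb (t j))" if "i \<ge> N" "j \<ge> N" for i j
      using \<kappa>'[OF F(1) F(2) one, of i j] N[rule_format, OF that] by linarith
    then show "\<exists>N. \<forall>i\<ge>N. \<forall>j\<ge>N. K \<le> B.gp (B.orb []) (B.orb (s i)) (B.orb (t j))" by blast
  qed (use F one in auto)
qed

lemma geodesic_transfer:
  obtains D where "\<And>L p q c. \<lbrakk>algebraic_lamination r L; (p, q) \<in> L; geodesic_from_to M1 d1 \<phi>1 p q c\<rbrakk> \<Longrightarrow>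
     \<exists>c'. geodesic_from_to M2 d2 \<phi>2 p q c' \<and>
       (\<forall>g\<in>A.F. \<forall>\<tau>. d1 (c \<tau>) (A.orb g) \<le> R \<longrightarrow> (\<exists>\<sigma>. d2 (B.orb g) (c' \<sigma>) \<le> D)) \<and>
       (\<forall>g\<in>A.F. \<forall>h\<in>A.F. \<forall>\<tau> \<tau>' \<sigma> \<sigma>'. \<tau> \<le> \<tau>' \<longrightarrow> d1 (c \<tau>) (A.orb g) \<le> R \<longrightarrow> d1 (c \<tau>') (A.orb h) \<le> R \<longrightarrow>
         d2 (B.orb g) (c' \<sigma>) \<le> D \<longrightarrow> d2 (B.orb h) (c' \<sigma>') \<le> D \<longrightarrow> \<sigma> - \<sigma>' \<le> 3 * D)"
proof -
  obtain \<kappa> where \<kappa>: "\<And>a b g. \<lbrakk>a \<in> A.F; b \<in> A.F; g \<in> A.F; A.gp (A.orb g) (A.orb a) (A.orb b) \<le> 2 *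
      max R 0\<rbrakk>
    \<Longrightarrow> B.gp (B.orb g) (B.orb a) (B.orb b) \<le> \<kappa>" using gp_control by blast
  show thesis
  proof (rule that[of \<kappa>])
    fix L p q c assume L: "algebraic_lamination r L" "(p, q) \<in> L" "geodesic_from_to M1 d1 \<phi>1 p q c"
    then obtain s t where c: "A.geodesic_line c" "s \<in> p" "t \<in> q"
      "gromov_asymptotic M1 d1 (\<lambda>n. A.orb (s n)) (\<lambda>n. c (- real n))"
      "gromov_asymptotic M1 d1 (\<lambda>n. A.orb (t n)) (\<lambda>n. c (real n))"
      using A.geodesic_from_to_iff[OF L(1,2)] by blast
    have ran: "range s \<subseteq> A.F" "range t \<subseteq> A.F" using lamination_sequences[OF L(1,2)] c by auto
    then have F: "s n \<in> A.F" "t n \<in> A.F" for n by auto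
    then have orbs: "range (\<lambda>n. A.orb (s n)) \<subseteq> M1" "range (\<lambda>n. A.orb (t n)) \<subseteq> M1"
       "range (\<lambda>n. B.orb (s n)) \<subseteq> M2" "range (\<lambda>n. B.orb (t n)) \<subseteq> M2" by auto
    have cr: "range (\<lambda>n. c (- real n)) \<subseteq> M1" "range (\<lambda>n. c (real n)) \<subseteq> M1" and cM: "c \<tau> \<in> M1" for \<tau>
      using c(1) A.geodesic_line_in by auto
    have "gromov_asymptotic M1 d1 (\<lambda>n. A.orb (s n)) (\<lambda>n. A.orb (s n))"
      "gromov_asymptotic M1 d1 (\<lambda>n. A.orb (t n)) (\<lambda>n. A.orb (t n))"
      using c(4,5) orbs cr by (meson A.asymptotic_sym A.asymptotic_trans)+
    then have conv: "gromov_asymptotic M2 d2 (\<lambda>n. B.orb (s n)) (\<lambda>n. B.orb (s n))"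
      "gromov_asymptotic M2 d2 (\<lambda>n. B.orb (t n)) (\<lambda>n. B.orb (t n))"
      using asymptotic_transfer ran by auto
    have bd: "\<exists>N. \<forall>i\<ge>N. \<forall>j\<ge>N. A.gp y (A.orb (s i)) (A.orb (t j)) \<le> d1 (c \<tau>) y" if "y \<in> M1" for y \<tau>
    proof -
      obtain N where N: "\<forall>i\<ge>N. \<forall>j\<ge>N. A.gp (c \<tau>) (A.orb (s i)) (A.orb (t j)) = 0"
        using A.geodesic_line_gp_zero[OF c(1) orbs(1,2) c(4,5)] by blast
      have "A.gp y (A.orb (s i)) (A.orb (t j)) \<le> A.gp (c \<tau>) (A.orb (s i)) (A.orb (t j)) + d1 y (c
          \<tau>)" for i j
        using that F cM by (intro A.gp_base_change) auto
      then show ?thesis using N A.commute[of y "c \<tau>"] by (metis add_0)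
    qed
    have bd2: "\<exists>N. \<forall>i\<ge>N. \<forall>j\<ge>N. B.gp (B.orb g) (B.orb (s i)) (B.orb (t j)) \<le> \<kappa>"
      if g: "g \<in> A.F" "d1 (c \<tau>) (A.orb g) \<le> R" for g \<tau>
    proof -
      obtain N where N: "\<forall>i\<ge>N. \<forall>j\<ge>N. A.gp (A.orb g) (A.orb (s i)) (A.orb (t j)) \<le> d1 (c \<tau>) (A.orb g)"
        using bd[OF A.orb_closed[OF g(1)], of \<tau>] by blast
      have "B.gp (B.orb g) (B.orb (s i)) (B.orb (t j)) \<le> \<kappa>" if "i \<ge> N" "j \<ge> N" for i j
        using \<kappa>[OF F(1) F(2) \<open>g \<in> A.F\<close>, of i j] N[rule_format, OF that] \<open>d1 (c \<tau>) (A.orb g) \<le> R\<close> by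
            linarith
      then show ?thesis by blast
    qed
    have "\<exists>\<kappa>0. \<forall>N. \<exists>i\<ge>N. \<exists>j\<ge>N. B.gp (B.orb []) (B.orb (s i)) (B.orb (t j)) \<le> \<kappa>0"
    proof -
      have one: "[] \<in> A.F" using A.FG.one_closed by (simp add: free_group_def)
      then have oM: "A.orb [] \<in> M1" by simp
      obtain \<kappa>1 where \<kappa>1: "\<And>a b g. \<lbrakk>a \<in> A.F; b \<in> A.F; g \<in> A.F; A.gp (A.orb g) (A.orb a) (A.orb b) \<le>
          d1 (c 0) (A.orb [])\<rbrakk>
        \<Longrightarrow> B.gp (B.orb g) (B.orb a) (B.orb b) \<le> \<kappa>1" using gp_control by blast
      obtain N where N: "\<forall>i\<ge>N. \<forall>j\<ge>N. A.gp (A.orb []) (A.orb (s i)) (A.orb (t j)) \<le> d1 (c 0) (A.orb [])"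
        using bd[OF oM] by blast
      have "B.gp (B.orb []) (B.orb (s (max N n))) (B.orb (t (max N n))) \<le> \<kappa>1" for n
        using \<kappa>1[OF F(1) F(2) one] N by simp
      then show ?thesis by (meson max.cobounded2)
    qed
    then obtain \<kappa>0 where \<kappa>0: "\<And>N. \<exists>i\<ge>N. \<exists>j\<ge>N. B.gp (B.orb []) (B.orb (s i)) (B.orb (t j)) \<le> \<kappa>0" by blast
    have "B.orb [] \<in> M2" using A.FG.one_closed by (simp add: free_group_def B.act_closed)
    then obtain c' where c': "B.geodesic_line c'"
      "gromov_asymptotic M2 d2 (\<lambda>n. B.orb (s n)) (\<lambda>n. c' (- real n))"
      "gromov_asymptotic M2 d2 (\<lambda>n. B.orb (t n)) (\<lambda>n. c' (real n))"
      using B.geodesic_line_exists[OF orbs(3,4) conv _ \<kappa>0] by blast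
    have c'M: "c' \<tau> \<in> M2" for \<tau> using c' B.geodesic_line_in by auto
    have "geodesic_from_to M2 d2 \<phi>2 p q c'"
      unfolding B.geodesic_from_to_iff[OF L(1,2)] using c c' by blast
    moreover have "\<exists>\<sigma>. d2 (B.orb g) (c' \<sigma>) \<le> \<kappa>" if g: "g \<in> A.F" "d1 (c \<tau>) (A.orb g) \<le> R" for g \<tau>
      using bd2[OF g] B.geodesic_line_near[OF c'(1) orbs(3,4) c'(2,3) B.orb_closed[OF g(1)]] by blast
    moreover have "\<sigma> - \<sigma>' \<le> 3 * \<kappa>"
      if gh: "g \<in> A.F" "h \<in> A.F" "\<tau> \<le> \<tau>'" "d1 (c \<tau>) (A.orb g) \<le> R" "d1 (c \<tau>') (A.orb h) \<le> R"
         "d2 (B.orb g) (c' \<sigma>) \<le> \<kappa>" "d2 (B.orb h) (c' \<sigma>') \<le> \<kappa>" for g h \<tau> \<tau>' \<sigma> \<sigma>'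
    proof (cases "\<sigma>' \<le> \<sigma>")
      case True
      obtain N where N: "\<forall>i\<ge>N. \<forall>j\<ge>N. 1 \<le> A.gp (c \<tau>') (A.orb (t i)) (c (real j))"
        using A.asymptoticD[OF c(5) cM] by blast
      obtain N' where N': "\<forall>i\<ge>N'. \<forall>j\<ge>N'. 3 * \<kappa> + 1 \<le> B.gp (c' \<sigma>') (B.orb (t i)) (c' (real j))"
        using B.asymptoticD[OF c'(3) c'M] by blast
      obtain m where m: "max (real N) (max (real N') (max \<tau>' \<sigma>)) \<le> real m" using real_arch_simple by
          blast
      have "min (A.gp (c \<tau>') (c \<tau>) (A.orb (t m))) (A.gp (c \<tau>') (A.orb (t m)) (c (real m))) \<le> A.gp (c
          \<tau>') (c \<tau>) (c (real m))"
        using cM F by (intro A.hyperbolic) auto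
      moreover have "A.gp (c \<tau>') (c \<tau>) (c (real m)) = 0"
        using gh(3) m by (simp add: gromov_product_def A.geodesic_line_dist[OF c(1)])
      moreover have "1 \<le> A.gp (c \<tau>') (A.orb (t m)) (c (real m))" using N m by auto
      ultimately have "A.gp (c \<tau>') (c \<tau>) (A.orb (t m)) \<le> 0" by (auto simp: min_def split: if_splits)
      moreover have "A.gp (A.orb h) (A.orb g) (A.orb (t m)) \<le> A.gp (c \<tau>') (A.orb g) (A.orb (t m)) +
          d1 (A.orb h) (c \<tau>')"
        using gh F cM by (intro A.gp_base_change) auto
      moreover have "A.gp (c \<tau>') (A.orb g) (A.orb (t m)) \<le> A.gp (c \<tau>') (c \<tau>) (A.orb (t m)) + d1
          (A.orb g) (c \<tau>)"
        using gh F cM by (intro A.gp_point_change) auto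
      ultimately have "A.gp (A.orb h) (A.orb g) (A.orb (t m)) \<le> 2 * max R 0"
        using gh(4,5) A.commute[of "A.orb h"] A.commute[of "A.orb g"] by auto
      then have "B.gp (B.orb h) (B.orb g) (B.orb (t m)) \<le> \<kappa>" using \<kappa> gh F by blast
      moreover have "B.gp (c' \<sigma>') (B.orb g) (B.orb (t m)) \<le> B.gp (B.orb h) (B.orb g) (B.orb (t m)) +
          d2 (c' \<sigma>') (B.orb h)"
        using gh F c'M by (intro B.gp_base_change) auto
      moreover have "B.gp (c' \<sigma>') (c' \<sigma>) (B.orb (t m)) \<le> B.gp (c' \<sigma>') (B.orb g) (B.orb (t m)) + d2
          (c' \<sigma>) (B.orb g)"
        using gh F c'M by (intro B.gp_point_change) auto
      ultimately have "B.gp (c' \<sigma>') (c' \<sigma>) (B.orb (t m)) \<le> 3 * \<kappa>"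
        using gh(6,7) B.commute[of "B.orb h"] B.commute[of "B.orb g"] by auto
      moreover have "min (B.gp (c' \<sigma>') (c' \<sigma>) (c' (real m))) (B.gp (c' \<sigma>') (c' (real m)) (B.orb (t
          m))) \<le> B.gp (c' \<sigma>') (c' \<sigma>) (B.orb (t m))"
        using c'M F by (intro B.hyperbolic) auto
      moreover have "3 * \<kappa> + 1 \<le> B.gp (c' \<sigma>') (c' (real m)) (B.orb (t m))"
        using N' m by (auto simp: B.gp_commute[of _ "c' (real m)"])
      moreover have "B.gp (c' \<sigma>') (c' \<sigma>) (c' (real m)) = \<sigma> - \<sigma>'"
        using True m by (simp add: gromov_product_def B.geodesic_line_dist[OF c'(1)])
      ultimately show ?thesis by (auto simp: min_def split: if_splits)
    next
      case False
      have "0 \<le> \<kappa>" using gh(6) B.nonneg order_trans by blast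
      with False show ?thesis by simp
    qed
    ultimately show "\<exists>c'. geodesic_from_to M2 d2 \<phi>2 p q c' \<and>
       (\<forall>g\<in>A.F. \<forall>\<tau>. d1 (c \<tau>) (A.orb g) \<le> R \<longrightarrow> (\<exists>\<sigma>. d2 (B.orb g) (c' \<sigma>) \<le> \<kappa>)) \<and>
       (\<forall>g\<in>A.F. \<forall>h\<in>A.F. \<forall>\<tau> \<tau>' \<sigma> \<sigma>'. \<tau> \<le> \<tau>' \<longrightarrow> d1 (c \<tau>) (A.orb g) \<le> R \<longrightarrow> d1 (c \<tau>') (A.orb h) \<le> R \<longrightarrow>
         d2 (B.orb g) (c' \<sigma>) \<le> \<kappa> \<longrightarrow> d2 (B.orb h) (c' \<sigma>') \<le> \<kappa> \<longrightarrow> \<sigma> - \<sigma>' \<le> 3 * \<kappa>)"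
      by (intro exI[of _ c']) blast
  qed
qed

end

section \<open>Edge paths and the laminary language\<close>

lemma edge_path_tree_graph_arcs: "edge_path (tree_graph M d) \<delta> \<Longrightarrow> set \<delta> \<subseteq> arcs (tree_graph M d)"
  by (auto simp: edge_path_def pre_digraph.awalk_def)

context cv_tree
begin

abbreviation V :: "'a set" where "V \<equiv> branch_points M d"
abbreviation TG :: "('a, 'a \<times> 'a) pre_digraph" where "TG \<equiv> tree_graph M d"
abbreviation QG :: "('a set, ('a \<times> 'a) set) pre_digraph" where "QG \<equiv> quotient_graph r M d \<phi>"

lemma arc_iff: "(u, v) \<in> arcs TG \<longleftrightarrow> u \<in> V \<and> v \<in> V \<and> u \<noteq> v \<and> seg u v \<inter> V = {u, v}"
  by (simp add: tree_graph_def)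

primrec edge_chain :: "'a \<Rightarrow> ('a \<times> 'a) list \<Rightarrow> 'a \<Rightarrow> bool" where
  "edge_chain u [] v \<longleftrightarrow> u = v"
| "edge_chain u (e # \<delta>) v \<longleftrightarrow> fst e = u \<and> e \<in> arcs TG \<and> snd e \<in> seg u v \<and> edge_chain (snd e) \<delta> v"

lemma edge_chain_exists: "\<lbrakk>u \<in> V; v \<in> V\<rbrakk> \<Longrightarrow> \<exists>\<delta>. edge_chain u \<delta> v"
proof (induction "card (V \<inter> seg u v)" arbitrary: u rule: less_induct)
  case less
  have M: "u \<in> M" "v \<in> M" using less.prems branch_subset by auto
  show ?case
  proof (cases "u = v")
    case True
    then show ?thesis by (intro exI[of _ "[]"]) simp
  next
    case False
    let ?W = "V \<inter> seg u v - {u}"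
    have fin: "finite (V \<inter> seg u v)"
    proof (rule finite_subset)
      show "V \<inter> seg u v \<subseteq> {z \<in> V. d u z \<le> d u v}"
      proof clarify
        fix z assume "z \<in> seg u v"
        then show "d u z \<le> d u v" using seg_dist[of z u v] nonneg[of z v] by linarith
      qed
    qed (rule finite_branch_ball[OF M(1)])
    moreover have vW: "v \<in> ?W" using less.prems False M ends_in_seg by auto
    ultimately have dW: "finite (d u ` ?W)" "d u ` ?W \<noteq> {}" by auto
    from Min_in[OF dW] obtain w where w: "w \<in> ?W" "d u w = Min (d u ` ?W)" by force
    have wM: "w \<in> M" using w branch_subset by auto
    have pos: "0 < d u w" using w M wM by (metis DiffD2 nonneg order_le_less singletonI zero)
    have "seg u w \<inter> V \<subseteq> {u, w}"
    proof
      fix x assume "x \<in> seg u w \<inter> V"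
      then have x: "x \<in> seg u w" "x \<in> V" by auto
      show "x \<in> {u, w}"
      proof (rule ccontr)
        assume ne: "x \<notin> {u, w}"
        then have "x \<in> ?W" using x w seg_sub[OF M, of w] by auto
        then have "d u w \<le> d u x" using w(2) dW(1) by simp
        then have "d x w \<le> 0" using seg_dist[OF x(1)] by simp
        then show False using ne x wM branch_subset by (metis insertCI nonneg order_antisym subsetD
            zero)
      qed
    qed
    then have arc: "(u, w) \<in> arcs TG" using less.prems w M wM ends_in_seg unfolding arc_iff by auto
    have sub: "seg w v \<subseteq> seg u v" using seg_sub[of v u w] w M by (auto simp: seg_commute)
    have "u \<notin> seg w v"
    proof
      assume "u \<in> seg w v"
      moreover have "d u w + d w v = d u v" using w seg_dist by blast
      ultimately show False using seg_dist[of u w v] pos by (simp add: commute)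
    qed
    moreover have "u \<in> seg u v" using ends_in_seg M by blast
    ultimately have "V \<inter> seg w v \<subset> V \<inter> seg u v" using sub less.prems by blast
    then have "card (V \<inter> seg w v) < card (V \<inter> seg u v)" using fin by (rule psubset_card_mono[rotated])
    then obtain \<delta> where "edge_chain w \<delta> v" using less w by blast
    then have "edge_chain u ((u, w) # \<delta>) v" using arc w by simp
    then show ?thesis by blast
  qed
qed

lemma edge_chain_unique:
  "\<lbrakk>edge_chain u \<delta> v; edge_chain u \<delta>' v; u \<in> M; v \<in> M\<rbrakk> \<Longrightarrow> \<delta> = \<delta>'"
proof (induction \<delta> arbitrary: u \<delta>')
  have Nil: "\<delta>' = []" if "edge_chain u \<delta>' u" "u \<in> M" for u \<delta>'
  proof (cases \<delta>')
    case (Cons e \<delta>)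
    then have e: "(u, snd e) \<in> arcs TG" "snd e \<in> seg u u" using that by (auto simp: prod_eq_iff)
    then have "d u (snd e) = 0" using seg_dist[OF e(2)] by (simp add: commute \<open>u \<in> M\<close>)
    then have "u = snd e" using e that seg_subset by (metis subsetD zero)
    then show ?thesis using e by (simp add: arc_iff)
  qed
  {
    case Nil
    then show ?case using \<open>\<And>u \<delta>'. \<lbrakk>edge_chain u \<delta>' u; u \<in> M\<rbrakk> \<Longrightarrow> \<delta>' = []\<close> by auto
  next
    case (Cons e \<delta>)
    show ?case
    proof (cases \<delta>')
      case Nil
      then have "u = v" using Cons.prems by simp
      then show ?thesis using \<open>\<And>u \<delta>'. \<lbrakk>edge_chain u \<delta>' u; u \<in> M\<rbrakk> \<Longrightarrow> \<delta>' = []\<close> Cons.prems by blast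
    next
      case (Cons e' \<epsilon>)
      let ?w = "snd e" and ?w' = "snd e'"
      have e: "e = (u, ?w)" "?w \<in> seg u v" "edge_chain ?w \<delta> v"
        "e' = (u, ?w')" "?w' \<in> seg u v" "edge_chain ?w' \<epsilon> v"
        and arcs: "(u, ?w) \<in> arcs TG" "(u, ?w') \<in> arcs TG"
        using Cons.prems Cons by (auto simp: prod_eq_iff) (metis prod.collapse)+
      have between: "x = y" if "(u, x) \<in> arcs TG" "(u, y) \<in> arcs TG" "x \<in> seg u v" "y \<in> seg u v" "d
          u x \<le> d u y" for x y
      proof -
        have "d x y = d u y - d u x" using seg_dist_eq[OF Cons.prems(3,4)] that by simp
        then have "x \<in> seg u y" using that seg_subset by (auto simp: tree_segment_def)
        then show ?thesis using that by (auto simp: arc_iff)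
      qed
      have "?w = ?w'" using between[of ?w ?w'] between[of ?w' ?w] e arcs by (metis linear)
      moreover have "?w \<in> M" using e seg_subset by auto
      ultimately have "\<delta> = \<epsilon>" using Cons.IH[of ?w \<epsilon>] e Cons.prems by simp
      then show ?thesis using Cons e \<open>?w = ?w'\<close> by metis
    qed
  }
qed

lemma arc_act:
  assumes "g \<in> F" "(u, v) \<in> arcs TG"
  shows "(\<phi> g u, \<phi> g v) \<in> arcs TG"
proof -
  have uv: "u \<in> V" "v \<in> V" "u \<noteq> v" "seg u v \<inter> V = {u, v}" using assms by (auto simp: arc_iff)
  then have M: "u \<in> M" "v \<in> M" using branch_subset by auto
  have "seg (\<phi> g u) (\<phi> g v) \<inter> V = \<phi> g ` (seg u v \<inter> V)"
    unfolding seg_act[OF assms(1) M] using branch_act_iff[OF assms(1)] seg_subset by blast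
  moreover have "\<phi> g u \<noteq> \<phi> g v" using uv M assms by (metis act_inv)
  ultimately show ?thesis using uv assms branch_act by (simp add: arc_iff)
qed

lemma edge_chain_act:
  "\<lbrakk>edge_chain u \<delta> v; g \<in> F; u \<in> M; v \<in> M\<rbrakk>
    \<Longrightarrow> edge_chain (\<phi> g u) (map (map_prod (\<phi> g) (\<phi> g)) \<delta>) (\<phi> g v)"
proof (induction \<delta> arbitrary: u)
  case (Cons e \<delta>)
  obtain w where e: "e = (u, w)" using Cons.prems by (cases e) auto
  then have w: "(u, w) \<in> arcs TG" "w \<in> seg u v" "edge_chain w \<delta> v" using Cons.prems by auto
  moreover have "w \<in> M" using w seg_subset by auto
  ultimately show ?case using Cons.IH[of w] Cons.prems e by (auto simp: arc_act seg_act)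
qed simp

lemma edge_chain_length:
  "\<lbrakk>edge_chain u \<delta> v; u \<in> M; v \<in> M\<rbrakk> \<Longrightarrow> (\<Sum>e\<leftarrow>\<delta>. d (fst e) (snd e)) = d u v"
proof (induction \<delta> arbitrary: u)
  case (Cons e \<delta>)
  then have "snd e \<in> seg u v" "edge_chain (snd e) \<delta> v" "fst e = u" by auto
  moreover from this have "snd e \<in> M" using seg_subset by blast
  ultimately show ?case using Cons.IH[of "snd e"] Cons.prems seg_dist[of "snd e" u v] by simp
qed simp

lemma edge_chain_arcs: "edge_chain u \<delta> v \<Longrightarrow> set \<delta> \<subseteq> arcs TG"
  by (induction \<delta> arbitrary: u) auto

lemma edge_chain_ends: "\<lbrakk>edge_chain u \<delta> v; \<delta> \<noteq> []\<rbrakk> \<Longrightarrow> u \<in> V \<and> v \<in> V"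
proof (induction \<delta> arbitrary: u)
  case (Cons e \<delta>)
  then have "(u, snd e) \<in> arcs TG" "edge_chain (snd e) \<delta> v" by (auto simp: prod_eq_iff)
  then show ?case using Cons.IH[of "snd e"] by (cases "\<delta> = []") (auto simp: arc_iff)
qed simp

lemma arc_length_bounds:
  obtains \<epsilon> D where "\<epsilon> > 0" "D > 0" "\<And>e. e \<in> arcs TG \<Longrightarrow> \<epsilon> \<le> d (fst e) (snd e) \<and> d (fst e) (snd e) \<le> D"
proof -
  obtain \<epsilon> where \<epsilon>: "\<epsilon> > 0" "\<And>u v. \<lbrakk>u \<in> V; v \<in> V; u \<noteq> v\<rbrakk> \<Longrightarrow> \<epsilon> \<le> d u v"
    using branch_separation by blast
  obtain D where D: "D > 0" "\<And>y z. \<lbrakk>y \<in> M; z \<in> M; D \<le> d y z\<rbrakk> \<Longrightarrow> \<exists>w\<in>V. w \<in> seg y z \<and> d y w \<le> D"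
    using branch_dense by blast
  have "d u v \<le> 3 * D" if arc: "(u, v) \<in> arcs TG" for u v
  proof (rule ccontr)
    assume "\<not> ?thesis"
    then have big: "3 * D < d u v" by simp
    have M: "u \<in> M" "v \<in> M" using arc branch_subset by (auto simp: arc_iff)
    obtain y where y: "y \<in> seg u v" "d u y = D" "d y v = d u v - D"
      using seg_point[OF M, of D] D(1) big by auto
    have yM: "y \<in> M" using y seg_subset by auto
    have "D \<le> d y v" using y(3) big D(1) by linarith
    then obtain w where w: "w \<in> V" "w \<in> seg y v" "d y w \<le> D" using D(2)[OF yM M(2)] by blast
    have "w \<in> seg u v" using seg_sub[of v u y] w(2) y M by (auto simp: seg_commute)
    then have "w = u \<or> w = v" using arc w by (auto simp: arc_iff)
    moreover have "d y w + d w v = d y v" using w seg_dist by blast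
    ultimately show False using w(3) y big D(1) commute[of y u] M by auto
  qed
  then show thesis using \<epsilon> D(1) by (intro that[of \<epsilon> "3 * D"]) (auto simp: tree_graph_def)
qed

lemma edge_chain_length_bounds:
  obtains \<epsilon> D where "\<epsilon> > 0" "D > 0"
    "\<And>u \<delta> v. \<lbrakk>edge_chain u \<delta> v; u \<in> M; v \<in> M\<rbrakk> \<Longrightarrow> \<epsilon> * real (length \<delta>) \<le> d u v \<and> d u v \<le> D * real
        (length \<delta>)"
proof -
  obtain \<epsilon> D where D: "\<epsilon> > 0" "D > 0" "\<And>e. e \<in> arcs TG \<Longrightarrow> \<epsilon> \<le> d (fst e) (snd e) \<and> d (fst e) (snd e) \<le> D"
    using arc_length_bounds by blast
  have "set \<delta> \<subseteq> arcs TG \<Longrightarrow> \<epsilon> * real (length \<delta>) \<le> (\<Sum>e\<leftarrow>\<delta>. d (fst e) (snd e)) \<and>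
      (\<Sum>e\<leftarrow>\<delta>. d (fst e) (snd e)) \<le> D * real (length \<delta>)" for \<delta>
  proof (induction \<delta>)
    case (Cons e \<delta>)
    then show ?case using D(3)[of e] by (simp add: algebra_simps)
  qed simp
  then show thesis using D edge_chain_length edge_chain_arcs by (intro that[of \<epsilon> D]) metis+
qed

lemma geodesic_line_edge_chain:
  assumes "geodesic_line c"
  shows "\<lbrakk>set \<delta> \<subseteq> arcs TG; \<forall>i<length \<delta>. \<tau> i < \<tau> (Suc i) \<and> \<delta> ! i = (c (\<tau> i), c (\<tau> (Suc i)))\<rbrakk>
    \<Longrightarrow> edge_chain (c (\<tau> 0)) \<delta> (c (\<tau> (length \<delta>))) \<and> \<tau> 0 \<le> \<tau> (length \<delta>)"
proof (induction \<delta> arbitrary: \<tau>)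
  case (Cons e \<delta>)
  have e: "\<tau> 0 < \<tau> 1" "e = (c (\<tau> 0), c (\<tau> 1))" using Cons.prems(2)[rule_format, of 0] by auto
  have "edge_chain (c (\<tau> 1)) \<delta> (c (\<tau> (Suc (length \<delta>)))) \<and> \<tau> 1 \<le> \<tau> (Suc (length \<delta>))"
    using Cons.IH[of "\<lambda>i. \<tau> (Suc i)"] Cons.prems by fastforce
  moreover from this have "c (\<tau> 1) \<in> seg (c (\<tau> 0)) (c (\<tau> (Suc (length \<delta>))))"
    using e by (intro geodesic_line_between[OF assms]) auto
  ultimately show ?case using e Cons.prems(1) by simp
qed simp

lemma edge_chain_subpath:
  assumes "geodesic_line c"
  shows "\<lbrakk>edge_chain (c s) \<delta> (c t); s \<le> t\<rbrakk> \<Longrightarrow>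
    \<exists>\<tau>. \<tau> 0 = s \<and> (\<forall>i<length \<delta>. \<tau> i < \<tau> (Suc i) \<and> \<delta> ! i = (c (\<tau> i), c (\<tau> (Suc i))))"
proof (induction \<delta> arbitrary: s)
  case (Cons e \<delta>)
  obtain w where e: "e = (c s, w)" using Cons.prems by (cases e) auto
  then have w: "(c s, w) \<in> arcs TG" "w \<in> seg (c s) (c t)" "edge_chain w \<delta> (c t)" using Cons.prems by
      auto
  define s' where "s' = s + d (c s) w"
  have s': "w = c s'" "s' \<le> t" using geodesic_line_seg[OF assms Cons.prems(2) w(2)] by (auto simp:
      s'_def)
  have "s < s'"
  proof -
    have "c s \<noteq> w" using w by (auto simp: arc_iff)
    then show ?thesis using w(2) seg_subset geodesic_line_in[OF assms, of s] unfolding s'_def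
      by (metis add_0_right add_strict_left_mono nonneg order_le_less subsetD zero)
  qed
  obtain \<tau> where \<tau>: "\<tau> 0 = s'" "\<forall>i<length \<delta>. \<tau> i < \<tau> (Suc i) \<and> \<delta> ! i = (c (\<tau> i), c (\<tau> (Suc i)))"
    using Cons.IH[of s'] w s' by auto
  show ?case
    using \<tau> \<open>s < s'\<close> e s'(1)
    by (intro exI[of _ "case_nat s \<tau>"]) (auto simp: less_Suc_eq_0_disj)
qed auto

lemma edge_chain_awalk: "\<lbrakk>edge_chain u \<delta> v; u \<in> V\<rbrakk> \<Longrightarrow> pre_digraph.awalk TG u \<delta> v"
proof (induction \<delta> arbitrary: u)
  case Nil
  then show ?case by (simp add: pre_digraph.awalk_def pre_digraph.cas.simps tree_graph_def)
next
  case (Cons e \<delta>)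
  obtain w where e: "e = (u, w)" using Cons.prems by (cases e) auto
  then have w: "(u, w) \<in> arcs TG" "edge_chain w \<delta> v" using Cons.prems by auto
  then have "pre_digraph.awalk TG w \<delta> v" using Cons.IH by (simp add: arc_iff)
  then show ?case using w e
    by (auto simp: pre_digraph.awalk_def pre_digraph.cas.simps tree_graph_def)
qed

lemma fst_edge_orbit: "fst ` edge_orbit r \<phi> (u, v) = orbit (free_group r) \<phi> u"
  and snd_edge_orbit: "snd ` edge_orbit r \<phi> (u, v) = orbit (free_group r) \<phi> v"
  by (force simp: edge_orbit_def orbit_def)+

lemma edge_chain_quotient_awalk:
  "\<lbrakk>edge_chain u \<delta> v; u \<in> V\<rbrakk> \<Longrightarrow> pre_digraph.awalk QG (orbit (free_group r) \<phi> u)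
     (map (edge_orbit r \<phi>) \<delta>) (orbit (free_group r) \<phi> v)"
proof (induction \<delta> arbitrary: u)
  case Nil
  then show ?case by (simp add: pre_digraph.awalk_def pre_digraph.cas.simps tree_graph_def
      quotient_graph_def)
next
  case (Cons e \<delta>)
  obtain w where e: "e = (u, w)" using Cons.prems by (cases e) auto
  then have w: "(u, w) \<in> arcs TG" "edge_chain w \<delta> v" using Cons.prems by auto
  then have "pre_digraph.awalk QG (orbit (free_group r) \<phi> w) (map (edge_orbit r \<phi>) \<delta>) (orbit
      (free_group r) \<phi> v)"
    using Cons.IH by (simp add: arc_iff)
  then show ?case using w e Cons.prems
    by (auto simp: pre_digraph.awalk_def pre_digraph.cas.simps quotient_graph_def fst_edge_orbit
        snd_edge_orbit)
      (simp add: tree_graph_def)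
qed

lemma edge_orbit_self: "u \<in> M \<Longrightarrow> v \<in> M \<Longrightarrow> (u, v) \<in> edge_orbit r \<phi> (u, v)"
  unfolding edge_orbit_def orbit_def using act_one by (force intro: exI[of _ one_F])

lemma edge_orbit_act:
  assumes "g \<in> F" "u \<in> M" "v \<in> M"
  shows "edge_orbit r \<phi> (\<phi> g u, \<phi> g v) = edge_orbit r \<phi> (u, v)"
proof (intro equalityI subsetI)
  fix e assume "e \<in> edge_orbit r \<phi> (\<phi> g u, \<phi> g v)"
  then obtain h where "h \<in> F" "e = (\<phi> h (\<phi> g u), \<phi> h (\<phi> g v))" by (auto simp: edge_orbit_def orbit_def)
  then have "e = map_prod (\<phi> (h \<odot> g)) (\<phi> (h \<odot> g)) (u, v)" "h \<odot> g \<in> F" using assms by (auto simp: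
      act_mult)
  then show "e \<in> edge_orbit r \<phi> (u, v)" unfolding edge_orbit_def orbit_def by blast
next
  fix e assume "e \<in> edge_orbit r \<phi> (u, v)"
  then obtain h where h: "h \<in> F" "e = (\<phi> h u, \<phi> h v)" by (auto simp: edge_orbit_def orbit_def)
  let ?k = "h \<odot> inv_F g"
  have "e = map_prod (\<phi> ?k) (\<phi> ?k) (\<phi> g u, \<phi> g v)" "?k \<in> F"
    using h assms by (auto simp: act_mult act_closed act_inv)
  then show "e \<in> edge_orbit r \<phi> (\<phi> g u, \<phi> g v)" unfolding edge_orbit_def orbit_def by blast
qed

lemma edge_orbit_act_list:
  assumes "g \<in> F" "set \<delta> \<subseteq> arcs TG"
  shows "map (edge_orbit r \<phi>) (map (map_prod (\<phi> g) (\<phi> g)) \<delta>) = map (edge_orbit r \<phi>) \<delta>"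
proof -
  have "fst e \<in> M \<and> snd e \<in> M" if "e \<in> set \<delta>" for e
  proof -
    have "e \<in> arcs TG" using that assms(2) by blast
    then show ?thesis using branch_subset by (cases e) (auto simp: arc_iff)
  qed
  then show ?thesis using assms(1) by (auto simp: edge_orbit_act)
qed

lemma edge_chain_orbits_eq:
  "\<lbrakk>edge_chain u \<delta> v; edge_chain (\<phi> g u) \<delta>' v'; g \<in> F; u \<in> M;
    map (edge_orbit r \<phi>) \<delta> = map (edge_orbit r \<phi>) \<delta>'\<rbrakk> \<Longrightarrow> v' = \<phi> g v"
proof (induction \<delta> arbitrary: u \<delta>')
  case (Cons e \<delta>)
  obtain w where e: "e = (u, w)" using Cons.prems by (cases e) auto
  obtain e' \<epsilon> where \<delta>': "\<delta>' = e' # \<epsilon>" using Cons.prems by (cases \<delta>') auto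
  obtain w' where e': "e' = (\<phi> g u, w')" using Cons.prems \<delta>' by (cases e') auto
  have arcs: "(u, w) \<in> arcs TG" "(\<phi> g u, w') \<in> arcs TG" using Cons.prems e e' \<delta>' by auto
  then have M: "w \<in> M" "w' \<in> M" using branch_subset by (auto simp: arc_iff)
  have "(\<phi> g u, w') \<in> edge_orbit r \<phi> (\<phi> g u, w')" using M Cons.prems by (intro edge_orbit_self
      act_closed)
  also have "\<dots> = edge_orbit r \<phi> (u, w)" using Cons.prems e e' \<delta>' by simp
  finally obtain h where h: "h \<in> F" "\<phi> g u = \<phi> h u" "w' = \<phi> h w" by (auto simp: edge_orbit_def
      orbit_def)
  have "h = g" using act_free_eq[OF h(1) Cons.prems(3,4)] h(2) by simp
  then have w': "w' = \<phi> g w" using h(3) by simp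
  show ?case
  proof (rule Cons.IH)
    show "edge_chain w \<delta> v" using Cons.prems(1) e by simp
    show "edge_chain (\<phi> g w) \<epsilon> v'" using Cons.prems(2) unfolding \<delta>' e' w' by simp
    show "map (edge_orbit r \<phi>) \<delta> = map (edge_orbit r \<phi>) \<epsilon>" using Cons.prems(5) \<delta>' by simp
  qed (use Cons.prems M in auto)
qed auto

lemma edge_chain_same_orbits:
  assumes "edge_chain u \<delta> v" "edge_chain u' \<delta>' v'" "\<delta> \<noteq> []"
    "map (edge_orbit r \<phi>) \<delta> = map (edge_orbit r \<phi>) \<delta>'"
  shows "\<exists>g\<in>F. u' = \<phi> g u \<and> v' = \<phi> g v"
proof -
  obtain e \<epsilon> where \<delta>: "\<delta> = e # \<epsilon>" using assms by (cases \<delta>) auto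
  then obtain e' \<epsilon>' where \<delta>': "\<delta>' = e' # \<epsilon>'" using assms by (cases \<delta>') auto
  obtain w where e: "e = (u, w)" using assms \<delta> by (cases e) auto
  obtain w' where e': "e' = (u', w')" using assms \<delta>' by (cases e') auto
  have arcs: "(u, w) \<in> arcs TG" "(u', w') \<in> arcs TG" using assms \<delta> \<delta>' e e' by auto
  then have M: "u \<in> M" "w \<in> M" "u' \<in> M" "w' \<in> M" using branch_subset by (auto simp: arc_iff)
  have "(u', w') \<in> edge_orbit r \<phi> (u, w)" using assms(4) \<delta> \<delta>' e e' edge_orbit_self[OF M(3,4)] by simp
  then obtain g where g: "g \<in> F" "u' = \<phi> g u" by (auto simp: edge_orbit_def orbit_def)
  then show ?thesis using edge_chain_orbits_eq[OF assms(1) _ g(1) M(1) assms(4)] assms(2) by blast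
qed

lemma edge_length_orbit:
  assumes "e \<in> arcs TG"
  shows "edge_length d (edge_orbit r \<phi> e) = d (fst e) (snd e)"
proof -
  obtain u v where e: "e = (u, v)" by (cases e)
  then have M: "u \<in> M" "v \<in> M" using assms branch_subset by (auto simp: arc_iff)
  have "(\<lambda>(u, v). d u v) ` edge_orbit r \<phi> e = {d u v}"
  proof
    show "(\<lambda>(u, v). d u v) ` edge_orbit r \<phi> e \<subseteq> {d u v}"
      using e M by (auto simp: edge_orbit_def orbit_def act_isometry)
    show "{d u v} \<subseteq> (\<lambda>(u, v). d u v) ` edge_orbit r \<phi> e"
      using edge_orbit_self[OF M] e by force
  qed
  then show ?thesis using e by (simp add: edge_length_def)
qed

lemma path_length_orbits:
  assumes "edge_chain u \<delta> v" "u \<in> M" "v \<in> M"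
  shows "path_length d (map (edge_orbit r \<phi>) \<delta>) = d u v"
proof -
  have "map (\<lambda>e. edge_length d (edge_orbit r \<phi> e)) \<delta> = map (\<lambda>e. d (fst e) (snd e)) \<delta>"
    using edge_chain_arcs[OF assms(1)] edge_length_orbit by auto
  then have "path_length d (map (edge_orbit r \<phi>) \<delta>) = (\<Sum>e\<leftarrow>\<delta>. d (fst e) (snd e))"
    unfolding path_length_def map_map comp_def by (simp only:)
  then show ?thesis using edge_chain_length[OF assms] by simp
qed

abbreviation language where "language L \<equiv> laminary_language r M d \<phi> L"

lemma languageE:
  assumes "algebraic_lamination r L" "\<gamma> \<in> language L"
  obtains p q c s t \<delta> where "(p, q) \<in> L" "geodesic_from_to M d \<phi> p q c" "s \<le> t"
    "edge_chain (c s) \<delta> (c t)" "\<delta> \<noteq> []" "\<gamma> = map (edge_orbit r \<phi>) \<delta>"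
proof -
  obtain \<delta> p q c where 1: "length \<gamma> > 0" "edge_path TG \<delta>" "map (edge_orbit r \<phi>) \<delta> = \<gamma>" "(p, q) \<in> L"
    "geodesic_from_to M d \<phi> p q c" "subpath_of_geodesic c \<delta>"
    using assms(2) unfolding laminary_language_def by blast
  then have "geodesic_line c" by (auto simp: geodesic_from_to_def geodesic_line_def)
  moreover obtain \<tau> where "\<forall>i<length \<delta>. \<tau> i < \<tau> (Suc i) \<and> \<delta> ! i = (c (\<tau> i), c (\<tau> (Suc i)))"
    using 1(6) unfolding subpath_of_geodesic_def by blast
  ultimately have "edge_chain (c (\<tau> 0)) \<delta> (c (\<tau> (length \<delta>))) \<and> \<tau> 0 \<le> \<tau> (length \<delta>)"
    using edge_path_tree_graph_arcs[OF 1(2)] geodesic_line_edge_chain by blast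
  with 1 show thesis by (intro that[of p q c "\<tau> 0" "\<tau> (length \<delta>)" \<delta>]) auto
qed

lemma languageI:
  assumes "(p, q) \<in> L" "geodesic_from_to M d \<phi> p q c" "s \<le> t" "edge_chain (c s) \<delta> (c t)" "\<delta> \<noteq> []" "c
      s \<in> V"
  shows "map (edge_orbit r \<phi>) \<delta> \<in> language L"
proof -
  have line: "geodesic_line c" using assms by (auto simp: geodesic_from_to_def geodesic_line_def)
  have "edge_path TG \<delta>" using edge_chain_awalk[OF assms(4,6)] unfolding edge_path_def by blast
  moreover have "edge_path QG (map (edge_orbit r \<phi>) \<delta>)"
    using edge_chain_quotient_awalk[OF assms(4,6)] unfolding edge_path_def by blast
  moreover have "subpath_of_geodesic c \<delta>"
    using edge_chain_subpath[OF line assms(4,3)] unfolding subpath_of_geodesic_def by blast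
  ultimately show ?thesis using assms unfolding laminary_language_def by blast
qed

lemma finite_quotient_arcs: "finite (arcs QG)"
proof -
  obtain R where R: "\<And>y. y \<in> M \<Longrightarrow> \<exists>g\<in>F. d y (orb g) \<le> R" using cocompact by blast
  obtain \<epsilon> D where D: "D > 0" "\<And>e. e \<in> arcs TG \<Longrightarrow> \<epsilon> \<le> d (fst e) (snd e) \<and> d (fst e) (snd e) \<le> D"
    using arc_length_bounds by blast
  define B where "B = {z \<in> V. d \<xi> z \<le> R + D}"
  have finB: "finite B" unfolding B_def by (rule finite_branch_ball) simp
  have "arcs QG \<subseteq> edge_orbit r \<phi> ` (B \<times> B)"
  proof
    fix \<alpha> assume "\<alpha> \<in> arcs QG"
    then obtain u v where uv: "(u, v) \<in> arcs TG" "\<alpha> = edge_orbit r \<phi> (u, v)"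
      by (auto simp: quotient_graph_def)
    then have M: "u \<in> M" "v \<in> M" using branch_subset by (auto simp: arc_iff)
    obtain g where g: "g \<in> F" "d u (orb g) \<le> R" using R M by blast
    let ?u = "\<phi> (inv_F g) u" and ?v = "\<phi> (inv_F g) v"
    have b: "?u \<in> V" "?v \<in> V" using arc_act[OF _ uv(1), of "inv_F g"] g by (auto simp: arc_iff)
    then have uvM: "?u \<in> M" "?v \<in> M" using branch_subset by auto
    have "d \<xi> ?u = d u (orb g)"
      using act_isometry[of "inv_F g" "orb g" u] g M by (simp add: act_inv commute)
    moreover have "d ?u ?v = d u v" using g M by (simp add: act_isometry)
    moreover have "d u v \<le> D" using D(2)[OF uv(1)] by simp
    moreover have "d \<xi> ?v \<le> d \<xi> ?u + d ?u ?v" using triangle uvM by simp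
    ultimately have "?u \<in> B" "?v \<in> B" using b g D(1) by (auto simp: B_def)
    moreover have "\<alpha> = edge_orbit r \<phi> (?u, ?v)" using uv g M by (simp add: edge_orbit_act)
    ultimately show "\<alpha> \<in> edge_orbit r \<phi> ` (B \<times> B)" by blast
  qed
  then show ?thesis using finB by (meson finite_SigmaI finite_imageI finite_subset)
qed

lemma finite_language_length: "finite {\<gamma> \<in> language L. length \<gamma> \<le> n}"
proof (rule finite_subset)
  show "{\<gamma> \<in> language L. length \<gamma> \<le> n} \<subseteq> {\<gamma>. set \<gamma> \<subseteq> arcs QG \<and> length \<gamma> \<le> n}"
    by (auto simp: laminary_language_def edge_path_def pre_digraph.awalk_def)
qed (rule finite_lists_length_le[OF finite_quotient_arcs])

lemma path_length_bounds:
  obtains \<epsilon> D where "\<epsilon> > 0" "D > 0" "\<And>L \<gamma>. \<lbrakk>algebraic_lamination r L; \<gamma> \<in> language L\<rbrakk> \<Longrightarrow>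
     \<epsilon> * real (length \<gamma>) \<le> path_length d \<gamma> \<and> path_length d \<gamma> \<le> D * real (length \<gamma>)"
proof -
  obtain \<epsilon> D where D: "\<epsilon> > 0" "D > 0"
    "\<And>u \<delta> v. \<lbrakk>edge_chain u \<delta> v; u \<in> M; v \<in> M\<rbrakk> \<Longrightarrow> \<epsilon> * real (length \<delta>) \<le> d u v \<and> d u v \<le> D * real
        (length \<delta>)"
    using edge_chain_length_bounds by blast
  show thesis
  proof (rule that[OF D(1,2)])
    fix L \<gamma> assume "algebraic_lamination r L" "\<gamma> \<in> language L"
    then obtain p q c s t \<delta> where "geodesic_from_to M d \<phi> p q c"
      and \<delta>: "edge_chain (c s) \<delta> (c t)" "\<gamma> = map (edge_orbit r \<phi>) \<delta>" by (rule languageE)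
    then have "c s \<in> M" "c t \<in> M" by (auto simp: geodesic_from_to_def)
    then show "\<epsilon> * real (length \<gamma>) \<le> path_length d \<gamma> \<and> path_length d \<gamma> \<le> D * real (length \<gamma>)"
      using D(3)[OF \<delta>(1)] path_length_orbits[OF \<delta>(1)] \<delta>(2) by simp
  qed
qed

end

section \<open>Counting\<close>

lemma card_le_fibers:
  assumes "finite T" "\<And>s. s \<in> S \<Longrightarrow> f s \<in> T" "\<And>t. card {s \<in> S. f s = t} \<le> K"
  shows "card S \<le> K * card T"
proof -
  have "S = (\<Union>t\<in>T. {s \<in> S. f s = t})" using assms(2) by auto
  then have "card S \<le> (\<Sum>t\<in>T. card {s \<in> S. f s = t})" using card_UN_le[OF assms(1)] by metis
  also have "\<dots> \<le> (\<Sum>t\<in>T. K)" using assms(3) by (intro sum_mono)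
  finally show ?thesis by (simp add: mult.commute)
qed

context cv_tree
begin

text \<open>An edge chain is determined by its ends, hence so is its projection to the quotient.\<close>

definition path_between :: "'a \<times> 'a \<Rightarrow> ('a \<times> 'a) set list" where
  "path_between = (\<lambda>(u, v). map (edge_orbit r \<phi>) (SOME \<delta>. edge_chain u \<delta> v))"

lemma path_between:
  assumes "edge_chain u \<delta> v" "u \<in> M" "v \<in> M"
  shows "path_between (u, v) = map (edge_orbit r \<phi>) \<delta>"
proof -
  have "edge_chain u (SOME \<delta>. edge_chain u \<delta> v) v" using assms(1) by (rule someI)
  then show ?thesis using edge_chain_unique[OF _ assms] by (simp add: path_between_def)
qed

lemma branch_ball_card:
  obtains K where "\<And>g. g \<in> F \<Longrightarrow> finite {z \<in> V. d z (orb g) \<le> \<rho>} \<and> card {z \<in> V. d z (orb g) \<le> \<rho>} \<le> K"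
proof -
  let ?B = "{z \<in> V. d \<xi> z \<le> \<rho>}"
  have fin: "finite ?B" by (rule finite_branch_ball) simp
  have sub: "{z \<in> V. d z (orb g) \<le> \<rho>} \<subseteq> \<phi> g ` ?B" if g: "g \<in> F" for g
  proof clarify
    fix z assume z: "z \<in> V" "d z (orb g) \<le> \<rho>"
    then have zM: "z \<in> M" using branch_subset by auto
    have "d \<xi> (\<phi> (inv_F g) z) = d (orb g) z"
      using act_isometry[of "inv_F g" "orb g" z] g zM by (simp add: act_inv)
    then have "\<phi> (inv_F g) z \<in> ?B" using z g branch_act[of "inv_F g" z] by (simp add: commute)
    then show "z \<in> \<phi> g ` ?B" using act_inv'[OF g zM] by force
  qed
  show thesis
  proof (rule that[of "card ?B"])
    fix g assume g: "g \<in> F"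
    have "card {z \<in> V. d z (orb g) \<le> \<rho>} \<le> card (\<phi> g ` ?B)" using sub[OF g] fin by (intro card_mono) auto
    also have "\<dots> \<le> card ?B" by (rule card_image_le[OF fin])
    finally show "finite {z \<in> V. d z (orb g) \<le> \<rho>} \<and> card {z \<in> V. d z (orb g) \<le> \<rho>} \<le> card ?B"
      using sub[OF g] fin finite_subset by blast
  qed
qed

lemma branch_on_line:
  obtains D where "D > 0" "\<And>c \<tau>. geodesic_line c \<Longrightarrow> \<exists>\<sigma>. \<tau> \<le> \<sigma> \<and> \<sigma> \<le> \<tau> + D \<and> c \<sigma> \<in> V"
proof -
  obtain D where D: "D > 0" "\<And>y z. \<lbrakk>y \<in> M; z \<in> M; D \<le> d y z\<rbrakk> \<Longrightarrow> \<exists>w\<in>V. w \<in> seg y z \<and> d y w \<le> D"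
    using branch_dense by blast
  show thesis
  proof (rule that[OF D(1)])
    fix c \<tau> assume c: "geodesic_line c"
    have "c \<tau> \<in> M" "c (\<tau> + D) \<in> M" "D \<le> d (c \<tau>) (c (\<tau> + D))"
      using geodesic_line_in[OF c] geodesic_line_dist[OF c] D(1) by auto
    then obtain w where w: "w \<in> V" "w \<in> seg (c \<tau>) (c (\<tau> + D))" using D(2) by blast
    then show "\<exists>\<sigma>. \<tau> \<le> \<sigma> \<and> \<sigma> \<le> \<tau> + D \<and> c \<sigma> \<in> V"
      using geodesic_line_seg[OF c _ w(2)] D(1) by (intro exI[of _ "\<tau> + d (c \<tau>) w"]) auto
  qed
qed

end

context cv_trees
begin

lemma language_transfer:
  obtains R E C where "\<And>L \<gamma>. \<lbrakk>algebraic_lamination r L; \<gamma> \<in> A.language L\<rbrakk> \<Longrightarrow>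
    \<exists>u v \<delta> u' v' \<delta>' g h. u \<in> M1 \<and> v \<in> M1 \<and> A.edge_chain u \<delta> v \<and> \<delta> \<noteq> [] \<and> \<gamma> = map (edge_orbit r \<phi>1) \<delta> \<and>
      u' \<in> M2 \<and> v' \<in> M2 \<and> B.edge_chain u' \<delta>' v' \<and> \<delta>' \<noteq> [] \<and> map (edge_orbit r \<phi>2) \<delta>' \<in> B.language L \<and>
      g \<in> A.F \<and> h \<in> A.F \<and> d1 u (A.orb g) \<le> R \<and> d1 v (A.orb h) \<le> R \<and>
      d2 u' (B.orb g) \<le> E \<and> d2 v' (B.orb h) \<le> E \<and> real (length \<delta>') \<le> C * real (length \<delta>)"
proof -
  obtain R where R: "\<And>y. y \<in> M1 \<Longrightarrow> \<exists>g\<in>A.F. d1 y (A.orb g) \<le> R" using A.cocompact by blast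
  have R0: "0 \<le> R" using R[OF A.basepoint] A.nonneg by (meson order_trans)
  obtain \<kappa> where \<kappa>: "\<And>L p q c. \<lbrakk>algebraic_lamination r L; (p, q) \<in> L; geodesic_from_to M1 d1 \<phi>1 p q c\<rbrakk> \<Longrightarrow>
     \<exists>c'. geodesic_from_to M2 d2 \<phi>2 p q c' \<and>
       (\<forall>g\<in>A.F. \<forall>\<tau>. d1 (c \<tau>) (A.orb g) \<le> R \<longrightarrow> (\<exists>\<sigma>. d2 (B.orb g) (c' \<sigma>) \<le> \<kappa>)) \<and>
       (\<forall>g\<in>A.F. \<forall>h\<in>A.F. \<forall>\<tau> \<tau>' \<sigma> \<sigma>'. \<tau> \<le> \<tau>' \<longrightarrow> d1 (c \<tau>) (A.orb g) \<le> R \<longrightarrow> d1 (c \<tau>') (A.orb h) \<le> R \<longrightarrow>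
         d2 (B.orb g) (c' \<sigma>) \<le> \<kappa> \<longrightarrow> d2 (B.orb h) (c' \<sigma>') \<le> \<kappa> \<longrightarrow> \<sigma> - \<sigma>' \<le> 3 * \<kappa>)"
    using geodesic_transfer[of R] by blast
  obtain D where D: "D > 0" "\<And>c \<tau>. B.geodesic_line c \<Longrightarrow> \<exists>\<sigma>. \<tau> \<le> \<sigma> \<and> \<sigma> \<le> \<tau> + D \<and> c \<sigma> \<in> B.V"
    using B.branch_on_line by blast
  obtain \<Lambda> where \<Lambda>: "0 \<le> \<Lambda>" "\<forall>g\<in>A.F. \<forall>h\<in>A.F. d2 (B.orb g) (B.orb h) \<le> \<Lambda> * (d1 (A.orb g) (A.orb h) + 1)"
    using orb_Lipschitz by blast
  obtain \<epsilon>1 D1 where D1: "\<epsilon>1 > 0" "D1 > 0" "\<And>u \<delta> v. \<lbrakk>A.edge_chain u \<delta> v; u \<in> M1; v \<in> M1\<rbrakk>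
      \<Longrightarrow> \<epsilon>1 * real (length \<delta>) \<le> d1 u v \<and> d1 u v \<le> D1 * real (length \<delta>)"
    using A.edge_chain_length_bounds by blast
  obtain \<epsilon>2 D2 where D2: "\<epsilon>2 > 0" "D2 > 0" "\<And>u \<delta> v. \<lbrakk>B.edge_chain u \<delta> v; u \<in> M2; v \<in> M2\<rbrakk>
      \<Longrightarrow> \<epsilon>2 * real (length \<delta>) \<le> d2 u v \<and> d2 u v \<le> D2 * real (length \<delta>)"
    using B.edge_chain_length_bounds by blast
  define E where "E = 4 * \<kappa> + 1 + D"
  define C where "C = (2 * E + \<Lambda> * (2 * R + 1 + D1)) / \<epsilon>2"
  show thesis
  proof (rule that[of R E C])
    fix L \<gamma> assume L: "algebraic_lamination r L" "\<gamma> \<in> A.language L"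
    then obtain p q c s t \<delta> where c: "(p, q) \<in> L" "geodesic_from_to M1 d1 \<phi>1 p q c" "s \<le> t"
      and \<delta>: "A.edge_chain (c s) \<delta> (c t)" "\<delta> \<noteq> []" "\<gamma> = map (edge_orbit r \<phi>1) \<delta>"
      by (rule A.languageE)
    have uM: "c s \<in> M1" "c t \<in> M1" using c(2) by (auto simp: geodesic_from_to_def)
    obtain g where g: "g \<in> A.F" "d1 (c s) (A.orb g) \<le> R" using R[OF uM(1)] by blast
    obtain h where h: "h \<in> A.F" "d1 (c t) (A.orb h) \<le> R" using R[OF uM(2)] by blast
    obtain c' where c': "geodesic_from_to M2 d2 \<phi>2 p q c'"
      and near: "\<forall>g\<in>A.F. \<forall>\<tau>. d1 (c \<tau>) (A.orb g) \<le> R \<longrightarrow> (\<exists>\<sigma>. d2 (B.orb g) (c' \<sigma>) \<le> \<kappa>)"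
      and order: "\<forall>g\<in>A.F. \<forall>h\<in>A.F. \<forall>\<tau> \<tau>' \<sigma> \<sigma>'. \<tau> \<le> \<tau>' \<longrightarrow> d1 (c \<tau>) (A.orb g) \<le> R \<longrightarrow> d1 (c \<tau>') (A.orb h)
          \<le> R \<longrightarrow>
         d2 (B.orb g) (c' \<sigma>) \<le> \<kappa> \<longrightarrow> d2 (B.orb h) (c' \<sigma>') \<le> \<kappa> \<longrightarrow> \<sigma> - \<sigma>' \<le> 3 * \<kappa>"
      using \<kappa>[OF L(1) c(1,2)] by blast
    have line: "B.geodesic_line c'" using c' by (auto simp: geodesic_from_to_def B.geodesic_line_def)
    have c'M: "c' x \<in> M2" for x using B.geodesic_line_in[OF line] .
    obtain \<sigma> where \<sigma>: "d2 (B.orb g) (c' \<sigma>) \<le> \<kappa>" using near g by blast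
    obtain \<sigma>' where \<sigma>': "d2 (B.orb h) (c' \<sigma>') \<le> \<kappa>" using near h by blast
    have ord: "\<sigma> - \<sigma>' \<le> 3 * \<kappa>" using order g h c(3) \<sigma> \<sigma>' by blast
    have \<kappa>0: "0 \<le> \<kappa>" using \<sigma> B.nonneg order_trans by blast
    obtain a where a: "\<sigma> - D \<le> a" "a \<le> \<sigma>" "c' a \<in> B.V" using D(2)[OF line, of "\<sigma> - D"] by auto
    define m where "m = max \<sigma> \<sigma>' + 1"
    obtain b where b: "m \<le> b" "b \<le> m + D" "c' b \<in> B.V" using D(2)[OF line, of m] by auto
    have ab: "a < b" using a b by (simp add: m_def)
    obtain \<delta>' where \<delta>': "B.edge_chain (c' a) \<delta>' (c' b)" using B.edge_chain_exists a b by blast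
    have ne: "\<delta>' \<noteq> []"
    proof
      assume "\<delta>' = []"
      then have "c' a = c' b" using \<delta>' by simp
      then have "d2 (c' a) (c' b) = 0" using c'M by simp
      then show False using ab by (simp add: B.geodesic_line_dist[OF line])
    qed
    have lang: "map (edge_orbit r \<phi>2) \<delta>' \<in> B.language L"
      using ab by (intro B.languageI[OF c(1) c' _ \<delta>' ne a(3)]) simp
    have dg: "d2 (c' a) (B.orb g) \<le> E"
    proof -
      have "d2 (c' a) (B.orb g) \<le> d2 (c' a) (c' \<sigma>) + d2 (c' \<sigma>) (B.orb g)" using c'M g by (intro
          B.triangle) auto
      then show ?thesis using \<sigma> a \<kappa>0 B.commute[of "c' \<sigma>"] by (simp add: B.geodesic_line_dist[OF
          line] E_def)
    qed
    have dh: "d2 (c' b) (B.orb h) \<le> E"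
    proof -
      have "d2 (c' b) (B.orb h) \<le> d2 (c' b) (c' \<sigma>') + d2 (c' \<sigma>') (B.orb h)" using c'M h by (intro
          B.triangle) auto
      moreover have "d2 (c' b) (c' \<sigma>') = b - \<sigma>'" using b by (simp add: B.geodesic_line_dist[OF line]
          m_def)
      moreover have "b - \<sigma>' \<le> 3 * \<kappa> + 1 + D" using b ord \<kappa>0 by (auto simp: m_def max_def split:
          if_splits)
      ultimately show ?thesis using \<sigma>' B.commute[of "c' \<sigma>'"] by (simp add: E_def)
    qed
    have len: "real (length \<delta>') \<le> C * real (length \<delta>)"
    proof -
      have len1: "1 \<le> real (length \<delta>)" using \<delta>(2) by (cases \<delta>) auto
      have E0: "0 \<le> E" using dg B.nonneg order_trans by blast
      have "d1 (A.orb g) (A.orb h) \<le> d1 (A.orb g) (c s) + (d1 (c s) (c t) + d1 (c t) (A.orb h))"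
        using A.triangle[of "A.orb g" "c s" "A.orb h"] A.triangle[of "c s" "c t" "A.orb h"] uM g h
            by auto
      also have "\<dots> \<le> 2 * R + D1 * real (length \<delta>)"
        using g h D1(3)[OF \<delta>(1) uM] A.commute[of "A.orb g" "c s"] by simp
      finally have "d1 (A.orb g) (A.orb h) + 1 \<le> 2 * R + 1 + D1 * real (length \<delta>)" by simp
      then have "\<Lambda> * (d1 (A.orb g) (A.orb h) + 1) \<le> \<Lambda> * (2 * R + 1 + D1 * real (length \<delta>))"
        using \<Lambda>(1) by (rule mult_left_mono)
      also have "\<dots> \<le> \<Lambda> * ((2 * R + 1 + D1) * real (length \<delta>))"
      proof (intro mult_left_mono \<Lambda>(1))
        have "(2 * R + 1) * 1 \<le> (2 * R + 1) * real (length \<delta>)" using R0 len1 by (intro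
            mult_left_mono) auto
        then show "2 * R + 1 + D1 * real (length \<delta>) \<le> (2 * R + 1 + D1) * real (length \<delta>)"
          by (simp add: algebra_simps)
      qed
      finally have lip: "d2 (B.orb g) (B.orb h) \<le> \<Lambda> * ((2 * R + 1 + D1) * real (length \<delta>))"
        using \<Lambda>(2) g h by force
      have "\<epsilon>2 * real (length \<delta>') \<le> d2 (c' a) (c' b)" using D2(3)[OF \<delta>' c'M c'M] by simp
      also have "\<dots> \<le> d2 (c' a) (B.orb g) + (d2 (B.orb g) (B.orb h) + d2 (B.orb h) (c' b))"
        using B.triangle[of "c' a" "B.orb g" "c' b"] B.triangle[of "B.orb g" "B.orb h" "c' b"] c'M g
            h by auto
      also have "\<dots> \<le> 2 * E * 1 + \<Lambda> * ((2 * R + 1 + D1) * real (length \<delta>))"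
        using dg dh lip B.commute[of "B.orb h"] by simp
      also have "\<dots> \<le> 2 * E * real (length \<delta>) + \<Lambda> * ((2 * R + 1 + D1) * real (length \<delta>))"
        using len1 E0 by (intro add_right_mono mult_left_mono) auto
      finally show ?thesis unfolding C_def using D2(1) by (simp add: field_simps)
    qed
    show "\<exists>u v \<delta> u' v' \<delta>' g h. u \<in> M1 \<and> v \<in> M1 \<and> A.edge_chain u \<delta> v \<and> \<delta> \<noteq> [] \<and> \<gamma> = map (edge_orbit r
        \<phi>1) \<delta> \<and>
      u' \<in> M2 \<and> v' \<in> M2 \<and> B.edge_chain u' \<delta>' v' \<and> \<delta>' \<noteq> [] \<and> map (edge_orbit r \<phi>2) \<delta>' \<in> B.language L \<and>
      g \<in> A.F \<and> h \<in> A.F \<and> d1 u (A.orb g) \<le> R \<and> d1 v (A.orb h) \<le> R \<and>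
      d2 u' (B.orb g) \<le> E \<and> d2 v' (B.orb h) \<le> E \<and> real (length \<delta>') \<le> C * real (length \<delta>)"
      using uM \<delta> c'M \<delta>' ne lang g h dg dh len
      by (intro exI[of _ "c s"] exI[of _ "c t"] exI[of _ \<delta>] exI[of _ "c' a"] exI[of _ "c' b"]
          exI[of _ \<delta>'] exI[of _ g] exI[of _ h] conjI) assumption+
  qed
qed

lemma language_map:
  obtains K C where "K \<ge> 1" "C > 0" "\<And>L. algebraic_lamination r L \<Longrightarrow>
    \<exists>\<Psi>. (\<forall>\<gamma>\<in>A.language L. \<Psi> \<gamma> \<in> B.language L \<and> real (length (\<Psi> \<gamma>)) \<le> C * real (length \<gamma>)) \<and>
      (\<forall>\<gamma>'. finite {\<gamma> \<in> A.language L. \<Psi> \<gamma> = \<gamma>'} \<and> card {\<gamma> \<in> A.language L. \<Psi> \<gamma> = \<gamma>'} \<le> K)"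
proof -
  interpret S: cv_trees r M2 d2 \<phi>2 M1 d1 \<phi>1 ..
  obtain R E C where T: "\<And>L \<gamma>. \<lbrakk>algebraic_lamination r L; \<gamma> \<in> A.language L\<rbrakk> \<Longrightarrow>
    \<exists>u v \<delta> u' v' \<delta>' g h. u \<in> M1 \<and> v \<in> M1 \<and> A.edge_chain u \<delta> v \<and> \<delta> \<noteq> [] \<and> \<gamma> = map (edge_orbit r \<phi>1) \<delta> \<and>
      u' \<in> M2 \<and> v' \<in> M2 \<and> B.edge_chain u' \<delta>' v' \<and> \<delta>' \<noteq> [] \<and> map (edge_orbit r \<phi>2) \<delta>' \<in> B.language L \<and>
      g \<in> A.F \<and> h \<in> A.F \<and> d1 u (A.orb g) \<le> R \<and> d1 v (A.orb h) \<le> R \<and>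
      d2 u' (B.orb g) \<le> E \<and> d2 v' (B.orb h) \<le> E \<and> real (length \<delta>') \<le> C * real (length \<delta>)"
    by (rule language_transfer, rule that)
  obtain \<sigma> where \<sigma>: "\<forall>g\<in>A.F. \<forall>h\<in>A.F. d2 (B.orb g) (B.orb h) \<le> 2 * E \<longrightarrow> d1 (A.orb g) (A.orb h) \<le> \<sigma>"
    using S.orb_control by blast
  define W where "W g = {z \<in> A.V. d1 z (A.orb g) \<le> R + \<sigma>}" for g
  obtain K where K: "\<And>g. g \<in> A.F \<Longrightarrow> finite (W g) \<and> card (W g) \<le> K"
    using A.branch_ball_card[of "R + \<sigma>"] unfolding W_def by blast
  show thesis
  proof (rule that[of "max (K * K) 1" "max C 1"])
    fix L assume L: "algebraic_lamination r L"
    define P where "P \<gamma> u v \<delta> u' v' \<delta>' g h \<longleftrightarrow> u \<in> M1 \<and> v \<in> M1 \<and> A.edge_chain u \<delta> v \<and> \<delta> \<noteq> [] \<and> \<gamma> = map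
        (edge_orbit r \<phi>1) \<delta> \<and>
      u' \<in> M2 \<and> v' \<in> M2 \<and> B.edge_chain u' \<delta>' v' \<and> \<delta>' \<noteq> [] \<and> map (edge_orbit r \<phi>2) \<delta>' \<in> B.language L \<and>
      g \<in> A.F \<and> h \<in> A.F \<and> d1 u (A.orb g) \<le> R \<and> d1 v (A.orb h) \<le> R \<and>
      d2 u' (B.orb g) \<le> E \<and> d2 v' (B.orb h) \<le> E \<and> real (length \<delta>') \<le> C * real (length \<delta>)"
      for \<gamma> u v \<delta> u' v' \<delta>' g h
    have "\<forall>\<gamma>\<in>A.language L. \<exists>\<delta>' u v \<delta> u' v' g h. P \<gamma> u v \<delta> u' v' \<delta>' g h"
    proof
      fix \<gamma> assume "\<gamma> \<in> A.language L"
      from T[OF L this] show "\<exists>\<delta>' u v \<delta> u' v' g h. P \<gamma> u v \<delta> u' v' \<delta>' g h"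
        unfolding P_def by (elim exE) (intro exI, assumption)
    qed
    from bchoice[OF this] obtain \<Delta> where \<Delta>:
      "\<forall>\<gamma>\<in>A.language L. \<exists>u v \<delta> u' v' g h. P \<gamma> u v \<delta> u' v' (\<Delta> \<gamma>) g h" ..
    define \<Psi> where "\<Psi> \<gamma> = map (edge_orbit r \<phi>2) (\<Delta> \<gamma>)" for \<gamma>
    have 1: "\<Psi> \<gamma> \<in> B.language L \<and> real (length (\<Psi> \<gamma>)) \<le> max C 1 * real (length \<gamma>)"
      if \<gamma>: "\<gamma> \<in> A.language L" for \<gamma>
    proof -
      obtain u v \<delta> u' v' g h where P: "P \<gamma> u v \<delta> u' v' (\<Delta> \<gamma>) g h" using \<Delta> \<gamma> by blast
      then have "real (length (\<Delta> \<gamma>)) \<le> C * real (length \<delta>)" "length \<delta> = length \<gamma>" unfolding P_def by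
          auto
      moreover have "C * real (length \<gamma>) \<le> max C 1 * real (length \<gamma>)" by (intro mult_right_mono) auto
      moreover have "map (edge_orbit r \<phi>2) (\<Delta> \<gamma>) \<in> B.language L" using P unfolding P_def by blast
      ultimately show ?thesis by (simp add: \<Psi>_def)
    qed
    have 2: "finite {\<gamma> \<in> A.language L. \<Psi> \<gamma> = \<gamma>'} \<and> card {\<gamma> \<in> A.language L. \<Psi> \<gamma> = \<gamma>'} \<le> K * K" for \<gamma>'
    proof (cases "{\<gamma> \<in> A.language L. \<Psi> \<gamma> = \<gamma>'} = {}")
      case False
      then obtain \<gamma>0 where \<gamma>0: "\<gamma>0 \<in> A.language L" "\<Psi> \<gamma>0 = \<gamma>'" by blast
      obtain u0 v0 \<delta>0 u0' v0' g0 h0 where P0: "P \<gamma>0 u0 v0 \<delta>0 u0' v0' (\<Delta> \<gamma>0) g0 h0" using \<Delta> \<gamma>0 by blast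
      have "{\<gamma> \<in> A.language L. \<Psi> \<gamma> = \<gamma>'} \<subseteq> A.path_between ` (W g0 \<times> W h0)"
      proof clarify
        fix \<gamma> assume \<gamma>: "\<gamma> \<in> A.language L" "\<gamma>' = \<Psi> \<gamma>"
        obtain u v \<delta> u' v' g h where P: "P \<gamma> u v \<delta> u' v' (\<Delta> \<gamma>) g h" using \<Delta> \<gamma> by blast
        have "map (edge_orbit r \<phi>2) (\<Delta> \<gamma>0) = map (edge_orbit r \<phi>2) (\<Delta> \<gamma>)"
          using \<gamma> \<gamma>0 by (simp add: \<Psi>_def)
        then obtain k where k: "k \<in> A.F" "u' = \<phi>2 k u0'" "v' = \<phi>2 k v0'"
          using B.edge_chain_same_orbits[of u0' "\<Delta> \<gamma>0" v0' u' "\<Delta> \<gamma>" v'] P P0 unfolding P_def by blast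
        let ?k = "inv\<^bsub>free_group r\<^esub> k"
        have move: "\<phi>1 ?k x \<in> W f0"
          if x: "x \<in> A.V" "x' = \<phi>2 k x0'" "x0' \<in> M2" "f \<in> A.F" "f0 \<in> A.F" "d1 x (A.orb f) \<le> R"
            "d2 x' (B.orb f) \<le> E" "d2 x0' (B.orb f0) \<le> E" for x x' x0' f f0
        proof -
          have xM: "x \<in> M1" using x A.branch_subset by auto
          let ?kf = "k \<otimes>\<^bsub>free_group r\<^esub> f0"
          have kf: "?kf \<in> A.F" using k x by simp
          have "d2 (B.orb f) (B.orb ?kf) \<le> d2 (B.orb f) x' + d2 x' (B.orb ?kf)"
            using x k kf by (intro B.triangle) (auto simp: B.act_closed)
          also have "d2 x' (B.orb ?kf) = d2 x0' (B.orb f0)"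
            using x k by (simp add: B.act_mult B.act_isometry)
          finally have "d2 (B.orb f) (B.orb ?kf) \<le> 2 * E" using x B.commute[of "B.orb f" x'] by simp
          then have "d1 (A.orb f) (A.orb ?kf) \<le> \<sigma>" using \<sigma> x kf by blast
          moreover have "d1 x (A.orb ?kf) \<le> d1 x (A.orb f) + d1 (A.orb f) (A.orb ?kf)"
            using xM x kf by (intro A.triangle) auto
          moreover have "d1 (\<phi>1 ?k x) (A.orb f0) = d1 x (A.orb ?kf)"
            using A.act_isometry[of k "\<phi>1 ?k x" "A.orb f0"] k x xM
            by (simp add: A.act_inv' A.act_mult A.act_closed)
          ultimately have "d1 (\<phi>1 ?k x) (A.orb f0) \<le> R + \<sigma>" using x by linarith
          moreover have "\<phi>1 ?k x \<in> A.V" using A.branch_act[of ?k x] k x by simp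
          ultimately show ?thesis by (simp add: W_def)
        qed
        have uv: "u \<in> A.V" "v \<in> A.V"
          using A.edge_chain_ends[of u \<delta> v] P unfolding P_def by blast+
        have kF: "?k \<in> A.F" using k by simp
        have "\<phi>1 ?k u \<in> W g0" "\<phi>1 ?k v \<in> W h0"
          using move[OF uv(1) k(2)] move[OF uv(2) k(3)] P P0 unfolding P_def by blast+
        moreover have "A.path_between (\<phi>1 ?k u, \<phi>1 ?k v) = \<gamma>"
        proof -
          have uM: "u \<in> M1" "v \<in> M1" and \<delta>: "A.edge_chain u \<delta> v" "\<gamma> = map (edge_orbit r \<phi>1) \<delta>"
            using P unfolding P_def by auto
          have "A.path_between (\<phi>1 ?k u, \<phi>1 ?k v) = map (edge_orbit r \<phi>1) (map (map_prod (\<phi>1 ?k) (\<phi>1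
              ?k)) \<delta>)"
            using A.edge_chain_act[OF \<delta>(1) kF uM] kF uM by (intro A.path_between A.act_closed)
          then show ?thesis using A.edge_orbit_act_list[OF kF A.edge_chain_arcs[OF \<delta>(1)]] \<delta>(2) by simp
        qed
        ultimately show "\<gamma> \<in> A.path_between ` (W g0 \<times> W h0)" by force
      qed
      moreover have W: "finite (W g0)" "finite (W h0)" "card (W g0) \<le> K" "card (W h0) \<le> K"
        using K P0 unfolding P_def by blast+
      moreover have "card (A.path_between ` (W g0 \<times> W h0)) \<le> K * K"
      proof -
        have "card (A.path_between ` (W g0 \<times> W h0)) \<le> card (W g0 \<times> W h0)" using W by (intro
            card_image_le) auto
        also have "\<dots> \<le> K * K" using W by (simp add: card_cartesian_product mult_le_mono)
        finally show ?thesis .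
      qed
      ultimately show ?thesis
        by (meson card_mono finite_SigmaI finite_imageI finite_subset order_trans)
    qed (simp only: finite.emptyI card.empty zero_le simp_thms)
    have "\<forall>\<gamma>'. finite {\<gamma> \<in> A.language L. \<Psi> \<gamma> = \<gamma>'} \<and> card {\<gamma> \<in> A.language L. \<Psi> \<gamma> = \<gamma>'} \<le> max (K * K) 1"
      using 2 by (meson max.cobounded1 order_trans)
    with 1 show "\<exists>\<Psi>. (\<forall>\<gamma>\<in>A.language L. \<Psi> \<gamma> \<in> B.language L \<and> real (length (\<Psi> \<gamma>)) \<le> max C 1 * real
        (length \<gamma>)) \<and>
      (\<forall>\<gamma>'. finite {\<gamma> \<in> A.language L. \<Psi> \<gamma> = \<gamma>'} \<and> card {\<gamma> \<in> A.language L. \<Psi> \<gamma> = \<gamma>'} \<le> max (K * K) 1)"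
      by blast
  qed auto
qed

lemma complexity_le:
  assumes L: "algebraic_lamination r L"
  obtains C where "C \<ge> 1" "\<And>n m. \<lbrakk>n \<ge> 1; C * n \<le> m\<rbrakk> \<Longrightarrow>
    complexity r M1 d1 \<phi>1 L n \<le> C * complexity r M2 d2 \<phi>2 L m \<and>
    metric_complexity r M1 d1 \<phi>1 L n \<le> C * metric_complexity r M2 d2 \<phi>2 L m"
proof -
  obtain K C0 where K: "K \<ge> 1" "C0 > 0" "\<And>L. algebraic_lamination r L \<Longrightarrow>
    \<exists>\<Psi>. (\<forall>\<gamma>\<in>A.language L. \<Psi> \<gamma> \<in> B.language L \<and> real (length (\<Psi> \<gamma>)) \<le> C0 * real (length \<gamma>)) \<and>
      (\<forall>\<gamma>'. finite {\<gamma> \<in> A.language L. \<Psi> \<gamma> = \<gamma>'} \<and> card {\<gamma> \<in> A.language L. \<Psi> \<gamma> = \<gamma>'} \<le> K)"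
    by (rule language_map, rule that)
  obtain \<Psi> where \<Psi>: "\<And>\<gamma>. \<gamma> \<in> A.language L \<Longrightarrow> \<Psi> \<gamma> \<in> B.language L"
    "\<And>\<gamma>. \<gamma> \<in> A.language L \<Longrightarrow> real (length (\<Psi> \<gamma>)) \<le> C0 * real (length \<gamma>)"
    "\<And>\<gamma>'. finite {\<gamma> \<in> A.language L. \<Psi> \<gamma> = \<gamma>'}" "\<And>\<gamma>'. card {\<gamma> \<in> A.language L. \<Psi> \<gamma> = \<gamma>'} \<le> K"
    using K(3)[OF L] by blast
  obtain \<epsilon>1 D1 where b1: "\<epsilon>1 > 0" "D1 > 0" "\<And>L \<gamma>. \<lbrakk>algebraic_lamination r L; \<gamma> \<in> A.language L\<rbrakk> \<Longrightarrow>
     \<epsilon>1 * real (length \<gamma>) \<le> path_length d1 \<gamma> \<and> path_length d1 \<gamma> \<le> D1 * real (length \<gamma>)"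
    using A.path_length_bounds by metis
  obtain \<epsilon>2 D2 where b2: "\<epsilon>2 > 0" "D2 > 0" "\<And>L \<gamma>. \<lbrakk>algebraic_lamination r L; \<gamma> \<in> B.language L\<rbrakk> \<Longrightarrow>
     \<epsilon>2 * real (length \<gamma>) \<le> path_length d2 \<gamma> \<and> path_length d2 \<gamma> \<le> D2 * real (length \<gamma>)"
    using B.path_length_bounds by metis
  obtain C1 where C1: "max (real K) (max C0 (D2 * C0 / \<epsilon>1)) \<le> real C1" using real_arch_simple by blast
  have fiber: "card S \<le> C1 * card T" if "S \<subseteq> A.language L" "finite T" "\<And>\<gamma>. \<gamma> \<in> S \<Longrightarrow> \<Psi> \<gamma> \<in> T" for S T
  proof -
    have "card {\<gamma> \<in> S. \<Psi> \<gamma> = \<gamma>'} \<le> K" for \<gamma>'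
    proof -
      have "card {\<gamma> \<in> S. \<Psi> \<gamma> = \<gamma>'} \<le> card {\<gamma> \<in> A.language L. \<Psi> \<gamma> = \<gamma>'}"
        using that(1) \<Psi>(3) by (intro card_mono) auto
      then show ?thesis using \<Psi>(4) order_trans by blast
    qed
    then have "card S \<le> K * card T" using that by (intro card_le_fibers) auto
    also have "\<dots> \<le> C1 * card T" using C1 by (intro mult_right_mono) auto
    finally show ?thesis .
  qed
  show thesis
  proof (rule that[of C1])
    show "C1 \<ge> 1" using C1 K(1) by simp
    fix n m :: nat assume nm: "n \<ge> 1" "C1 * n \<le> m"
    have m1: "m \<noteq> 0" using nm \<open>C1 \<ge> 1\<close> by (metis One_nat_def le_zero_eq mult_is_0 not_one_le_zero)
    have nm': "real C1 * real n \<le> real m" using nm(2) by (metis of_nat_le_iff of_nat_mult)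
    have "card {\<gamma> \<in> A.language L. length \<gamma> \<le> n} \<le> C1 * card {\<gamma> \<in> B.language L. length \<gamma> \<le> m}"
    proof (rule fiber[OF _ B.finite_language_length])
      fix \<gamma> assume "\<gamma> \<in> {\<gamma> \<in> A.language L. length \<gamma> \<le> n}"
      then have \<gamma>: "\<gamma> \<in> A.language L" "real (length \<gamma>) \<le> real n" by auto
      have "real (length (\<Psi> \<gamma>)) \<le> C0 * real (length \<gamma>)" by (rule \<Psi>(2)[OF \<gamma>(1)])
      also have "\<dots> \<le> real C1 * real n" using C1 \<gamma> K(2) by (intro mult_mono) auto
      also have "\<dots> \<le> real m" by (rule nm')
      finally show "\<Psi> \<gamma> \<in> {\<gamma> \<in> B.language L. length \<gamma> \<le> m}" using \<Psi>(1)[OF \<gamma>(1)] by simp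
    qed auto
    moreover have "card {\<gamma> \<in> A.language L. path_length d1 \<gamma> \<le> real n}
        \<le> C1 * card {\<gamma> \<in> B.language L. path_length d2 \<gamma> \<le> real m}"
    proof (rule fiber)
      have "{\<gamma> \<in> B.language L. path_length d2 \<gamma> \<le> real m} \<subseteq> {\<gamma> \<in> B.language L. length \<gamma> \<le> nat \<lceil>real
          m / \<epsilon>2\<rceil>}"
      proof clarify
        fix \<gamma> assume \<gamma>: "\<gamma> \<in> B.language L" "path_length d2 \<gamma> \<le> real m"
        then have "\<epsilon>2 * real (length \<gamma>) \<le> real m" using b2(3)[OF L] by force
        then have "real (length \<gamma>) \<le> real m / \<epsilon>2" using b2(1) by (simp add: field_simps)
        then show "length \<gamma> \<le> nat \<lceil>real m / \<epsilon>2\<rceil>" by linarith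
      qed
      then show "finite {\<gamma> \<in> B.language L. path_length d2 \<gamma> \<le> real m}"
        using B.finite_language_length finite_subset by blast
      fix \<gamma> assume "\<gamma> \<in> {\<gamma> \<in> A.language L. path_length d1 \<gamma> \<le> real n}"
      then have \<gamma>: "\<gamma> \<in> A.language L" "path_length d1 \<gamma> \<le> real n" by auto
      have "\<epsilon>1 * real (length \<gamma>) \<le> real n" using b1(3)[OF L \<gamma>(1)] \<gamma>(2) by linarith
      then have len: "real (length \<gamma>) \<le> real n / \<epsilon>1" using b1(1) by (simp add: field_simps)
      have "C0 * real (length \<gamma>) \<le> C0 * (real n / \<epsilon>1)" using len K(2) by (intro mult_left_mono) auto
      then have len': "real (length (\<Psi> \<gamma>)) \<le> C0 * (real n / \<epsilon>1)" using \<Psi>(2)[OF \<gamma>(1)] by linarith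
      have "path_length d2 (\<Psi> \<gamma>) \<le> D2 * real (length (\<Psi> \<gamma>))" using b2(3)[OF L \<Psi>(1)[OF \<gamma>(1)]] by simp
      also have "\<dots> \<le> D2 * (C0 * (real n / \<epsilon>1))"
        using len' b2(2) by (intro mult_left_mono) auto
      also have "\<dots> = (D2 * C0 / \<epsilon>1) * real n" by simp
      also have "\<dots> \<le> real C1 * real n" using C1 by (intro mult_right_mono) auto
      also have "\<dots> \<le> real m" by (rule nm')
      finally show "\<Psi> \<gamma> \<in> {\<gamma> \<in> B.language L. path_length d2 \<gamma> \<le> real m}" using \<Psi>(1)[OF \<gamma>(1)] by simp
    qed auto
    ultimately show "complexity r M1 d1 \<phi>1 L n \<le> C1 * complexity r M2 d2 \<phi>2 L m \<and>
      metric_complexity r M1 d1 \<phi>1 L n \<le> C1 * metric_complexity r M2 d2 \<phi>2 L m"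
      using nm m1 by (simp add: complexity_def metric_complexity_def)
  qed
qed

end

theorem corollary5p8:
  fixes r :: nat
    and L :: "(bdry_point \<times> bdry_point) set"
    and M1 :: "'a set" and d1 :: "'a \<Rightarrow> 'a \<Rightarrow> real" and \<phi>1 :: "word \<Rightarrow> 'a \<Rightarrow> 'a"
    and M2 :: "'b set" and d2 :: "'b \<Rightarrow> 'b \<Rightarrow> real" and \<phi>2 :: "word \<Rightarrow> 'b \<Rightarrow> 'b"
  assumes "r \<ge> 2"
    and "algebraic_lamination r L"
    and "outer_space_tree r M1 d1 \<phi>1"
    and "outer_space_tree r M2 d2 \<phi>2"
  shows "growth_equiv (complexity r M1 d1 \<phi>1 L) (complexity r M2 d2 \<phi>2 L) \<and>
         growth_equiv (metric_complexity r M1 d1 \<phi>1 L) (metric_complexity r M2 d2 \<phi>2 L)"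
proof -
  interpret A: cv_tree r M1 d1 \<phi>1 using assms by unfold_locales auto
  interpret B: cv_tree r M2 d2 \<phi>2 using assms by unfold_locales auto
  interpret AB: cv_trees r M1 d1 \<phi>1 M2 d2 \<phi>2 ..
  interpret BA: cv_trees r M2 d2 \<phi>2 M1 d1 \<phi>1 ..
  obtain C where C: "C \<ge> 1" "\<And>n m. \<lbrakk>n \<ge> 1; C * n \<le> m\<rbrakk> \<Longrightarrow>
    complexity r M1 d1 \<phi>1 L n \<le> C * complexity r M2 d2 \<phi>2 L m \<and>
    metric_complexity r M1 d1 \<phi>1 L n \<le> C * metric_complexity r M2 d2 \<phi>2 L m"
    using AB.complexity_le[OF assms(2)] by blast
  obtain C' where C': "C' \<ge> 1" "\<And>n m. \<lbrakk>n \<ge> 1; C' * n \<le> m\<rbrakk> \<Longrightarrow>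
    complexity r M2 d2 \<phi>2 L n \<le> C' * complexity r M1 d1 \<phi>1 L m \<and>
    metric_complexity r M2 d2 \<phi>2 L n \<le> C' * metric_complexity r M1 d1 \<phi>1 L m"
    using BA.complexity_le[OF assms(2)] by blast
  define E where "E = max C C'"
  have E: "E \<ge> 1" "C \<le> E" "C' \<le> E" using C(1) by (auto simp: E_def)
  have grow: "growth_equiv f g"
    if f: "\<And>n m. \<lbrakk>n \<ge> 1; C * n \<le> m\<rbrakk> \<Longrightarrow> f n \<le> C * g m" and g: "\<And>n m. \<lbrakk>n \<ge> 1; C' * n \<le> m\<rbrakk> \<Longrightarrow> g n \<le> C' * f m"
    for f g :: "nat \<Rightarrow> nat"
    unfolding growth_equiv_def
  proof (intro exI[of _ E] conjI allI impI E(1))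
    fix n :: nat assume n: "n \<ge> 1"
    show "f n \<le> E * g (E * n)"
      by (rule order_trans[OF f[OF n mult_le_mono1[OF E(2)]] mult_le_mono1[OF E(2)]])
    show "g n \<le> E * f (E * n)"
      by (rule order_trans[OF g[OF n mult_le_mono1[OF E(3)]] mult_le_mono1[OF E(3)]])
  qed
  show ?thesis using C(2) C'(2) by (intro conjI grow) blast+
qed

end
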